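(* Let $\Gamma$ be a subgroup of $G$ of type (O) such that the set $\Gamma\smallsetminus\Gamma_\infty$ is of type (F). Suppose that $\mathcal F_\infty$ is a fundamental region for $\Gamma_\infty$ in $D$ satisfying $$\overline{\mathcal F_\infty}\cap\bigcap_{g\in\Gamma\smallsetminus\Gamma_\infty}\overline{\mathrm{Ext}\, I(g)}=\overline{\mathcal F_\infty\cap\bigcap_{g\in\Gamma\smallsetminus\Gamma_\infty}\mathrm{Ext}\, I(g)}.$$ Then $$\mathcal F:=\mathcal F_\infty\cap\bigcap_{g\in\Gamma\smallsetminus\Gamma_\infty}\mathrm{Ext}\, I(g)$$ is a fundamental region for $\Gamma$ in $D$.
   Context: **$J^2C$-module structures.** A $J^2C$-module structure is a triple $(C,V,J)$ of two finite-dimensional real inner product spaces $C,V$ and an $\mathbb R$-bilinear map $J\colon C\times V\to V$, written $J_\zeta v=\zeta v=J(\zeta,v)$, such that (1) there is $e\in C\smallsetminus\{0\}$ with $J(e,v)=v$ for all $v\in V$; (2) $|J(\zeta,v)|=|\zeta||v|$ for all $\zeta\in C$, $v\in V$; (3) $C(Cv)=Cv$ for all $v\in V$, where $Cv=\{\zeta v\mid\zeta\in C\}$ and $C(Cv)=\{\zeta(\eta v)\mid \zeta,\eta\in C\}$. If $V\neq\{0\}$, $e$ is unique and $|e|=1$; if $V=\{0\}$, a unit vector $e\in C$ is fixed as part of the data. Identify $\mathbb Re$ with $\mathbb R$ via $ae\mapsto a$, put $C'=e^\perp$, and for $\zeta=a+z$ with $a\in\mathbb R$, $z\in C'$ put $\mathrm{Re}\,\zeta=a$,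 $\mathrm{Im}\,\zeta=z$, $\overline\zeta=a-z$, and $\zeta^{-1}=|\zeta|^{-2}\overline\zeta$ if $\zeta\ne0$. The map $\beta_2\colon V\times V\to C$ is defined by $\langle\beta_2(v,u),\zeta\rangle=\langle\zeta u,v\rangle$ for all $\zeta\in C$; the bracket $[\cdot,\cdot]\colon V\times V\to C'$ by $\langle z,[x,y]\rangle=\langle J(z,x),y\rangle$ for all $z\in C'$. **The space $D$.** Fix a $J^2C$-module structure with $(C,V)\neq(\mathbb Re,\{0\})$. Let $S=\mathbb R^+\times C'\times V$ be the Lie group with product $(t_1,Z_1,X_1)(t_2,Z_2,X_2)=(t_1t_2,\,Z_1+t_1Z_2+\tfrac12t_1^{1/2}[X_1,X_2],\,X_1+t_1^{1/2}X_2)$ and the left-invariant Riemannian metric which at the identity $(1,0,0)$ is the standard inner product of $\mathbb R\oplus C'\oplus V$. Let $D=\{(\zeta,v)\in C\oplus V\mid \mathrm{Re}\,\zeta>\tfrac14|v|^2\}$ with the Riemannian metric making $S\to D$, $(t,Z,X)\mapsto(t+\tfrac14|X|^2+Z,X)$ an isometry. $D$ is a rank one Riemannian symmetric space of noncompact type (and all such spaces arise this way). $G$ is the full group of Riemannian isometries of $D$; its action extends continuously to $\overline D^g=\{(\zeta,v)\in C\oplus V\mid\mathrm{Re}\,\zeta\geq\tfrac14|v|^2\}\cup\{\infty\}$, the closure of $D$ in the one-point compactification of $C\oplus V$. $G_\infty$ is the stabilizer of $\infty$ in $G$; for a subgroup $\Gamma$, $\Gamma_\infty=\Gamma\cap G_\infty$.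 **Subgroups.** $A=\{a_t\mid t>0\}$ with $a_t(\zeta,v)=(t\zeta,t^{1/2}v)$; $N=\{n_{(Z,X)}\mid Z\in C',X\in V\}$ with $n_{(Z,X)}(\zeta,v)=(\tfrac14|X|^2+Z+\zeta+\tfrac12\beta_2(v,X),X+v)$; $M$ is the group of pairs $(\varphi,\psi)$ of orthogonal maps $\varphi\colon C\to C$, $\psi\colon V\to V$ with $\varphi(e)=e$ and $\psi(\zeta v)=\varphi(\zeta)\psi(v)$, acting by $(\varphi,\psi)(\zeta,v)=(\varphi(\zeta),\psi(v))$; all fix $\infty$. The geodesic inversion is $\sigma(\zeta,v)=(\zeta^{-1},-\zeta^{-1}v)$, $\sigma 0=\infty$, $\sigma\infty=0$. One has $G_\infty=MAN$, and each $g\in G\smallsetminus G_\infty$ is uniquely of the form $g=n_1\sigma ma_tn_2$ with $n_1,n_2\in N$, $m\in M$, $a_t\in A$. **Isometric spheres.** The height is $\mathrm{ht}(\zeta,v)=\mathrm{Re}\,\zeta-\tfrac14|v|^2$. The Cygan metric on $\overline D^g\smallsetminus\{\infty\}$ is, for $z_j=(\zeta_j,v_j)$, $\varrho(z_1,z_2)=\big|\tfrac14|v_1|^2+\tfrac14|v_2|^2+|\mathrm{ht}(z_1)-\mathrm{ht}(z_2)|+\mathrm{Im}\,\zeta_1-\mathrm{Im}\,\zeta_2-\tfrac12\beta_2(v_1,v_2)\big|^{1/2}$. For $g=n_1\sigma ma_tn_2\in G\smallsetminus G_\infty$ put $R(g)=t^{-1/4}$, and let $I(g)$, $\mathrm{Ext}\,I(g)$,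 $\mathrm{Int}\,I(g)$ be the sets of $z\in D$ with $\varrho(z,g^{-1}\infty)=R(g)$, $>R(g)$, $<R(g)$, respectively. **Types and fundamental regions.** A subgroup $\Gamma$ of $G$ is of type (O) if $\bigcap_{g\in\Gamma\smallsetminus\Gamma_\infty}\mathrm{Ext}\,I(g)=D\smallsetminus\overline{\bigcup_{g\in\Gamma\smallsetminus\Gamma_\infty}\mathrm{Int}\,I(g)}$. A subset $T\subseteq G$ is of type (F) if for each $z\in D$ the maximum of $\{\mathrm{ht}(gz)\mid g\in\langle T\rangle\}$ exists, where $\langle T\rangle$ is the subgroup generated by $T$. A fundamental region for a subgroup $\Gamma$ in $D$ is an open set $Y\subseteq D$ such that the translates of $Y$ by any two distinct elements of $\Gamma$ are disjoint and $D=\bigcup_{g\in\Gamma}g\overline Y$. Closures are taken in $D$; an intersection over the empty index set is $D$. *)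

theory Defs
  imports
    "HOL-Analysis.Analysis"
    "HOL-Algebra.Bij"
    "HOL-Algebra.Generated_Groups"
begin

subsection \<open>\<open>J\<^sup>2C\<close>-module structures\<close>

text \<open>
  \<open>C\<close> and \<open>V\<close> are types. \<open>C\<close> is never zero, since it contains \<open>e\<close>. The library class
  \<open>euclidean_space\<close> excludes the zero space, and \<open>V = {0}\<close> must be admitted, so \<open>V\<close> only has
  class \<open>real_inner\<close> and its finite dimension is an axiom. The type \<open>unit\<close>, made an inner product
  space at the end of this theory, is a model of \<open>V = {0}\<close>.

  The unit \<open>e\<close> is a parameter: the condition \<open>norm e = 1\<close> follows from the other axioms if
  \<open>V \<noteq> {0}\<close>, and a unit vector is part of the data if \<open>V = {0}\<close>.
\<close>

definition J2C_module :: "('c::euclidean_space \<Rightarrow> 'v::real_inner \<Rightarrow> 'v) \<Rightarrow> 'c \<Rightarrow> bool" where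
  "J2C_module J e \<longleftrightarrow>
     (\<exists>B. finite B \<and> span B = (UNIV :: 'v set)) \<and>
     bilinear J \<and>
     norm e = 1 \<and> (\<forall>v. J e v = v) \<and>
     (\<forall>\<zeta> v. norm (J \<zeta> v) = norm \<zeta> * norm v) \<and>
     (\<forall>v. {J \<zeta> (J \<eta> v) | \<zeta> \<eta>. True} = {J \<zeta> v | \<zeta>. True})"

definition C_im :: "'c::euclidean_space \<Rightarrow> 'c set" where
  "C_im e = {z. e \<bullet> z = 0}"

definition re_part :: "'c::euclidean_space \<Rightarrow> 'c \<Rightarrow> real" where
  "re_part e \<zeta> = e \<bullet> \<zeta>"

definition im_part :: "'c::euclidean_space \<Rightarrow> 'c \<Rightarrow> 'c" where
  "im_part e \<zeta> = \<zeta> - re_part e \<zeta> *\<^sub>R e"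

definition conj_C :: "'c::euclidean_space \<Rightarrow> 'c \<Rightarrow> 'c" where
  "conj_C e \<zeta> = re_part e \<zeta> *\<^sub>R e - im_part e \<zeta>"

definition inv_C :: "'c::euclidean_space \<Rightarrow> 'c \<Rightarrow> 'c" where
  "inv_C e \<zeta> = (1 / (norm \<zeta>)\<^sup>2) *\<^sub>R conj_C e \<zeta>"

definition beta2 :: "('c::euclidean_space \<Rightarrow> 'v::real_inner \<Rightarrow> 'v) \<Rightarrow> 'v \<Rightarrow> 'v \<Rightarrow> 'c" where
  "beta2 J v u = (THE c. \<forall>\<zeta>. c \<bullet> \<zeta> = J \<zeta> u \<bullet> v)"

definition bracket :: "('c::euclidean_space \<Rightarrow> 'v::real_inner \<Rightarrow> 'v) \<Rightarrow> 'c \<Rightarrow> 'v \<Rightarrow> 'v \<Rightarrow> 'c" where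
  "bracket J e x y = (THE w. w \<in> C_im e \<and> (\<forall>z\<in>C_im e. z \<bullet> w = J z x \<bullet> y))"

subsection \<open>The Lie group \<open>S\<close> with its left-invariant metric\<close>

text \<open>\<open>S\<close> is an open subset of the linear subspace \<open>T_S\<close>, which is also its tangent space at
  every point.\<close>

definition S_set :: "'c::euclidean_space \<Rightarrow> (real \<times> 'c \<times> 'v::real_inner) set" where
  "S_set e = {(t, Z, X). t > 0 \<and> Z \<in> C_im e}"

definition T_S :: "'c::euclidean_space \<Rightarrow> (real \<times> 'c \<times> 'v::real_inner) set" where
  "T_S e = {(\<tau>, Z, X). Z \<in> C_im e}"

fun S_mult :: "('c::euclidean_space \<Rightarrow> 'v::real_inner \<Rightarrow> 'v) \<Rightarrow> 'c \<Rightarrow>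
    real \<times> 'c \<times> 'v \<Rightarrow> real \<times> 'c \<times> 'v \<Rightarrow> real \<times> 'c \<times> 'v" where
  "S_mult J e (t1, Z1, X1) (t2, Z2, X2) =
     (t1 * t2,
      Z1 + t1 *\<^sub>R Z2 + (1/2 * sqrt t1) *\<^sub>R bracket J e X1 X2,
      X1 + sqrt t1 *\<^sub>R X2)"

definition S_one :: "real \<times> 'c::euclidean_space \<times> 'v::real_inner" where
  "S_one = (1, 0, 0)"

definition S_metric :: "('c::euclidean_space \<Rightarrow> 'v::real_inner \<Rightarrow> 'v) \<Rightarrow> 'c \<Rightarrow>
    real \<times> 'c \<times> 'v \<Rightarrow> real \<times> 'c \<times> 'v \<Rightarrow> real \<times> 'c \<times> 'v \<Rightarrow> real" where
  "S_metric J e s a b =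
     (let dL = frechet_derivative (S_mult J e s) (at S_one)
      in inv_into (T_S e) dL a \<bullet> inv_into (T_S e) dL b)"

subsection \<open>The space \<open>D\<close> and its isometry group\<close>

fun ht :: "'c::euclidean_space \<Rightarrow> 'c \<times> 'v::real_inner \<Rightarrow> real" where
  "ht e (\<zeta>, v) = re_part e \<zeta> - 1/4 * (norm v)\<^sup>2"

definition D_set :: "'c::euclidean_space \<Rightarrow> ('c \<times> 'v::real_inner) set" where
  "D_set e = {(\<zeta>, v). re_part e \<zeta> > 1/4 * (norm v)\<^sup>2}"

fun S_to_D :: "'c::euclidean_space \<Rightarrow> real \<times> 'c \<times> 'v::real_inner \<Rightarrow> 'c \<times> 'v" where
  "S_to_D e (t, Z, X) = ((t + 1/4 * (norm X)\<^sup>2) *\<^sub>R e + Z, X)"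

text \<open>The metric tensor on \<open>D\<close>, transported from \<open>S\<close> along \<open>S_to_D\<close>; see \<open>S_to_D_isometry\<close>
  below.\<close>

definition D_metric :: "('c::euclidean_space \<Rightarrow> 'v::real_inner \<Rightarrow> 'v) \<Rightarrow> 'c \<Rightarrow>
    'c \<times> 'v \<Rightarrow> 'c \<times> 'v \<Rightarrow> 'c \<times> 'v \<Rightarrow> real" where
  "D_metric J e p a b =
     (let s = inv_into (S_set e) (S_to_D e) p;
          d\<Theta> = frechet_derivative (S_to_D e) (at s)
      in S_metric J e s (inv_into (T_S e) d\<Theta> a) (inv_into (T_S e) d\<Theta> b))"

text \<open>\<open>C\<^sup>\<infinity>\<close> maps on an open set: \<open>F [h\<^sub>k, \<dots>, h\<^sub>1]\<close> is the iterated directional derivative of \<open>f\<close>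
  in the directions \<open>h\<^sub>1\<close>, \dots, \<open>h\<^sub>k\<close>.\<close>

definition smooth_map_on :: "'a::real_normed_vector set \<Rightarrow> ('a \<Rightarrow> 'b::real_normed_vector) \<Rightarrow> bool"
  where
  "smooth_map_on U f \<longleftrightarrow>
     (\<exists>F :: 'a list \<Rightarrow> 'a \<Rightarrow> 'b.
        (\<forall>x\<in>U. F [] x = f x) \<and>
        (\<forall>hs. \<forall>x\<in>U. (F hs has_derivative (\<lambda>h. F (h # hs) x)) (at x)))"

definition riemannian_isometry ::
    "('c::euclidean_space \<Rightarrow> 'v::real_inner \<Rightarrow> 'v) \<Rightarrow> 'c \<Rightarrow> ('c \<times> 'v \<Rightarrow> 'c \<times> 'v) \<Rightarrow> bool" where
  "riemannian_isometry J e f \<longleftrightarrow>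
     bij_betw f (D_set e) (D_set e) \<and>
     smooth_map_on (D_set e) f \<and>
     smooth_map_on (D_set e) (inv_into (D_set e) f) \<and>
     (\<forall>p\<in>D_set e. \<forall>a b.
        D_metric J e (f p) (frechet_derivative f (at p) a) (frechet_derivative f (at p) b)
          = D_metric J e p a b)"

definition isom_group :: "('c::euclidean_space \<Rightarrow> 'v::real_inner \<Rightarrow> 'v) \<Rightarrow> 'c \<Rightarrow>
    ('c \<times> 'v \<Rightarrow> 'c \<times> 'v) monoid" where
  "isom_group J e =
     (BijGroup (D_set e))\<lparr>carrier := {f \<in> Bij (D_set e). riemannian_isometry J e f}\<rparr>"

subsection \<open>The action on the closure and the stabilizer of infinity\<close>

text \<open>In the one-point compactification \<open>None\<close> is the point \<open>\<infinity>\<close>.\<close>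

definition D_bar :: "'c::euclidean_space \<Rightarrow> ('c \<times> 'v::real_inner) option set" where
  "D_bar e = insert None (Some ` {(\<zeta>, v). re_part e \<zeta> \<ge> 1/4 * (norm v)\<^sup>2})"

definition D_bar_top :: "'c::euclidean_space \<Rightarrow> ('c \<times> 'v::real_inner) option topology" where
  "D_bar_top e = subtopology (Alexandroff_compactification euclidean) (D_bar e)"

definition bar_ext :: "'c::euclidean_space \<Rightarrow> ('c \<times> 'v::real_inner \<Rightarrow> 'c \<times> 'v) \<Rightarrow>
    ('c \<times> 'v) option \<Rightarrow> ('c \<times> 'v) option" where
  "bar_ext e g = (THE h. h \<in> extensional (D_bar e) \<and>
     continuous_map (D_bar_top e) (D_bar_top e) h \<and>
     (\<forall>z\<in>D_set e. h (Some z) = Some (g z)))"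

definition G_infty :: "('c::euclidean_space \<Rightarrow> 'v::real_inner \<Rightarrow> 'v) \<Rightarrow> 'c \<Rightarrow>
    ('c \<times> 'v \<Rightarrow> 'c \<times> 'v) set" where
  "G_infty J e = {g \<in> carrier (isom_group J e). bar_ext e g None = None}"

subsection \<open>The subgroups \<open>A\<close>, \<open>N\<close>, \<open>M\<close> and the geodesic inversion\<close>

fun act_A :: "real \<Rightarrow> 'c::euclidean_space \<times> 'v::real_inner \<Rightarrow> 'c \<times> 'v" where
  "act_A t (\<zeta>, v) = (t *\<^sub>R \<zeta>, sqrt t *\<^sub>R v)"

fun act_N :: "('c::euclidean_space \<Rightarrow> 'v::real_inner \<Rightarrow> 'v) \<Rightarrow> 'c \<Rightarrow> 'c \<Rightarrow> 'v \<Rightarrow>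
    'c \<times> 'v \<Rightarrow> 'c \<times> 'v" where
  "act_N J e Z X (\<zeta>, v) =
     ((1/4 * (norm X)\<^sup>2) *\<^sub>R e + Z + \<zeta> + (1/2) *\<^sub>R beta2 J v X, X + v)"

definition N_maps :: "('c::euclidean_space \<Rightarrow> 'v::real_inner \<Rightarrow> 'v) \<Rightarrow> 'c \<Rightarrow>
    ('c \<times> 'v \<Rightarrow> 'c \<times> 'v) set" where
  "N_maps J e = {act_N J e Z X | Z X. Z \<in> C_im e}"

definition M_maps :: "('c::euclidean_space \<Rightarrow> 'v::real_inner \<Rightarrow> 'v) \<Rightarrow> 'c \<Rightarrow>
    ('c \<times> 'v \<Rightarrow> 'c \<times> 'v) set" where
  "M_maps J e = {map_prod \<phi> \<psi> | \<phi> \<psi>.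
     orthogonal_transformation \<phi> \<and> orthogonal_transformation \<psi> \<and>
     \<phi> e = e \<and> (\<forall>\<zeta> v. \<psi> (J \<zeta> v) = J (\<phi> \<zeta>) (\<psi> v))}"

fun geod_inversion :: "('c::euclidean_space \<Rightarrow> 'v::real_inner \<Rightarrow> 'v) \<Rightarrow> 'c \<Rightarrow>
    'c \<times> 'v \<Rightarrow> 'c \<times> 'v" where
  "geod_inversion J e (\<zeta>, v) = (inv_C e \<zeta>, - J (inv_C e \<zeta>) v)"

subsection \<open>Isometric spheres\<close>

fun cygan :: "('c::euclidean_space \<Rightarrow> 'v::real_inner \<Rightarrow> 'v) \<Rightarrow> 'c \<Rightarrow>
    'c \<times> 'v \<Rightarrow> 'c \<times> 'v \<Rightarrow> real" where
  "cygan J e (\<zeta>1, v1) (\<zeta>2, v2) =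
     sqrt (norm ((1/4 * (norm v1)\<^sup>2 + 1/4 * (norm v2)\<^sup>2 + \<bar>ht e (\<zeta>1, v1) - ht e (\<zeta>2, v2)\<bar>) *\<^sub>R e
                 + im_part e \<zeta>1 - im_part e \<zeta>2 - (1/2) *\<^sub>R beta2 J v1 v2))"

text \<open>\<open>isom_radius\<close> and \<open>isom_center\<close> are only meaningful for \<open>g\<close> not fixing \<open>\<infinity>\<close>: then the
  decomposition \<open>g = n\<^sub>1 \<sigma> m a\<^sub>t n\<^sub>2\<close> exists and is unique, and \<open>g\<^sup>-\<^sup>1 \<infinity> \<noteq> \<infinity>\<close>.\<close>

definition isom_radius :: "('c::euclidean_space \<Rightarrow> 'v::real_inner \<Rightarrow> 'v) \<Rightarrow> 'c \<Rightarrow>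
    ('c \<times> 'v \<Rightarrow> 'c \<times> 'v) \<Rightarrow> real" where
  "isom_radius J e g = (THE r. \<exists>t>0. r = t powr (- 1/4) \<and>
     (\<exists>n1\<in>N_maps J e. \<exists>m\<in>M_maps J e. \<exists>n2\<in>N_maps J e.
        \<forall>z\<in>D_set e. g z = n1 (geod_inversion J e (m (act_A t (n2 z))))))"

definition isom_center :: "('c::euclidean_space \<Rightarrow> 'v::real_inner \<Rightarrow> 'v) \<Rightarrow> 'c \<Rightarrow>
    ('c \<times> 'v \<Rightarrow> 'c \<times> 'v) \<Rightarrow> 'c \<times> 'v" where
  "isom_center J e g = the (bar_ext e (m_inv (isom_group J e) g) None)"

definition isom_ext :: "('c::euclidean_space \<Rightarrow> 'v::real_inner \<Rightarrow> 'v) \<Rightarrow> 'c \<Rightarrow>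
    ('c \<times> 'v \<Rightarrow> 'c \<times> 'v) \<Rightarrow> ('c \<times> 'v) set" where
  "isom_ext J e g = {z \<in> D_set e. cygan J e z (isom_center J e g) > isom_radius J e g}"

definition isom_int :: "('c::euclidean_space \<Rightarrow> 'v::real_inner \<Rightarrow> 'v) \<Rightarrow> 'c \<Rightarrow>
    ('c \<times> 'v \<Rightarrow> 'c \<times> 'v) \<Rightarrow> ('c \<times> 'v) set" where
  "isom_int J e g = {z \<in> D_set e. cygan J e z (isom_center J e g) < isom_radius J e g}"

subsection \<open>Types of subgroups and fundamental regions\<close>

definition D_closure :: "'c::euclidean_space \<Rightarrow> ('c \<times> 'v::real_inner) set \<Rightarrow> ('c \<times> 'v) set" where
  "D_closure e A = D_set e \<inter> closure A"

definition type_O :: "('c::euclidean_space \<Rightarrow> 'v::real_inner \<Rightarrow> 'v) \<Rightarrow> 'c \<Rightarrow>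
    ('c \<times> 'v \<Rightarrow> 'c \<times> 'v) set \<Rightarrow> bool" where
  "type_O J e \<Gamma> \<longleftrightarrow>
     D_set e \<inter> (\<Inter>g\<in>\<Gamma> - G_infty J e. isom_ext J e g)
       = D_set e - D_closure e (\<Union>g\<in>\<Gamma> - G_infty J e. isom_int J e g)"

definition type_F :: "('c::euclidean_space \<Rightarrow> 'v::real_inner \<Rightarrow> 'v) \<Rightarrow> 'c \<Rightarrow>
    ('c \<times> 'v \<Rightarrow> 'c \<times> 'v) set \<Rightarrow> bool" where
  "type_F J e T \<longleftrightarrow>
     T \<subseteq> carrier (isom_group J e) \<and>
     (\<forall>z\<in>D_set e. \<exists>g\<in>generate (isom_group J e) T.
        \<forall>h\<in>generate (isom_group J e) T. ht e (h z) \<le> ht e (g z))"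

definition fundamental_region :: "'c::euclidean_space \<Rightarrow>
    ('c \<times> 'v::real_inner \<Rightarrow> 'c \<times> 'v) set \<Rightarrow> ('c \<times> 'v) set \<Rightarrow> bool" where
  "fundamental_region e \<Gamma> Y \<longleftrightarrow>
     open Y \<and> Y \<subseteq> D_set e \<and>
     (\<forall>g\<in>\<Gamma>. \<forall>h\<in>\<Gamma>. g \<noteq> h \<longrightarrow> g ` Y \<inter> h ` Y = {}) \<and>
     D_set e = (\<Union>g\<in>\<Gamma>. g ` D_closure e Y)"

subsection \<open>Characteristic properties of the implicitly defined notions\<close>

lemma J2C_bilinear: "J2C_module J e \<Longrightarrow> bilinear J"
  and J2C_norm_e: "J2C_module J e \<Longrightarrow> norm e = 1"
  and J2C_e: "J2C_module J e \<Longrightarrow> J e v = v"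
  and J2C_norm: "J2C_module J e \<Longrightarrow> norm (J \<zeta> v) = norm \<zeta> * norm v"
  by (simp_all add: J2C_module_def)

lemma Riesz_C:
  fixes f :: "'c::euclidean_space \<Rightarrow> real"
  assumes "linear f"
  shows "\<exists>!c. \<forall>\<zeta>. c \<bullet> \<zeta> = f \<zeta>"
proof (rule ex_ex1I)
  have "adjoint f 1 \<bullet> \<zeta> = f \<zeta>" for \<zeta>
    using adjoint_works[OF assms, of \<zeta> 1] by (simp add: inner_commute)
  then show "\<exists>c. \<forall>\<zeta>. c \<bullet> \<zeta> = f \<zeta>" by blast
  show "c = d" if "\<forall>\<zeta>. c \<bullet> \<zeta> = f \<zeta>" "\<forall>\<zeta>. d \<bullet> \<zeta> = f \<zeta>" for c d
    using that by (metis vector_eq_rdot inner_commute)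
qed

lemma J2C_linear_left_inner:
  assumes "J2C_module J e"
  shows "linear (\<lambda>\<zeta>. J \<zeta> u \<bullet> v)"
  using J2C_bilinear[OF assms]
  by (intro linearI) (simp_all add: bilinear_ladd bilinear_lmul inner_add_left)

lemma beta2_inner:
  assumes "J2C_module J e"
  shows "beta2 J v u \<bullet> \<zeta> = J \<zeta> u \<bullet> v"
  using theI'[OF Riesz_C[OF J2C_linear_left_inner[OF assms, of u v]]]
  by (simp add: beta2_def)

lemma bracket_ex1:
  fixes J :: "'c::euclidean_space \<Rightarrow> 'v::real_inner \<Rightarrow> 'v"
  assumes J: "J2C_module J e"
  shows "\<exists>!w. w \<in> C_im e \<and> (\<forall>z\<in>C_im e. z \<bullet> w = J z x \<bullet> y)"
proof (rule ex_ex1I)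
  have e: "e \<bullet> e = 1" using J2C_norm_e[OF J] by (simp add: dot_square_norm)
  let ?w = "im_part e (beta2 J y x)"
  have "?w \<in> C_im e"
    by (simp add: C_im_def im_part_def re_part_def inner_diff_right e)
  moreover have "z \<bullet> ?w = J z x \<bullet> y" if "z \<in> C_im e" for z
    using that beta2_inner[OF J, of y x z]
    by (simp add: C_im_def im_part_def inner_diff_right inner_commute)
  ultimately show "\<exists>w. w \<in> C_im e \<and> (\<forall>z\<in>C_im e. z \<bullet> w = J z x \<bullet> y)" by blast
  fix w w' assume w: "w \<in> C_im e \<and> (\<forall>z\<in>C_im e. z \<bullet> w = J z x \<bullet> y)"
    and w': "w' \<in> C_im e \<and> (\<forall>z\<in>C_im e. z \<bullet> w' = J z x \<bullet> y)"
  then have "w - w' \<in> C_im e" by (simp add: C_im_def inner_diff_right)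
  then have "(w - w') \<bullet> (w - w') = 0"
    using w w' by (simp add: inner_diff_right)
  then show "w = w'" by simp
qed

lemma bracket_in:
  assumes "J2C_module J e"
  shows "bracket J e x y \<in> C_im e"
  using theI'[OF bracket_ex1[OF assms, of x y]] by (simp add: bracket_def)

lemma bracket_inner:
  assumes "J2C_module J e" and "z \<in> C_im e"
  shows "z \<bullet> bracket J e x y = J z x \<bullet> y"
  using theI'[OF bracket_ex1[OF assms(1), of x y]] assms(2) by (simp add: bracket_def)

lemma bracket_eqI:
  assumes "J2C_module J e" "w \<in> C_im e" "\<And>z. z \<in> C_im e \<Longrightarrow> z \<bullet> w = J z x \<bullet> y"
  shows "bracket J e x y = w"
  unfolding bracket_def using assms bracket_ex1[OF assms(1), of x y]
  by (intro the1_equality) auto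

lemma bounded_linear_bracket:
  assumes J: "J2C_module J e"
  shows "bounded_linear (bracket J e x)"
proof (rule bounded_linear_intro[where K = "norm x"])
  show "bracket J e x (y + y') = bracket J e x y + bracket J e x y'" for y y'
    using bracket_in[OF J]
    by (intro bracket_eqI[OF J])
       (auto simp: C_im_def inner_add_right bracket_inner[OF J])
  show "bracket J e x (r *\<^sub>R y) = r *\<^sub>R bracket J e x y" for r y
    using bracket_in[OF J]
    by (intro bracket_eqI[OF J]) (auto simp: C_im_def bracket_inner[OF J])
  fix y
  let ?w = "bracket J e x y"
  have "norm ?w * norm ?w = J ?w x \<bullet> y"
    using bracket_inner[OF J bracket_in[OF J], of x y x y]
    by (simp flip: power2_eq_square dot_square_norm)
  also have "\<dots> \<le> norm (J ?w x) * norm y" by (rule norm_cauchy_schwarz)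
  also have "\<dots> = norm ?w * (norm y * norm x)" by (simp add: J2C_norm[OF J])
  finally show "norm ?w \<le> norm y * norm x"
    by (cases "norm ?w = 0") auto
qed

text \<open>The differential of a left translation of \<open>S\<close> does not depend on the base point, since left
  translations are affine in the coordinates \<open>(t, Z, X)\<close>.\<close>

lemma S_mult_derivative:
  assumes J: "J2C_module J e"
  shows "(S_mult J e (t, Z, X) has_derivative
           (\<lambda>(\<tau>, z, x). (t * \<tau>, t *\<^sub>R z + (1/2 * sqrt t) *\<^sub>R bracket J e X x, sqrt t *\<^sub>R x))) (at s)"
proof -
  note [derivative_intros] = bounded_linear.has_derivative[OF bounded_linear_bracket[OF J]]
  have *: "S_mult J e (t, Z, X) = (\<lambda>s. (t * fst s,
      Z + t *\<^sub>R fst (snd s) + (1/2 * sqrt t) *\<^sub>R bracket J e X (snd (snd s)),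
      X + sqrt t *\<^sub>R snd (snd s)))"
    by (auto simp: fun_eq_iff)
  show ?thesis
    unfolding * by (auto intro!: derivative_eq_intros simp: fun_eq_iff)
qed

lemma S_metric_left_invariant:
  assumes J: "J2C_module J e" and s: "s \<in> S_set e" and a: "a \<in> T_S e" and b: "b \<in> T_S e"
  defines "dL \<equiv> frechet_derivative (S_mult J e s) (at S_one)"
  shows "S_metric J e s (dL a) (dL b) = a \<bullet> b"
proof -
  obtain t Z X where s_eq: "s = (t, Z, X)" by (cases s)
  have t: "t > 0" using s by (simp add: S_set_def s_eq)
  have dL: "dL = (\<lambda>(\<tau>, z, x).
      (t * \<tau>, t *\<^sub>R z + (1/2 * sqrt t) *\<^sub>R bracket J e X x, sqrt t *\<^sub>R x))"
    unfolding dL_def s_eq by (rule frechet_derivative_at[OF S_mult_derivative[OF J], symmetric])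
  have "inj_on dL (T_S e)"
    using t by (auto simp: inj_on_def dL)
  then show ?thesis
    using a b unfolding S_metric_def Let_def dL_def[symmetric] by simp
qed

lemma S_to_D_derivative:
  "(S_to_D e has_derivative
     (\<lambda>(\<tau>, z, x). ((\<tau> + 1/2 * (X \<bullet> x)) *\<^sub>R e + z, x))) (at (t, Z, X))"
proof -
  have *: "S_to_D e = (\<lambda>s. ((fst s + 1/4 * (snd (snd s) \<bullet> snd (snd s))) *\<^sub>R e + fst (snd s),
      snd (snd s)))"
    by (auto simp: fun_eq_iff dot_square_norm)
  show ?thesis
    unfolding * by (auto intro!: derivative_eq_intros simp: fun_eq_iff inner_commute)
qed

lemma scaleR_e_plus_C_im:
  assumes "norm e = 1" "z \<in> C_im e" "z' \<in> C_im e" "a *\<^sub>R e + z = b *\<^sub>R e + z'"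
  shows "a = b \<and> z = z'"
proof -
  have "e \<bullet> (a *\<^sub>R e + z) = e \<bullet> (b *\<^sub>R e + z')" using assms(4) by simp
  then have "a = b" using assms(1-3) by (simp add: C_im_def inner_add_right dot_square_norm)
  with assms(4) show ?thesis by simp
qed

lemma bij_betw_S_to_D:
  fixes e :: "'c::euclidean_space"
  assumes e: "norm e = 1"
  shows "bij_betw (S_to_D e) (S_set e) (D_set e :: ('c \<times> 'v::real_inner) set)"
proof (rule bij_betw_imageI)
  show "inj_on (S_to_D e) (S_set e :: (real \<times> 'c \<times> 'v) set)"
  proof (rule inj_onI)
    fix u w :: "real \<times> 'c \<times> 'v"
    assume uw: "u \<in> S_set e" "w \<in> S_set e" "S_to_D e u = S_to_D e w"
    obtain t Z X t' Z' X' where eqs: "u = (t, Z, X)" "w = (t', Z', X')"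
      by (metis prod_cases3)
    have "t + 1/4 * (norm X)\<^sup>2 = t' + 1/4 * (norm X)\<^sup>2 \<and> Z = Z'"
      using uw by (intro scaleR_e_plus_C_im[OF e]) (auto simp: eqs S_set_def)
    then show "u = w" using uw(3) by (simp add: eqs)
  qed
  have ee: "e \<bullet> e = 1" using e by (simp add: dot_square_norm)
  show "S_to_D e ` S_set e = (D_set e :: ('c \<times> 'v) set)"
  proof (intro subset_antisym subsetI)
    fix p :: "'c \<times> 'v" assume "p \<in> S_to_D e ` S_set e"
    then show "p \<in> D_set e"
      by (auto simp: S_set_def D_set_def C_im_def re_part_def inner_add_right ee)
  next
    fix p :: "'c \<times> 'v" assume p: "p \<in> D_set e"
    obtain \<zeta> v where [simp]: "p = (\<zeta>, v)" by (cases p)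
    have "(ht e (\<zeta>, v), im_part e \<zeta>, v) \<in> S_set e"
      using p by (simp add: S_set_def D_set_def C_im_def im_part_def re_part_def inner_diff_right ee)
    moreover have "p = S_to_D e (ht e (\<zeta>, v), im_part e \<zeta>, v)"
      by (simp add: im_part_def)
    ultimately show "p \<in> S_to_D e ` S_set e" by blast
  qed
qed

lemma S_to_D_isometry:
  assumes e: "norm e = 1" and s: "s \<in> S_set e" and a: "a \<in> T_S e" and b: "b \<in> T_S e"
  defines "d\<Theta> \<equiv> frechet_derivative (S_to_D e) (at s)"
  shows "D_metric J e (S_to_D e s) (d\<Theta> a) (d\<Theta> b) = S_metric J e s a b"
proof -
  obtain t Z X where s_eq: "s = (t, Z, X)" by (cases s)
  have d: "d\<Theta> = (\<lambda>(\<tau>, z, x). ((\<tau> + 1/2 * (X \<bullet> x)) *\<^sub>R e + z, x))"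
    unfolding d\<Theta>_def s_eq by (rule frechet_derivative_at[OF S_to_D_derivative, symmetric])
  have inj: "inj_on d\<Theta> (T_S e)"
  proof (rule inj_onI)
    fix u w assume "u \<in> T_S e" "w \<in> T_S e" "d\<Theta> u = d\<Theta> w"
    then show "u = w"
      using scaleR_e_plus_C_im[OF e, of "fst (snd u)" "fst (snd w)"
          "fst u + 1/2 * (X \<bullet> snd (snd u))" "fst w + 1/2 * (X \<bullet> snd (snd w))"]
      by (auto simp: d T_S_def prod_eq_iff split: prod.splits)
  qed
  have "inv_into (S_set e) (S_to_D e) (S_to_D e s) = s"
    by (rule bij_betw_inv_into_left[OF bij_betw_S_to_D[OF e] s])
  then show ?thesis
    using a b inj by (simp add: D_metric_def Let_def flip: d\<Theta>_def)
qed

subsection \<open>A type for \<open>V = {0}\<close>\<close>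

instantiation unit :: real_inner
begin

definition zero_unit :: unit where "zero_unit = ()"
definition plus_unit :: "unit \<Rightarrow> unit \<Rightarrow> unit" where "plus_unit x y = ()"
definition minus_unit :: "unit \<Rightarrow> unit \<Rightarrow> unit" where "minus_unit x y = ()"
definition uminus_unit :: "unit \<Rightarrow> unit" where "uminus_unit x = ()"
definition scaleR_unit :: "real \<Rightarrow> unit \<Rightarrow> unit" where "scaleR_unit r x = ()"
definition inner_unit :: "unit \<Rightarrow> unit \<Rightarrow> real" where "inner_unit x y = 0"
definition norm_unit :: "unit \<Rightarrow> real" where "norm_unit x = 0"
definition dist_unit :: "unit \<Rightarrow> unit \<Rightarrow> real" where "dist_unit x y = 0"
definition sgn_unit :: "unit \<Rightarrow> unit" where "sgn_unit x = ()"
definition uniformity_unit :: "(unit \<times> unit) filter" where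
  "uniformity_unit = (INF r\<in>{0<..}. principal {(x, y). dist x y < r})"
definition open_unit :: "unit set \<Rightarrow> bool" where
  "open_unit U \<longleftrightarrow> (\<forall>x\<in>U. eventually (\<lambda>(x', y). x' = x \<longrightarrow> y \<in> U) uniformity)"

instance
  by standard
     (simp_all add: inner_unit_def norm_unit_def dist_unit_def uniformity_unit_def open_unit_def)

end

lemma J2C_module_unit:
  fixes e :: "'c::euclidean_space"
  assumes "norm e = 1"
  shows "J2C_module (\<lambda>_ _. () :: unit) e"
proof -
  have "bilinear (\<lambda>(_::'c) (_::unit). ())"
    by (auto simp: bilinear_def intro!: linearI)
  moreover have "\<exists>B. finite B \<and> span B = (UNIV :: unit set)"
    using span_UNIV finite by blast
  ultimately show ?thesis
    using assms by (auto simp: J2C_module_def norm_unit_def)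
qed

end

theory Submission
  imports Defs
begin

text \<open>
  The key is the height formula: an isometry \<open>g\<close> with \<open>g \<infinity> \<noteq> \<infinity>\<close> satisfies
  \<open>ht (g z) = ht z * (R(g) / \<rho>(z, g\<^sup>-\<^sup>1 \<infinity>))\<^sup>4\<close>, so that \<open>Ext I(g)\<close> is the set where \<open>g\<close> lowers
  the height (\<open>isom_ext_iff\<close>), while an isometry fixing \<open>\<infinity>\<close> multiplies all heights by one
  constant (\<open>G_infty_iff_scales_height\<close>). If \<open>\<Gamma>\<close> fixes \<open>\<infinity>\<close>, the region is \<open>F_inf\<close> itself.
  Otherwise the elements that move \<open>\<infinity>\<close> generate \<open>\<Gamma>\<close>, so by type (F) every orbit contains a
  point of maximal height. This forces the elements of \<open>\<Gamma>\<close> that fix \<open>\<infinity>\<close> to preserve heights,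
  so a highest point of an orbit can be moved into the closure of \<open>F_inf\<close> and stays a highest
  point. There no \<open>g\<close> raises the height, so the point lies in the closure of each \<open>Ext I(g)\<close>, and
  the closure hypothesis puts it in the closure of the region. Conversely, let \<open>x\<close> and \<open>g x\<close> both
  lie in the region. If \<open>g\<close> moves \<open>\<infinity>\<close>, then \<open>g\<close> lowers the height of \<open>x\<close> and \<open>g\<^sup>-\<^sup>1\<close> lowers
  the height of \<open>g x\<close>, a contradiction; if \<open>g\<close> fixes \<open>\<infinity>\<close>, it is the identity because \<open>F_inf\<close>
  is fundamental. Type (O) makes the region open.

  The height formula rests on the decomposition of an arbitrary Riemannian isometry as an element of
  \<open>M A N\<close> or of \<open>N \<sigma> M A N\<close> (\<open>isometry_decomposition\<close>). It is obtained by metric geometry. The function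
  \<open>Phi z w = |pht z w|\<^sup>2 / (4 * ht z * ht w)\<close> equals \<open>cosh\<^sup>2 (d(z,w)/2)\<close> for the Riemannian distance \<open>d\<close>.
  Explicit geodesics (\<open>geodesic_from_base\<close>) together with the gradient bound
  \<open>|grad Phi|\<^sup>2 \<le> Phi * (Phi - 1)\<close> (\<open>dPhi_bound\<close>) show that isometries preserve \<open>Phi\<close>
  (\<open>Phi_isometry\<close>). The height is, up to a factor, the horofunction of the vertical ray at \<open>\<infinity>\<close>: ratios of
  \<open>Phi\<close> to points going up the ray converge to ratios of heights. The image of the ray under \<open>g\<close>
  accumulates at \<open>\<infinity>\<close> or at a finite boundary point; accordingly \<open>g\<close>, or \<open>\<sigma> n g\<close>
  with \<open>n \<in> N\<close> moving that point to \<open>0\<close>, rescales the height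
  (\<open>Phi_preserving_dichotomy\<close>). A bijection that preserves \<open>Phi\<close> and the height and fixes
  \<open>(e, 0)\<close> is read off in horospherical coordinates and lies in \<open>M\<close> (\<open>height_preserving_fixing_base\<close>).
  The explicit forms extend continuously to the boundary, which identifies \<open>g \<infinity>\<close>
  (\<open>bar_ext_MAN\<close>, \<open>bar_ext_NsMAN\<close>).
\<close>

section \<open>A comparison principle for the hyperbolic cosine\<close>

lemma has_real_derivative_of_has_derivative:
  fixes f :: "real \<Rightarrow> real"
  assumes "(f has_derivative F) (at x)"
  shows "(f has_real_derivative F 1) (at x)"
proof -
  have "linear F" using has_derivative_bounded_linear[OF assms] bounded_linear.linear by blast
  then have "F h = F 1 * h" for h using linear_cmul[of F h 1] by simp
  then have "F = (\<lambda>h. F 1 * h)" by (rule ext)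
  with assms show ?thesis by (simp add: has_field_derivative_def)
qed

text \<open>
  If \<open>u = cosh\<^sup>2 (d/2)\<close> for the distance \<open>d\<close> from a given point, then along a curve the speed bounds
  \<open>\<bar>d'\<bar>\<close>, that is, \<open>(u')\<^sup>2 \<le> speed\<^sup>2 * u * (u - 1)\<close>. The speed \<open>2r / (1 - l\<^sup>2 r\<^sup>2)\<close> is that of the ray
  \<open>l \<mapsto> l r\<close> in the Poincare disc of curvature \<open>-1\<close>, whose length is \<open>ln ((1 + r) / (1 - r))\<close>, and the bound says
  that \<open>d\<close> is at most this length.
\<close>
lemma cosh_square_comparison:
  fixes u u' :: "real \<Rightarrow> real"
  assumes r: "0 \<le> r" "r < 1"
    and u: "\<And>l. 0 \<le> l \<Longrightarrow> l \<le> 1 \<Longrightarrow> (u has_real_derivative u' l) (at l)"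
    and u1: "\<And>l. 0 \<le> l \<Longrightarrow> l \<le> 1 \<Longrightarrow> 1 \<le> u l"
    and bound: "\<And>l. 0 \<le> l \<Longrightarrow> l \<le> 1 \<Longrightarrow> (u' l)\<^sup>2 \<le> (2 * r / (1 - l\<^sup>2 * r\<^sup>2))\<^sup>2 * (u l * (u l - 1))"
    and u0: "u 0 = 1"
  shows "u 1 \<le> 1 / (1 - r\<^sup>2)"
proof -
  \<comment> \<open>\<open>f = cosh d\<close>, and \<open>E = exp L\<close> for the length \<open>L\<close> of the curve.\<close>
  define f where "f l = 2 * u l - 1" for l
  define E where "E = (1 + r) / (1 - r)"
  have E: "E > 0" using r by (simp add: E_def)
  \<comment> \<open>The distance \<open>ln (f + sqrt (f\<^sup>2 - 1))\<close> need not be differentiable where \<open>f = 1\<close>, as at the start;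
    a small \<open>d\<^sup>2\<close> added under the root regularises it, and \<open>d\<close> tends to \<open>0\<close> afterwards.\<close>
  have main: "f 1 + sqrt ((f 1)\<^sup>2 - 1) \<le> (1 + d) * E" if d: "d > 0" for d
  proof -
    define s where "s l = sqrt ((f l)\<^sup>2 - 1 + d\<^sup>2)" for l
    have f1: "f l \<ge> 1" if "0 \<le> l" "l \<le> 1" for l using u1[OF that] by (simp add: f_def)
    have sq: "(f l)\<^sup>2 - 1 + d\<^sup>2 > 0" if "0 \<le> l" "l \<le> 1" for l
    proof -
      have "1 \<le> (f l)\<^sup>2" using f1[OF that] by (simp add: one_le_power)
      moreover have "d\<^sup>2 > 0" using d by simp
      ultimately show ?thesis by linarith
    qed
    define G where "G l = ln (f l + s l) - (ln (1 + l * r) - ln (1 - l * r))" for l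
    have "G 1 \<le> G 0"
    proof (rule DERIV_nonpos_imp_nonincreasing[of 0 1])
      fix l :: real assume l: "0 \<le> l" "l \<le> 1"
      have lr: "l * r < 1" "0 \<le> l * r" using l r by (auto intro: le_less_trans[OF mult_left_le_one_le])
      have s0: "s l > 0" using sq[OF l] by (simp add: s_def)
      have fd: "(f has_real_derivative 2 * u' l) (at l)"
        unfolding f_def by (auto intro!: derivative_eq_intros u[OF l])
      have sd: "(s has_real_derivative (f l * (2 * u' l) / s l)) (at l)"
        unfolding s_def using sq[OF l]
        by (auto intro!: derivative_eq_intros fd simp: field_simps)
      have fs: "f l + s l > 0" using f1[OF l] s0 by simp
      have "(G has_real_derivative ((2 * u' l + f l * (2 * u' l) / s l) / (f l + s l)
          - (r / (1 + l * r) - (- r) / (1 - l * r)))) (at l)"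
      proof -
        have 1: "((\<lambda>l. ln (f l + s l)) has_real_derivative inverse (f l + s l) * (2 * u' l + f l * (2 * u' l) / s l)) (at l)"
          by (rule DERIV_chain2[OF DERIV_ln[OF fs] DERIV_add[OF fd sd]])
        have d: "((\<lambda>l. 1 + l * r) has_real_derivative r) (at l)" "((\<lambda>l. 1 - l * r) has_real_derivative - r) (at l)"
          by (auto intro!: derivative_eq_intros)
        have "0 < 1 + l * r" "0 < 1 - l * r" using lr by auto
        then have 2: "((\<lambda>l. ln (1 + l * r)) has_real_derivative inverse (1 + l * r) * r) (at l)"
          and 3: "((\<lambda>l. ln (1 - l * r)) has_real_derivative inverse (1 - l * r) * - r) (at l)"
          using DERIV_chain2[OF DERIV_ln d(1)] DERIV_chain2[OF DERIV_ln d(2)] by blast+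
        show ?thesis
          unfolding G_def[abs_def]
          using DERIV_diff[OF 1 DERIV_diff[OF 2 3]] by (simp add: divide_inverse mult.commute)
      qed
      also have "(2 * u' l + f l * (2 * u' l) / s l) / (f l + s l) = 2 * u' l / s l"
      proof -
        have "2 * u' l + f l * (2 * u' l) / s l = (f l + s l) * (2 * u' l / s l)"
          using s0 by (simp add: field_simps)
        then show ?thesis using fs by simp
      qed
      also have "r / (1 + l * r) - (- r) / (1 - l * r) = 2 * r / (1 - l\<^sup>2 * r\<^sup>2)"
      proof -
        have "1 - l\<^sup>2 * r\<^sup>2 = (1 + l * r) * (1 - l * r)" by (simp add: power2_eq_square algebra_simps)
        then show ?thesis using lr by (simp add: field_simps)
      qed
      finally have Gd: "(G has_real_derivative (2 * u' l / s l - 2 * r / (1 - l\<^sup>2 * r\<^sup>2))) (at l)" .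
      define c where "c = 2 * r / (1 - l\<^sup>2 * r\<^sup>2)"
      have "l\<^sup>2 * r\<^sup>2 < 1" using lr by (simp add: abs_square_less_1 flip: power_mult_distrib)
      then have c0: "c \<ge> 0" using r by (simp add: c_def)
      have "(2 * u' l)\<^sup>2 \<le> c\<^sup>2 * ((f l)\<^sup>2 - 1)"
      proof -
        have "4 * (u' l)\<^sup>2 \<le> 4 * (c\<^sup>2 * (u l * (u l - 1)))" using bound[OF l] by (simp add: c_def)
        also have "\<dots> = c\<^sup>2 * ((f l)\<^sup>2 - 1)" by (simp add: f_def power2_eq_square algebra_simps)
        finally show ?thesis by simp
      qed
      also have "\<dots> \<le> c\<^sup>2 * (s l)\<^sup>2"
        using sq[OF l] by (intro mult_left_mono) (auto simp: s_def)
      finally have "(2 * u' l)\<^sup>2 \<le> (c * s l)\<^sup>2" by (simp only: power_mult_distrib)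
      then have "2 * u' l \<le> c * s l" by (rule power2_le_imp_le) (use c0 s0 in auto)
      then have "2 * u' l / s l - c \<le> 0" using s0 by (simp add: pos_divide_le_eq)
      with Gd[folded c_def] show "\<exists>y. (G has_real_derivative y) (at l) \<and> y \<le> 0" by blast
    qed simp
    moreover have "G 0 = ln (1 + d)" using d by (simp add: G_def s_def f_def u0)
    moreover have "G 1 = ln (f 1 + s 1) - ln E"
      using r by (simp add: G_def E_def ln_div)
    ultimately have "ln (f 1 + s 1) \<le> ln ((1 + d) * E)"
      using d E by (simp add: ln_mult)
    moreover have pos: "f 1 + s 1 > 0" using f1[of 1] sq[of 1] by (simp add: s_def add_pos_pos)
    ultimately have "f 1 + s 1 \<le> (1 + d) * E" using d E by simp
    moreover have "sqrt ((f 1)\<^sup>2 - 1) \<le> s 1" by (simp add: s_def)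
    ultimately show ?thesis by linarith
  qed
  have "f 1 + sqrt ((f 1)\<^sup>2 - 1) \<le> E"
  proof (rule field_le_epsilon)
    fix x :: real assume "x > 0"
    then have "f 1 + sqrt ((f 1)\<^sup>2 - 1) \<le> (1 + x / E) * E" using E by (intro main) simp
    then show "f 1 + sqrt ((f 1)\<^sup>2 - 1) \<le> E + x" using E by (simp add: algebra_simps)
  qed
  then have "sqrt ((f 1)\<^sup>2 - 1) \<le> E - f 1" by simp
  moreover have ff: "(f 1)\<^sup>2 - 1 \<ge> 0" using u1[of 1] by (simp add: f_def one_le_power)
  ultimately have "(f 1)\<^sup>2 - 1 \<le> (E - f 1)\<^sup>2"
    by (metis power_mono real_sqrt_ge_zero real_sqrt_pow2)
  then have "2 * E * f 1 \<le> E\<^sup>2 + 1" by (simp add: power2_eq_square algebra_simps)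
  then have "f 1 \<le> (E\<^sup>2 + 1) / (2 * E)" using E by (simp add: pos_le_divide_eq mult_ac)
  also have "\<dots> = (1 + r\<^sup>2) / (1 - r\<^sup>2)"
  proof -
    have "1 - r\<^sup>2 = (1 + r) * (1 - r)" by (simp add: power2_eq_square algebra_simps)
    then show ?thesis using r by (simp add: E_def divide_simps) (simp add: power2_eq_square algebra_simps)
  qed
  also have "\<dots> = 2 * (1 / (1 - r\<^sup>2)) - 1"
  proof -
    have "r\<^sup>2 < 1" using r by (simp add: abs_square_less_1)
    then show ?thesis by (simp add: field_simps)
  qed
  finally show ?thesis by (simp add: f_def)
qed

section \<open>Bounded sets are relatively compact\<close>

lemma compact_bounded_combinations:
  fixes B :: "'a::real_normed_vector set"
  assumes "finite B"
  shows "compact {\<Sum>b\<in>B. c b *\<^sub>R b | c. \<forall>b\<in>B. \<bar>c b\<bar> \<le> R}"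
  using assms
proof (induction B)
  case empty
  then show ?case by simp
next
  case (insert b B)
  let ?K = "{\<Sum>b\<in>B. c b *\<^sub>R b | c. \<forall>b\<in>B. \<bar>c b\<bar> \<le> R}"
  let ?f = "\<lambda>p. fst p *\<^sub>R b + snd p"
  have "?f ` ({-R..R} \<times> ?K) = {\<Sum>x\<in>insert b B. c x *\<^sub>R x | c. \<forall>x\<in>insert b B. \<bar>c x\<bar> \<le> R}"
  proof (intro subset_antisym subsetI)
    fix y assume "y \<in> ?f ` ({-R..R} \<times> ?K)"
    then obtain t c where tc: "t \<in> {-R..R}" "\<forall>b\<in>B. \<bar>c b\<bar> \<le> R" "y = t *\<^sub>R b + (\<Sum>b\<in>B. c b *\<^sub>R b)"
      by auto
    have "(\<Sum>x\<in>B. (c(b := t)) x *\<^sub>R x) = (\<Sum>b\<in>B. c b *\<^sub>R b)"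
      using insert.hyps by (intro sum.cong) auto
    then have "y = (\<Sum>x\<in>insert b B. (c(b := t)) x *\<^sub>R x)"
      using insert.hyps by (simp add: tc(3))
    moreover have "\<forall>x\<in>insert b B. \<bar>(c(b := t)) x\<bar> \<le> R" using tc by auto
    ultimately show "y \<in> {\<Sum>x\<in>insert b B. c x *\<^sub>R x | c. \<forall>x\<in>insert b B. \<bar>c x\<bar> \<le> R}" by blast
  next
    fix y assume "y \<in> {\<Sum>x\<in>insert b B. c x *\<^sub>R x | c. \<forall>x\<in>insert b B. \<bar>c x\<bar> \<le> R}"
    then obtain c where c: "\<forall>x\<in>insert b B. \<bar>c x\<bar> \<le> R" "y = (\<Sum>x\<in>insert b B. c x *\<^sub>R x)" by blast
    then have "y = ?f (c b, \<Sum>x\<in>B. c x *\<^sub>R x)" using insert.hyps by simp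
    moreover have "(c b, \<Sum>x\<in>B. c x *\<^sub>R x) \<in> {-R..R} \<times> ?K" using c by auto
    ultimately show "y \<in> ?f ` ({-R..R} \<times> ?K)" by blast
  qed
  moreover have "compact (?f ` ({-R..R} \<times> ?K))"
    using insert.IH
    by (intro compact_continuous_image compact_Times continuous_intros) auto
  ultimately show ?case by simp
qed

text \<open>
  As a type, \<open>V\<close> is only an inner product space, so the Heine-Borel property is derived
  from a finite spanning set: the coefficients of a bounded vector with respect to an orthogonal
  basis are bounded.
\<close>
lemma compact_cball_finite_span:
  fixes B :: "'a::real_inner set"
  assumes B: "finite B" "span B = UNIV"
  shows "compact (cball (0::'a) R)"
proof -
  obtain C :: "'a set" where C: "finite C" "span C = UNIV" "pairwise orthogonal C"
    using basis_orthogonal[OF B(1)] B(2) by metis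
  define r where "r = (\<Sum>b\<in>C. R / norm b)"
  let ?K = "{\<Sum>b\<in>C. c b *\<^sub>R b | c. \<forall>b\<in>C. \<bar>c b\<bar> \<le> r}"
  have "cball 0 R \<subseteq> ?K"
  proof
    fix x :: 'a assume x: "x \<in> cball 0 R"
    define c where "c b = (b \<bullet> x) / (b \<bullet> b)" for b
    define y where "y = x - (\<Sum>b\<in>C. c b *\<^sub>R b)"
    have "orthogonal y b" if b: "b \<in> C" for b
    proof -
      have "b \<bullet> (\<Sum>a\<in>C. c a *\<^sub>R a) = (\<Sum>a\<in>C. if a = b then c b * (b \<bullet> b) else 0)"
        unfolding inner_sum_right
        using C(3) b by (intro sum.cong) (auto simp: pairwise_def orthogonal_def)
      also have "\<dots> = b \<bullet> x" using C(1) b by (simp add: c_def)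
      finally show ?thesis by (simp add: orthogonal_def y_def inner_diff inner_commute)
    qed
    then have "orthogonal y y"
      using C(2) by (intro orthogonal_to_span[of y C y]) auto
    then have "x = (\<Sum>b\<in>C. c b *\<^sub>R b)" by (simp add: orthogonal_def y_def)
    moreover have "\<bar>c b\<bar> \<le> r" if b: "b \<in> C" for b
    proof -
      have R: "R \<ge> 0" using x by (auto intro: order_trans[OF norm_ge_zero])
      have "\<bar>b \<bullet> x\<bar> \<le> norm b * norm x" by (rule Cauchy_Schwarz_ineq2)
      also have "\<dots> \<le> norm b * R" using x by (intro mult_left_mono) auto
      finally have "\<bar>c b\<bar> \<le> R / norm b"
        by (cases "b = 0") (auto simp: c_def divide_simps dot_square_norm power2_eq_square mult.commute)
      also have "\<dots> \<le> r" unfolding r_def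
        using C(1) b R by (intro member_le_sum) auto
      finally show ?thesis .
    qed
    ultimately show "x \<in> ?K" by blast
  qed
  then have "?K \<inter> cball 0 R = cball 0 R" by (rule inf.absorb2)
  with compact_Int_closed[OF compact_bounded_combinations[OF C(1), of r] closed_cball[of 0 R]]
  show ?thesis by (simp only:)
qed

lemma norm_fst_proj: "norm (fst x) \<le> norm x" and norm_snd_proj: "norm (snd x) \<le> norm x"
  by (cases x; simp add: norm_fst_le norm_snd_le)+

locale J2C_structure =
  fixes J :: "'c::euclidean_space \<Rightarrow> 'v::real_inner \<Rightarrow> 'v" and e :: 'c
  assumes J2C: "J2C_module J e"
begin

abbreviation "D \<equiv> (D_set e :: ('c \<times> 'v) set)"
abbreviation hgt :: "'c \<times> 'v \<Rightarrow> real" where "hgt \<equiv> ht e"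
abbreviation cnj :: "'c \<Rightarrow> 'c" where "cnj \<equiv> conj_C e"
abbreviation \<beta> :: "'v \<Rightarrow> 'v \<Rightarrow> 'c" where "\<beta> \<equiv> beta2 J"
abbreviation base :: "'c \<times> 'v" where "base \<equiv> (e, 0)"

section \<open>Algebra of the module structure\<close>

lemma norm_e [simp]: "norm e = 1"
  using J2C_norm_e[OF J2C] .

lemma inner_e_e [simp]: "e \<bullet> e = 1"
  by (simp add: dot_square_norm)

lemma J_e [simp]: "J e v = v"
  using J2C_e[OF J2C] .

lemma norm_J: "norm (J \<zeta> v) = norm \<zeta> * norm v"
  using J2C_norm[OF J2C] .

lemma linear_J_left: "linear (\<lambda>\<zeta>. J \<zeta> v)" and linear_J_right: "linear (J \<zeta>)"
  using J2C_bilinear[OF J2C] by (auto simp: bilinear_def)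

lemmas J_linear_simps =
  linear_add[OF linear_J_left] linear_add[OF linear_J_right]
  linear_diff[OF linear_J_left] linear_diff[OF linear_J_right]
  linear_cmul[OF linear_J_left] linear_cmul[OF linear_J_right]
  linear_neg[OF linear_J_left] linear_neg[OF linear_J_right]

lemma J_zero [simp]: "J 0 v = 0" "J \<zeta> 0 = 0"
  using linear_0[OF linear_J_left] linear_0[OF linear_J_right] by blast+

lemma bounded_bilinear_J: "bounded_bilinear J"
  by (rule bounded_bilinear.intro) (auto simp: J_linear_simps norm_J intro!: exI[of _ 1])

lemma inner_J_J_same: "J \<zeta> v \<bullet> J \<zeta> w = (norm \<zeta>)\<^sup>2 * (v \<bullet> w)"
proof -
  have "(norm (J \<zeta> (v + w)))\<^sup>2 = (norm \<zeta>)\<^sup>2 * (norm (v + w))\<^sup>2"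
    "(norm (J \<zeta> v))\<^sup>2 = (norm \<zeta>)\<^sup>2 * (norm v)\<^sup>2"
    "(norm (J \<zeta> w))\<^sup>2 = (norm \<zeta>)\<^sup>2 * (norm w)\<^sup>2"
    by (simp_all add: norm_J power_mult_distrib)
  then show ?thesis
    by (simp add: power2_norm_eq_inner J_linear_simps inner_add algebra_simps inner_commute)
qed

lemma inner_J_J_polar: "J \<zeta> v \<bullet> J \<eta> w + J \<eta> v \<bullet> J \<zeta> w = 2 * (\<zeta> \<bullet> \<eta>) * (v \<bullet> w)"
proof -
  have "J (\<zeta> + \<eta>) v \<bullet> J (\<zeta> + \<eta>) w = (norm (\<zeta> + \<eta>))\<^sup>2 * (v \<bullet> w)"
    by (rule inner_J_J_same)
  then show ?thesis
    using inner_J_J_same[of \<zeta> v w] inner_J_J_same[of \<eta> v w]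
    by (simp add: power2_norm_eq_inner J_linear_simps inner_add algebra_simps inner_commute)
qed

lemma cnj_eq: "cnj \<zeta> = (2 * (e \<bullet> \<zeta>)) *\<^sub>R e - \<zeta>"
  by (simp add: conj_C_def im_part_def re_part_def algebra_simps scaleR_2 flip: scaleR_add_left)

lemma cnj_simps [simp]:
  "cnj 0 = 0" "cnj e = e" "cnj (cnj \<zeta>) = \<zeta>" "cnj (\<zeta> + \<eta>) = cnj \<zeta> + cnj \<eta>"
  "cnj (\<zeta> - \<eta>) = cnj \<zeta> - cnj \<eta>" "cnj (- \<zeta>) = - cnj \<zeta>" "cnj (r *\<^sub>R \<zeta>) = r *\<^sub>R cnj \<zeta>"
  "e \<bullet> cnj \<zeta> = e \<bullet> \<zeta>" "cnj \<zeta> \<bullet> e = e \<bullet> \<zeta>"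
  by (simp_all add: cnj_eq inner_diff inner_add algebra_simps inner_commute scaleR_2)

lemma cnj_inner: "cnj \<zeta> \<bullet> \<eta> = \<zeta> \<bullet> cnj \<eta>"
  by (simp add: cnj_eq inner_diff inner_commute)

lemma norm_cnj [simp]: "norm (cnj \<zeta>) = norm \<zeta>"
  by (simp add: norm_eq_sqrt_inner cnj_inner)

lemma bounded_linear_cnj: "bounded_linear cnj"
  by (rule bounded_linear_intro[where K = 1]) auto

text \<open>
  Polarisation of \<open>|J \<zeta> v| = |\<zeta>| |v|\<close> in both arguments, with \<open>e\<close> as one of the scalars: \<open>J z\<close> is
  skew for \<open>z\<close> orthogonal to \<open>e\<close>.
\<close>
lemma J_adjoint: "J \<zeta> v \<bullet> w = v \<bullet> J (cnj \<zeta>) w"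
  using inner_J_J_polar[of \<zeta> v e w]
  by (simp add: cnj_eq J_linear_simps inner_diff inner_commute)

lemma J_cnj_J [simp]: "J (cnj \<zeta>) (J \<zeta> v) = (norm \<zeta>)\<^sup>2 *\<^sub>R v"
  and J_J_cnj [simp]: "J \<zeta> (J (cnj \<zeta>) v) = (norm \<zeta>)\<^sup>2 *\<^sub>R v"
proof -
  have *: "J (cnj \<zeta>) (J \<zeta> v) = (norm \<zeta>)\<^sup>2 *\<^sub>R v" for \<zeta>
  proof -
    have "J (cnj \<zeta>) (J \<zeta> v) \<bullet> w = ((norm \<zeta>)\<^sup>2 *\<^sub>R v) \<bullet> w" for w
      by (simp add: J_adjoint[of "cnj \<zeta>"] inner_J_J_same)
    then show ?thesis
      by (metis vector_eq_rdot inner_commute)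
  qed
  show "J (cnj \<zeta>) (J \<zeta> v) = (norm \<zeta>)\<^sup>2 *\<^sub>R v" by (rule *)
  show "J \<zeta> (J (cnj \<zeta>) v) = (norm \<zeta>)\<^sup>2 *\<^sub>R v" using *[of "cnj \<zeta>"] by simp
qed

lemma beta_inner: "\<beta> v u \<bullet> \<zeta> = J \<zeta> u \<bullet> v"
  using beta2_inner[OF J2C] .

lemma beta_eqI: "(\<And>\<zeta>. c \<bullet> \<zeta> = J \<zeta> u \<bullet> v) \<Longrightarrow> \<beta> v u = c"
  by (metis beta_inner vector_eq_rdot inner_commute)

lemma bounded_bilinear_beta: "bounded_bilinear \<beta>"
proof (rule bounded_bilinear.intro)
  show "\<exists>K. \<forall>a b. norm (\<beta> a b) \<le> norm a * norm b * K"
  proof (intro exI allI)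
    fix a b
    have "norm (\<beta> a b) * norm (\<beta> a b) = J (\<beta> a b) b \<bullet> a"
      by (simp add: beta_inner[symmetric] power2_norm_eq_inner[symmetric] power2_eq_square)
    also have "\<dots> \<le> norm (J (\<beta> a b) b) * norm a" by (rule norm_cauchy_schwarz)
    also have "\<dots> = norm (\<beta> a b) * (norm a * norm b * 1)" by (simp add: norm_J)
    finally show "norm (\<beta> a b) \<le> norm a * norm b * 1"
      by (cases "norm (\<beta> a b) = 0") auto
  qed
qed (auto intro!: beta_eqI simp: beta_inner J_linear_simps inner_add)

interpretation beta: bounded_bilinear \<beta> by (rule bounded_bilinear_beta)

lemmas beta_simps = beta.add_left beta.add_right beta.diff_left beta.diff_right
  beta.minus_left beta.minus_right beta.scaleR_left beta.scaleR_right beta.zero_left beta.zero_right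

lemma beta_zero [simp]: "\<beta> 0 v = 0" "\<beta> v 0 = 0"
  by (rule beta.zero_left beta.zero_right)+

lemma cnj_beta: "cnj (\<beta> v u) = \<beta> u v"
proof (rule beta_eqI[symmetric])
  show "cnj (\<beta> v u) \<bullet> \<zeta> = J \<zeta> v \<bullet> u" for \<zeta>
    by (simp only: cnj_inner beta_inner J_adjoint[of "cnj \<zeta>"] cnj_simps) (rule inner_commute)
qed

lemma beta_same: "\<beta> v v = (norm v)\<^sup>2 *\<^sub>R e"
proof (rule beta_eqI)
  fix \<zeta>
  have "J \<zeta> v \<bullet> J e v + J e v \<bullet> J \<zeta> v = 2 * (\<zeta> \<bullet> e) * (v \<bullet> v)"
    by (rule inner_J_J_polar)
  then show "((norm v)\<^sup>2 *\<^sub>R e) \<bullet> \<zeta> = J \<zeta> v \<bullet> v"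
    by (simp add: power2_norm_eq_inner inner_commute)
qed

lemma inner_e_beta [simp]: "e \<bullet> \<beta> v u = u \<bullet> v" "\<beta> v u \<bullet> e = u \<bullet> v"
  using beta_inner[of v u e] by (simp_all add: inner_commute)

section \<open>The point pair invariant\<close>

lemma hgt_eq: "hgt z = e \<bullet> fst z - (norm (snd z))\<^sup>2 / 4"
  by (cases z) (simp add: re_part_def)

lemma mem_D: "z \<in> D \<longleftrightarrow> 0 < hgt z"
  by (cases z) (simp add: D_set_def re_part_def)

declare ht.simps [simp del]

text \<open>
  The polarisation of the height: \<open>pht\<close> is Hermitian (\<open>cnj_pht\<close>) and \<open>pht z z = 2 * ht z\<close> (\<open>pht_same\<close>).
  For \<open>w\<close> on the boundary, \<open>sqrt (norm (pht z w))\<close> is the Cygan distance (\<open>cygan_boundary\<close>).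
\<close>
definition pht :: "'c \<times> 'v \<Rightarrow> 'c \<times> 'v \<Rightarrow> 'c" where
  "pht z w = fst z + cnj (fst w) - (1/2) *\<^sub>R \<beta> (snd z) (snd w)"

text \<open>
  \<open>Phi z w = cosh\<^sup>2 (d(z,w)/2)\<close> for the Riemannian distance \<open>d\<close>, as in the Siegel domain model of complex
  hyperbolic space.
\<close>
definition Phi :: "'c \<times> 'v \<Rightarrow> 'c \<times> 'v \<Rightarrow> real" where
  "Phi z w = (norm (pht z w))\<^sup>2 / (4 * hgt z * hgt w)"

lemma cnj_pht: "cnj (pht z w) = pht w z"
  by (simp add: pht_def cnj_beta)

lemma norm_pht_commute: "norm (pht z w) = norm (pht w z)"
  by (metis cnj_pht norm_cnj)

lemma pht_same: "pht z z = (2 * hgt z) *\<^sub>R e"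
  by (simp add: pht_def cnj_eq beta_same hgt_eq algebra_simps flip: scaleR_add_left)

lemma inner_e_pht: "e \<bullet> pht z w = hgt z + hgt w + (norm (snd z - snd w))\<^sup>2 / 4"
  by (simp add: pht_def hgt_eq inner_add inner_diff power2_norm_eq_inner inner_commute field_simps)

lemma hgt_le_norm_pht: "hgt z + hgt w + (norm (snd z - snd w))\<^sup>2 / 4 \<le> norm (pht z w)"
  using norm_cauchy_schwarz[of e "pht z w"] by (simp add: inner_e_pht)

lemma pht_nonzero: "0 < hgt z \<Longrightarrow> 0 \<le> hgt w \<Longrightarrow> pht z w \<noteq> 0"
  using hgt_le_norm_pht[of z w]
  by (metis add_pos_nonneg divide_nonneg_pos norm_zero not_less zero_le_power2 zero_less_numeral)

lemma Phi_ge_1: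
  assumes "z \<in> D" "w \<in> D" shows "1 \<le> Phi z w"
proof -
  have pos: "0 < hgt z" "0 < hgt w" using assms by (auto simp: mem_D)
  have "hgt z + hgt w \<le> norm (pht z w)"
    using hgt_le_norm_pht[of z w] zero_le_power2[of "norm (snd z - snd w)"] by linarith
  then have "(hgt z + hgt w)\<^sup>2 \<le> (norm (pht z w))\<^sup>2"
    using pos by (intro power_mono) auto
  moreover have "4 * hgt z * hgt w \<le> (hgt z + hgt w)\<^sup>2"
    using zero_le_power2[of "hgt z - hgt w"] by (simp add: power2_eq_square algebra_simps)
  ultimately have "4 * hgt z * hgt w \<le> (norm (pht z w))\<^sup>2" by linarith
  then show ?thesis using pos by (simp add: Phi_def)
qed

lemma Phi_same: "z \<in> D \<Longrightarrow> Phi z z = 1"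
  by (simp add: Phi_def pht_same mem_D power2_eq_square)

section \<open>Height and invariant under \<open>A\<close>, \<open>N\<close> and the geodesic inversion\<close>

lemma fst_act_A [simp]: "fst (act_A t z) = t *\<^sub>R fst z"
  and snd_act_A [simp]: "snd (act_A t z) = sqrt t *\<^sub>R snd z"
  by (cases z; simp)+

lemma fst_act_N [simp]:
  "fst (act_N J e Z X z) = ((1/4 * (norm X)\<^sup>2) *\<^sub>R e + Z + fst z + (1/2) *\<^sub>R \<beta> (snd z) X)"
  and snd_act_N [simp]: "snd (act_N J e Z X z) = X + snd z"
  by (cases z; simp)+

lemma fst_inversion [simp]: "fst (geod_inversion J e z) = inv_C e (fst z)"
  and snd_inversion [simp]: "snd (geod_inversion J e z) = - J (inv_C e (fst z)) (snd z)"
  by (cases z; simp)+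

lemma inner_e_C_im: "Z \<in> C_im e \<Longrightarrow> e \<bullet> Z = 0" "Z \<in> C_im e \<Longrightarrow> Z \<bullet> e = 0"
  by (simp_all add: C_im_def inner_commute)

lemma cnj_C_im: "Z \<in> C_im e \<Longrightarrow> cnj Z = - Z"
  by (simp add: cnj_eq inner_e_C_im)

lemma pht_act_A: "0 < t \<Longrightarrow> pht (act_A t z) (act_A t w) = t *\<^sub>R pht z w"
  by (simp add: pht_def beta_simps algebra_simps)

lemma hgt_act_A: "0 < t \<Longrightarrow> hgt (act_A t z) = t * hgt z"
  by (simp add: hgt_eq power_mult_distrib algebra_simps)

lemma Phi_act_A: "0 < t \<Longrightarrow> Phi (act_A t z) (act_A t w) = Phi z w"
  by (simp add: Phi_def pht_act_A hgt_act_A power_mult_distrib power2_eq_square)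

lemma pht_act_N:
  assumes "Z \<in> C_im e" shows "pht (act_N J e Z X z) (act_N J e Z X w) = pht z w"
  by (simp add: pht_def beta_simps beta_same cnj_beta cnj_C_im[OF assms] algebra_simps
      flip: scaleR_add_left)

lemma hgt_act_N: "Z \<in> C_im e \<Longrightarrow> hgt (act_N J e Z X z) = hgt z"
  by (simp add: hgt_eq inner_add inner_e_C_im power2_norm_eq_inner inner_commute algebra_simps
     add_divide_distrib)

lemma Phi_act_N: "Z \<in> C_im e \<Longrightarrow> Phi (act_N J e Z X z) (act_N J e Z X w) = Phi z w"
  by (simp add: Phi_def pht_act_N hgt_act_N)

lemma act_A_inverse:
  assumes "0 < t" shows "act_A (1 / t) (act_A t z) = z" "act_A t (act_A (1 / t) z) = z"
  using assms by (auto simp: prod_eq_iff real_sqrt_divide)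

lemma act_N_inverse:
  assumes "Z \<in> C_im e"
  shows "act_N J e (- Z) (- X) (act_N J e Z X z) = z" "act_N J e Z X (act_N J e (- Z) (- X) z) = z"
  by (auto simp: prod_eq_iff beta_simps beta_same algebra_simps scaleR_add_left[symmetric])

lemma neg_C_im [simp]: "- Z \<in> C_im e \<longleftrightarrow> Z \<in> C_im e"
  by (simp add: C_im_def)

lemma inv_C_eq: "inv_C e \<zeta> = (1 / (norm \<zeta>)\<^sup>2) *\<^sub>R cnj \<zeta>"
  by (simp add: inv_C_def)

lemma norm_inv_C: "norm (inv_C e \<zeta>) = 1 / norm \<zeta>"
  by (cases "\<zeta> = 0") (auto simp: inv_C_eq power2_eq_square)

lemma inv_C_inv_C: "inv_C e (inv_C e \<zeta>) = \<zeta>"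
  unfolding inv_C_eq[of "inv_C e \<zeta>"] norm_inv_C
  by (cases "\<zeta> = 0") (auto simp: inv_C_eq[of \<zeta>] power2_eq_square)

lemma inversion_involution: "fst z \<noteq> 0 \<Longrightarrow> geod_inversion J e (geod_inversion J e z) = z"
  by (auto simp: prod_eq_iff inv_C_inv_C J_linear_simps)
     (simp add: inv_C_eq[of "fst z"] J_linear_simps inv_C_eq[of "(1 / (norm (fst z))\<^sup>2) *\<^sub>R cnj (fst z)"] power2_eq_square)

lemma fst_nonzero: "z \<in> D \<Longrightarrow> fst z \<noteq> 0"
  by (auto simp: mem_D hgt_eq)

lemma hgt_inversion: "fst z \<noteq> 0 \<Longrightarrow> hgt (geod_inversion J e z) = hgt z / (norm (fst z))\<^sup>2"
  by (simp add: hgt_eq norm_J norm_inv_C power_mult_distrib power_divide diff_divide_distrib)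
     (simp add: inv_C_eq)

lemma J_orbit_closed: "\<exists>\<zeta>. J \<xi> (J \<eta> v) = J \<zeta> v"
  using J2C unfolding J2C_module_def by blast

text \<open>
  The condition \<open>C(Cv) = Cv\<close> enters here. Applied to \<open>b = \<beta> (J \<zeta> v) u\<close>, it writes \<open>\<zeta>\<^sup>* (b u)\<close>
  as \<open>\<eta> u\<close> with \<open>|\<eta>| = |\<zeta>| |b|\<close>, so \<open>|b|\<^sup>2 = \<beta> v u \<bullet> \<eta>\<close> and Cauchy-Schwarz gives one inequality; the
  inequality for the conjugate of \<open>\<zeta>\<close> gives the other one.
\<close>
lemma norm_beta_J: "norm (\<beta> (J \<zeta> v) u) = norm \<zeta> * norm (\<beta> v u)"
proof -
  have le: "norm (\<beta> (J \<zeta> v) u) \<le> norm \<zeta> * norm (\<beta> v u)" for \<zeta> v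
  proof -
    let ?b = "\<beta> (J \<zeta> v) u"
    obtain \<eta> where \<eta>: "J (cnj \<zeta>) (J ?b u) = J \<eta> u" using J_orbit_closed by blast
    show ?thesis
    proof (cases "u = 0")
      case False
      have "norm \<eta> * norm u = norm \<zeta> * norm ?b * norm u"
        using arg_cong[OF \<eta>, of norm] by (auto simp: norm_J)
      then have n: "norm \<eta> = norm \<zeta> * norm ?b" using False by (metis mult_right_cancel norm_eq_zero)
      have "norm ?b * norm ?b = J ?b u \<bullet> J \<zeta> v"
        by (simp add: beta_inner[symmetric] power2_norm_eq_inner[symmetric] power2_eq_square)
      also have "\<dots> = J \<eta> u \<bullet> v"
        using J_adjoint[of \<zeta> v "J ?b u"] \<eta> by (simp add: inner_commute)
      also have "\<dots> = \<beta> v u \<bullet> \<eta>" by (simp add: beta_inner)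
      also have "\<dots> \<le> norm (\<beta> v u) * norm \<eta>" by (rule norm_cauchy_schwarz)
      also have "\<dots> = norm ?b * (norm \<zeta> * norm (\<beta> v u))" by (simp add: n)
      finally show ?thesis by (cases "?b = 0") auto
    qed simp
  qed
  show ?thesis
  proof (cases "\<zeta> = 0")
    case False
    have "norm (\<beta> (J (cnj \<zeta>) (J \<zeta> v)) u) \<le> norm (cnj \<zeta>) * norm (\<beta> (J \<zeta> v) u)" by (rule le)
    then have "norm \<zeta> * (norm \<zeta> * norm (\<beta> v u)) \<le> norm \<zeta> * norm (\<beta> (J \<zeta> v) u)"
      by (simp add: beta_simps power2_eq_square)
    then have "norm \<zeta> * norm (\<beta> v u) \<le> norm (\<beta> (J \<zeta> v) u)"
      by (rule mult_left_le_imp_le) (use False in simp)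
    with le[of \<zeta> v] show ?thesis by linarith
  qed simp
qed

lemma norm_beta_J2: "norm (\<beta> v (J \<zeta> u)) = norm \<zeta> * norm (\<beta> v u)"
  using norm_beta_J[of \<zeta> u v] by (metis cnj_beta norm_cnj)

text \<open>
  The square of the norm is expanded into three terms. The terms without \<open>\<beta>\<close> and the mixed term scale
  by \<open>1 / (|\<zeta>|\<^sup>2 |\<eta>|\<^sup>2)\<close> by the adjunction rules alone; the term \<open>|\<beta>|\<^sup>2\<close> needs \<open>norm_beta_J\<close>.
  The expansion replaces a direct formula for \<open>pht (\<sigma> z) (\<sigma> w)\<close>, which would need \<open>C\<close> to be an associative
  algebra acting on \<open>V\<close>.
\<close>
lemma norm_pht_inversion:
  assumes "fst z \<noteq> 0" "fst w \<noteq> 0"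
  shows "norm (pht (geod_inversion J e z) (geod_inversion J e w))
    = norm (pht z w) / (norm (fst z) * norm (fst w))"
proof -
  obtain \<zeta> v \<eta> u where [simp]: "z = (\<zeta>, v)" "w = (\<eta>, u)" by (cases z, cases w)
  have nz: "\<zeta> \<noteq> 0" "\<eta> \<noteq> 0" using assms by auto
  define n m where "n = norm \<zeta>" and "m = norm \<eta>"
  have pos: "n > 0" "m > 0" using nz by (auto simp: n_def m_def)
  have nn: "\<zeta> \<bullet> \<zeta> = n\<^sup>2" "\<eta> \<bullet> \<eta> = m\<^sup>2" by (simp_all add: n_def m_def power2_norm_eq_inner)
  let ?a = "inv_C e \<zeta>" and ?b = "inv_C e \<eta>"
  have sq: "(norm (x - (1/2) *\<^sub>R y))\<^sup>2 = x \<bullet> x - x \<bullet> y + (norm y)\<^sup>2 / 4" for x y :: 'c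
    by (simp add: power2_norm_eq_inner inner_diff inner_commute field_simps)
  have "norm (\<beta> (J ?a v) (J ?b u)) = norm (\<beta> v u) / (n * m)"
    by (simp add: norm_beta_J norm_beta_J2 norm_inv_C n_def m_def)
  then have 1: "(norm (\<beta> (J ?a v) (J ?b u)))\<^sup>2 = (norm (\<beta> v u))\<^sup>2 / (n\<^sup>2 * m\<^sup>2)"
    by (simp add: power_divide power_mult_distrib)
  have 2: "(?a + cnj ?b) \<bullet> (?a + cnj ?b) = (\<zeta> + cnj \<eta>) \<bullet> (\<zeta> + cnj \<eta>) / (n\<^sup>2 * m\<^sup>2)"
    using pos
    by (simp add: inv_C_eq inner_add cnj_inner nn inner_commute flip: n_def m_def)
       (simp add: field_simps power2_eq_square, metis cnj_inner inner_commute)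
  have 3: "(?a + cnj ?b) \<bullet> \<beta> (J ?a v) (J ?b u) = (\<zeta> + cnj \<eta>) \<bullet> \<beta> v u / (n\<^sup>2 * m\<^sup>2)"
  proof -
    have "(?a + cnj ?b) \<bullet> \<beta> (J ?a v) (J ?b u) = J ?a (J ?b u) \<bullet> J ?a v + J (cnj ?b) (J ?b u) \<bullet> J ?a v"
      by (simp add: inner_commute[of _ "\<beta> _ _"] beta_inner J_linear_simps inner_add)
    also have "\<dots> = (J ?b u \<bullet> v + u \<bullet> J ?a v * (n\<^sup>2 / m\<^sup>2)) / n\<^sup>2"
      using pos by (simp add: inner_J_J_same norm_inv_C power_divide field_simps flip: n_def m_def)
    also have "\<dots> = (J (cnj \<eta>) u \<bullet> v + u \<bullet> J (cnj \<zeta>) v) / (n\<^sup>2 * m\<^sup>2)"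
      using pos by (simp add: inv_C_eq J_linear_simps field_simps flip: n_def m_def)
    also have "\<dots> = (\<zeta> + cnj \<eta>) \<bullet> \<beta> v u / (n\<^sup>2 * m\<^sup>2)"
      by (simp add: inner_commute[of _ "\<beta> _ _"] beta_inner J_linear_simps inner_add J_adjoint[of \<zeta>])
    finally show ?thesis .
  qed
  have "(norm (pht (geod_inversion J e z) (geod_inversion J e w)))\<^sup>2
      = (norm (pht z w))\<^sup>2 / (n\<^sup>2 * m\<^sup>2)"
    by (simp add: pht_def beta_simps sq 1 2 3 diff_divide_distrib add_divide_distrib)
  also have "\<dots> = (norm (pht z w) / (n * m))\<^sup>2"
    by (simp add: power_divide power_mult_distrib)
  finally show ?thesis
    using pos by (subst (asm) power2_eq_iff_nonneg) (auto simp: n_def m_def)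
qed

lemma Phi_inversion:
  assumes "z \<in> D" "w \<in> D"
  shows "Phi (geod_inversion J e z) (geod_inversion J e w) = Phi z w"
  using assms[THEN fst_nonzero]
  by (simp add: Phi_def norm_pht_inversion hgt_inversion power_divide power_mult_distrib)

section \<open>The Riemannian metric in coordinates\<close>

text \<open>
  The metric tensor of \<open>D\<close> on the diagonal (\<open>D_metric_eq_Qmet\<close>).
\<close>
definition Qmet :: "'c \<times> 'v \<Rightarrow> 'c \<times> 'v \<Rightarrow> real" where
  "Qmet z a = (norm (fst a - (1/2) *\<^sub>R \<beta> (snd a) (snd z)))\<^sup>2 / (hgt z)\<^sup>2 + (norm (snd a))\<^sup>2 / hgt z"

lemma im_part_eq: "im_part e \<zeta> = \<zeta> - (e \<bullet> \<zeta>) *\<^sub>R e"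
  by (simp add: im_part_def re_part_def)

lemma im_part_C_im [simp]: "im_part e \<zeta> \<in> C_im e"
  by (simp add: im_part_eq C_im_def inner_diff)

lemma im_part_scaleR: "im_part e (r *\<^sub>R \<zeta>) = r *\<^sub>R im_part e \<zeta>"
  by (simp add: im_part_eq algebra_simps)

lemma bracket_eq: "bracket J e x y = im_part e (\<beta> y x)"
proof (rule bracket_eqI[OF J2C])
  fix z assume "z \<in> C_im e"
  then show "z \<bullet> im_part e (\<beta> y x) = J z x \<bullet> y"
    by (simp add: im_part_eq inner_diff inner_e_C_im inner_commute[of z "\<beta> y x"] beta_inner)
qed simp

lemma D_metric_eq_Qmet:
  assumes z: "z \<in> D"
  shows "D_metric J e z a a = Qmet z a"
proof -
  obtain \<zeta> v \<xi> x where [simp]: "z = (\<zeta>, v)" "a = (\<xi>, x)" by (cases z, cases a)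
  define h where "h = hgt z"
  have h: "h > 0" "h = e \<bullet> \<zeta> - (norm v)\<^sup>2 / 4" using z by (auto simp: mem_D h_def hgt_eq)
  define \<eta> where "\<eta> = \<xi> - (1/2) *\<^sub>R \<beta> x v"
  define s where "s = (h, im_part e \<zeta>, v)"
  have s: "s \<in> S_set e" using h by (simp add: s_def S_set_def)
  have sz: "S_to_D e s = z"
    by (simp add: s_def h(2) im_part_eq)
  \<comment> \<open>The tangent vector at the identity of \<open>S\<close> that left translation by \<open>s\<close> and
    \<open>S_to_D\<close> carry to \<open>a\<close>.\<close>
  define c where "c = ((e \<bullet> \<eta>) / h, (1/h) *\<^sub>R im_part e \<eta>, (1 / sqrt h) *\<^sub>R x)"
  have c: "c \<in> T_S e" by (simp add: c_def T_S_def C_im_def im_part_eq inner_diff)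
  have dL: "frechet_derivative (S_mult J e s) (at S_one) =
     (\<lambda>(\<tau>, z, x). (h * \<tau>, h *\<^sub>R z + (1/2 * sqrt h) *\<^sub>R bracket J e v x, sqrt h *\<^sub>R x))"
    unfolding s_def by (rule frechet_derivative_at[OF S_mult_derivative[OF J2C], symmetric])
  have dT: "frechet_derivative (S_to_D e) (at s) =
     (\<lambda>(\<tau>, z, x). ((\<tau> + 1/2 * (v \<bullet> x)) *\<^sub>R e + z, x))"
    unfolding s_def by (rule frechet_derivative_at[OF S_to_D_derivative, symmetric])
  let ?b = "frechet_derivative (S_mult J e s) (at S_one) c"
  have b: "?b = (e \<bullet> \<eta>, im_part e \<eta> + (1/2) *\<^sub>R im_part e (\<beta> x v), x)"
    using h(1) by (simp add: dL c_def bracket_eq beta_simps im_part_scaleR)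
  have bT: "?b \<in> T_S e"
    by (simp add: b T_S_def C_im_def im_part_eq inner_diff inner_add)
  have a: "frechet_derivative (S_to_D e) (at s) ?b = a"
    by (simp add: dT b im_part_eq \<eta>_def inner_diff inner_commute algebra_simps)
  have "D_metric J e z a a = S_metric J e s ?b ?b"
    using S_to_D_isometry[OF norm_e s bT bT] by (simp only: a sz)
  also have "\<dots> = c \<bullet> c"
    by (rule S_metric_left_invariant[OF J2C s c c])
  also have "\<dots> = ((e \<bullet> \<eta>)\<^sup>2 + im_part e \<eta> \<bullet> im_part e \<eta>) / h\<^sup>2 + (norm x)\<^sup>2 / h"
    using h(1) by (simp add: c_def power2_norm_eq_inner add_divide_distrib power2_eq_square[of h]
        power2_eq_square[of "e \<bullet> \<eta>"])
  also have "(e \<bullet> \<eta>)\<^sup>2 + im_part e \<eta> \<bullet> im_part e \<eta> = (norm \<eta>)\<^sup>2"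
    by (simp add: im_part_eq inner_diff power2_norm_eq_inner inner_commute)
       (simp add: power2_eq_square)
  finally show ?thesis by (simp add: Qmet_def \<eta>_def h_def)
qed

section \<open>The gradient of the invariant\<close>

lemma has_derivative_hgt:
  "(hgt has_derivative (\<lambda>a. e \<bullet> fst a - (snd z \<bullet> snd a) / 2)) (at z)"
proof -
  have *: "hgt = (\<lambda>z. e \<bullet> fst z - (snd z \<bullet> snd z) / 4)"
    by (simp add: fun_eq_iff hgt_eq power2_norm_eq_inner)
  show ?thesis unfolding *
    by (auto intro!: derivative_eq_intros simp: inner_commute)
qed

lemma has_derivative_pht:
  "((\<lambda>z. pht z w) has_derivative (\<lambda>a. fst a - (1/2) *\<^sub>R \<beta> (snd a) (snd w))) (at z)"
proof -
  note [derivative_intros] = bounded_linear.has_derivative[OF beta.bounded_linear_left]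
  show ?thesis unfolding pht_def
    by (auto intro!: derivative_eq_intros)
qed

text \<open>
  The derivative of \<open>\<lambda>z. Phi z w\<close> at \<open>z\<close> in direction \<open>a\<close> (\<open>has_derivative_Phi\<close>).
\<close>
definition dPhi :: "'c \<times> 'v \<Rightarrow> 'c \<times> 'v \<Rightarrow> 'c \<times> 'v \<Rightarrow> real" where
  "dPhi w z a = (pht z w \<bullet> (fst a - (1/2) *\<^sub>R \<beta> (snd a) (snd w))) / (2 * hgt z * hgt w)
     - Phi z w * (e \<bullet> fst a - (snd z \<bullet> snd a) / 2) / hgt z"

lemma has_derivative_Phi:
  assumes "z \<in> D" "w \<in> D"
  shows "((\<lambda>z. Phi z w) has_derivative dPhi w z) (at z)"
proof -
  have pos: "hgt z \<noteq> 0" "hgt w \<noteq> 0" using assms by (auto simp: mem_D)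
  have *: "(\<lambda>z. Phi z w) = (\<lambda>z. (pht z w \<bullet> pht z w) / (4 * hgt z * hgt w))"
    by (auto simp: Phi_def power2_norm_eq_inner)
  show ?thesis unfolding *
    apply (rule derivative_eq_intros has_derivative_pht has_derivative_hgt refl)+
    using pos
    by (auto simp: fun_eq_iff dPhi_def Phi_def power2_norm_eq_inner inner_commute) (simp add: field_simps inner_commute)
qed

text \<open>
  The inequality \<open>|grad Phi|\<^sup>2 \<le> Phi * (Phi - 1)\<close>, which says that the distance from \<open>w\<close> is 1-Lipschitz. In the
  coordinates \<open>\<eta> = \<xi> - \<beta> x v / 2\<close> and \<open>x\<close> the metric is diagonal, \<open>(A, B)\<close> is the gradient, and
  \<open>|(A, B)|\<^sup>2\<close> simplifies because \<open>|pht z w|\<^sup>2\<close> is a multiple of \<open>Phi\<close> and the real part of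
  \<open>pht z w\<close> is \<open>h + k + |v - v'|\<^sup>2 / 4\<close>.
\<close>
lemma dPhi_bound:
  assumes "z \<in> D" "w \<in> D"
  shows "(dPhi w z a)\<^sup>2 \<le> Qmet z a * (Phi z w * (Phi z w - 1))"
proof -
  define h k where "h = hgt z" and "k = hgt w"
  have pos: "h > 0" "k > 0" using assms by (auto simp: mem_D h_def k_def)
  obtain \<xi> x where [simp]: "a = (\<xi>, x)" by (cases a)
  let ?P = "pht z w" and ?F = "Phi z w"
  define d where "d = snd z - snd w"
  define \<eta> where "\<eta> = \<xi> - (1/2) *\<^sub>R \<beta> x (snd z)"
  define A where "A = (1/2/k) *\<^sub>R ?P - ?F *\<^sub>R e"
  define B where "B = (1 / (4 * sqrt h * k)) *\<^sub>R J ?P d"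
  have F: "?P \<bullet> ?P = 4 * h * k * ?F" using pos by (simp add: Phi_def power2_norm_eq_inner flip: h_def k_def)
  have RP: "e \<bullet> ?P = h + k + (d \<bullet> d) / 4" by (simp add: inner_e_pht h_def k_def d_def power2_norm_eq_inner)
  have sh: "sqrt h * sqrt h = h" using pos by simp
  have eta: "\<xi> - (1/2) *\<^sub>R \<beta> x (snd w) = \<eta> + (1/2) *\<^sub>R \<beta> x d"
    by (simp add: \<eta>_def d_def beta_simps algebra_simps)
  have "dPhi w z a = (?P \<bullet> \<eta> + (1/2) * (J ?P d \<bullet> x)) / (2*h*k) - ?F * (e \<bullet> \<eta>) / h"
    by (simp add: dPhi_def eta inner_add inner_commute[of ?P "\<beta> _ _"] beta_inner flip: h_def k_def)
       (simp add: \<eta>_def inner_diff)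
  also have "\<dots> = (A, B) \<bullet> ((1/h) *\<^sub>R \<eta>, (1 / sqrt h) *\<^sub>R x)"
    using pos sh by (simp add: A_def B_def inner_diff field_simps)
  finally have "(dPhi w z a)\<^sup>2 \<le> ((A, B) \<bullet> (A, B)) * (((1/h) *\<^sub>R \<eta>, (1 / sqrt h) *\<^sub>R x) \<bullet> ((1/h) *\<^sub>R \<eta>, (1 / sqrt h) *\<^sub>R x))"
    using Cauchy_Schwarz_ineq by metis
  also have "((1/h) *\<^sub>R \<eta>, (1 / sqrt h) *\<^sub>R x) \<bullet> ((1/h) *\<^sub>R \<eta>, (1 / sqrt h) *\<^sub>R x) = Qmet z a"
    using pos by (simp add: Qmet_def power2_norm_eq_inner power2_eq_square[of h] flip: h_def \<eta>_def)
  also have "(A, B) \<bullet> (A, B) = ?F * (?F - 1)"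
  proof -
    have "A \<bullet> A = (?P \<bullet> ?P) / (4*k\<^sup>2) - ?F * (e \<bullet> ?P) / k + ?F\<^sup>2"
      by (simp add: A_def inner_diff inner_commute power2_eq_square)
    also have "\<dots> = h * ?F / k - ?F * (h + k + (d \<bullet> d) / 4) / k + ?F\<^sup>2"
      using pos by (simp add: F RP power2_eq_square)
    finally have AA: "A \<bullet> A = h * ?F / k - ?F * (h + k + (d \<bullet> d) / 4) / k + ?F\<^sup>2" .
    have "B \<bullet> B = (?P \<bullet> ?P) * (d \<bullet> d) / (16 * h * k\<^sup>2)"
      using pos by (simp add: B_def inner_J_J_same power2_norm_eq_inner power2_eq_square[of k])
    also have "\<dots> = ?F * (d \<bullet> d) / (4 * k)"
      using pos by (simp add: F power2_eq_square)
    finally show ?thesis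
      using pos by (simp add: AA) (simp add: field_simps power2_eq_square)
  qed
  finally show ?thesis by (simp add: mult.commute)
qed

section \<open>Geodesics\<close>

lemma inner_J_J_left: "J \<zeta> v \<bullet> J \<eta> v = (\<zeta> \<bullet> \<eta>) * (norm v)\<^sup>2"
  using inner_J_J_polar[of \<zeta> v \<eta> v] by (simp add: power2_norm_eq_inner inner_commute)

text \<open>
  The image under the Cayley transform of a radius of the unit ball. With \<open>w = s + Z\<close>, which together with \<open>e\<close>
  spans a copy of the complex numbers acting on \<open>u\<close>, the curve is \<open>\<zeta> = (1 + l w) / (1 - l w)\<close>,
  \<open>v = 2 l (1 - l w)\<^sup>-\<^sup>1 u\<close>; \<open>\<kappa>\<close> is \<open>|1 - l w|\<^sup>2\<close>, and the derivatives are \<open>2 w (1 - l w)\<^sup>-\<^sup>2\<close> and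
  \<open>2 (1 - l w)\<^sup>-\<^sup>2 u\<close>, where \<open>(1 - l w)\<^sup>-\<^sup>2 = (c1 + c2 Z) / \<kappa>\<^sup>2\<close>.
\<close>
lemma geodesic_from_base:
  fixes s r l :: real and Z :: 'c and u :: 'v
  assumes Z: "Z \<in> C_im e" and r: "s\<^sup>2 + (norm Z)\<^sup>2 + (norm u)\<^sup>2 = r\<^sup>2" "r\<^sup>2 < 1"
  defines "n \<equiv> (norm Z)\<^sup>2"
  defines "\<kappa> \<equiv> \<lambda>l. (1 - l * s)\<^sup>2 + l\<^sup>2*n"
  defines "\<gamma> \<equiv> \<lambda>l. (((1 - l\<^sup>2*(s\<^sup>2 + n)) / \<kappa> l) *\<^sub>R e + (2*l / \<kappa> l) *\<^sub>R Z,
                  (2*l*(1 - l * s) / \<kappa> l) *\<^sub>R u + (2*l\<^sup>2 / \<kappa> l) *\<^sub>R J Z u)"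
  defines "c1 \<equiv> \<lambda>l. (1 - l * s)\<^sup>2 - l\<^sup>2*n" and "c2 \<equiv> \<lambda>l. 2*l*(1 - l * s)"
  defines "\<gamma>' \<equiv> \<lambda>l. ((2*(s*c1 l - n*c2 l) / (\<kappa> l)\<^sup>2) *\<^sub>R e + (2*(s*c2 l + c1 l) / (\<kappa> l)\<^sup>2) *\<^sub>R Z,
                  (2*c1 l / (\<kappa> l)\<^sup>2) *\<^sub>R u + (2*c2 l / (\<kappa> l)\<^sup>2) *\<^sub>R J Z u)"
  assumes l: "0 \<le> l" "l \<le> 1"
  shows "\<gamma> l \<in> D" "(\<gamma> has_vector_derivative \<gamma>' l) (at l)"
    "Qmet (\<gamma> l) (\<gamma>' l) = (2 * r / (1 - l\<^sup>2 * r\<^sup>2))\<^sup>2"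
proof -
  define U where "U = (norm u)\<^sup>2"
  define m where "m = 1 - l * s"
  define X where "X = \<kappa> l"
  have rr: "r\<^sup>2 = s\<^sup>2 + n + U" using r by (simp add: n_def U_def)
  have n0: "n \<ge> 0" "U \<ge> 0" by (simp_all add: n_def U_def)
  have "s\<^sup>2 < 1" using rr n0 r(2) by linarith
  then have "\<bar>s\<bar> < 1" by (simp add: abs_square_less_1)
  then have "l * s < 1"
    using l by (smt (verit) mult_left_le_one_le mult_nonneg_nonpos)
  then have m: "m > 0" by (simp add: m_def)
  have X: "X = m\<^sup>2 + l\<^sup>2*n" by (simp add: X_def \<kappa>_def m_def)
  have X0: "X > 0" using m n0 by (auto simp: X intro!: add_pos_nonneg)
  have ls: "l * s = 1 - m" by (simp add: m_def)
  have Ze: "e \<bullet> Z = 0" "Z \<bullet> e = 0" using inner_e_C_im[OF Z] by auto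
  have ZZ: "Z \<bullet> Z = n" by (simp add: n_def power2_norm_eq_inner)
  have uJ: "u \<bullet> J Z u = 0" "J Z u \<bullet> u = 0" "J Z u \<bullet> J Z u = n * U" "u \<bullet> u = U"
    using inner_J_J_left[of e u Z] inner_J_J_left[of Z u e] inner_J_J_left[of Z u Z]
    by (simp_all add: Ze ZZ U_def power2_norm_eq_inner)
  have lr: "l\<^sup>2 * r\<^sup>2 < 1"
  proof -
    have "l\<^sup>2 * r\<^sup>2 \<le> 1 * r\<^sup>2" using l by (intro mult_right_mono) (auto simp: power_le_one)
    then show ?thesis using r(2) by simp
  qed
  define p q where "p = 2*l*m / X" and "q = 2*l\<^sup>2/X"
  define A0 where "A0 = (1 - l\<^sup>2*(s\<^sup>2 + n)) / X"
  have gl: "\<gamma> l = (A0 *\<^sub>R e + (2*l/X) *\<^sub>R Z, p *\<^sub>R u + q *\<^sub>R J Z u)"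
    by (simp add: \<gamma>_def A0_def p_def q_def m_def X_def)
  have pq: "p\<^sup>2 + n*q\<^sup>2 = 4*l\<^sup>2/X"
  proof -
    have "p\<^sup>2 + n*q\<^sup>2 = 4*l\<^sup>2*(m\<^sup>2 + l\<^sup>2*n)/X\<^sup>2"
      by (simp add: p_def q_def power_divide power_mult_distrib add_divide_distrib algebra_simps flip: power_mult)
    then show ?thesis using X0 unfolding X[symmetric] by (simp add: power2_eq_square)
  qed
  have "(norm (p *\<^sub>R u + q *\<^sub>R J Z u))\<^sup>2 = (p\<^sup>2 + n*q\<^sup>2)*U"
    by (simp add: power2_norm_eq_inner inner_add uJ) (simp add: power2_eq_square algebra_simps)
  then have H: "hgt (\<gamma> l) = (1 - l\<^sup>2*r\<^sup>2) / X"
    using X0 by (simp add: hgt_eq gl pq inner_add Ze A0_def rr field_simps)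
  show "\<gamma> l \<in> D" using H lr X0 by (simp add: mem_D)

  have Xd: "(\<kappa> has_real_derivative (- 2 * s*m + 2*l*n)) (at l)"
    unfolding \<kappa>_def by (auto intro!: derivative_eq_intros simp: m_def)
  have X1: "\<kappa> l \<noteq> 0" using X0 by (simp add: X_def)
  have quot: "((\<lambda>l. f l / \<kappa> l) has_real_derivative g) (at l)"
    if "(f has_real_derivative f') (at l)" "f' * X - f l * (- 2 * s*m + 2*l*n) = g * X\<^sup>2" for f f' g
    by (rule DERIV_cong[OF DERIV_divide[OF that(1) Xd X1]])
       (use that(2) X0 in \<open>simp add: X_def power2_eq_square\<close>)
  have c: "c1 l = m\<^sup>2 - l\<^sup>2*n" "c2 l = 2*l*m" by (simp_all add: c1_def c2_def m_def)
  have d1: "((\<lambda>l. (1 - l\<^sup>2*(s\<^sup>2 + n)) / \<kappa> l) has_real_derivative 2*(s*c1 l - n*c2 l) / X\<^sup>2) (at l)"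
    apply (rule quot)
     apply (auto intro!: derivative_eq_intros)[1]
    using X0 by (simp add: c X) (simp add: m_def, algebra)
  have d2: "((\<lambda>l. 2*l / \<kappa> l) has_real_derivative 2*(s*c2 l + c1 l) / X\<^sup>2) (at l)"
    apply (rule quot)
     apply (auto intro!: derivative_eq_intros)[1]
    using X0 by (simp add: c X) (simp add: m_def, algebra)
  have d3: "((\<lambda>l. 2*l*(1 - l * s) / \<kappa> l) has_real_derivative 2*c1 l / X\<^sup>2) (at l)"
    apply (rule quot)
     apply (auto intro!: derivative_eq_intros)[1]
    using X0 by (simp add: c X) (simp add: m_def, algebra)
  have d4: "((\<lambda>l. 2*l\<^sup>2 / \<kappa> l) has_real_derivative 2*c2 l / X\<^sup>2) (at l)"
    apply (rule quot)
     apply (auto intro!: derivative_eq_intros)[1]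
    using X0 by (simp add: c X) (simp add: m_def, algebra)
  have sc: "((\<lambda>l. f l *\<^sub>R v) has_vector_derivative g *\<^sub>R v) (at l)"
    if "(f has_real_derivative g) (at l)" for f g and v :: "'z::real_normed_vector"
    using has_vector_derivative_scaleR[OF that has_vector_derivative_const[of v]] by simp
  have sv: "((\<lambda>l. f l *\<^sub>R v) has_vector_derivative g *\<^sub>R v) (at l)"
    if "(f has_real_derivative g) (at l)" for f g and v :: 'v
    using has_vector_derivative_scaleR[OF that has_vector_derivative_const[of v]] by simp
  show "(\<gamma> has_vector_derivative \<gamma>' l) (at l)"
    unfolding \<gamma>_def \<gamma>'_def X_def[symmetric]
    by (intro has_vector_derivative_Pair has_vector_derivative_add sc sv)
       (use d1 d2 d3 d4 in \<open>simp_all add: X_def\<close>)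

  define A B where "A = s*c1 l - n*c2 l - l*m*U" and "B = s*c2 l + c1 l - l\<^sup>2*U"
  have bt: "\<beta> u u = U *\<^sub>R e" "\<beta> (J Z u) (J Z u) = (n*U) *\<^sub>R e" "\<beta> (J Z u) u = U *\<^sub>R Z" "\<beta> u (J Z u) = - (U *\<^sub>R Z)"
  proof -
    show "\<beta> u u = U *\<^sub>R e" "\<beta> (J Z u) (J Z u) = (n*U) *\<^sub>R e"
      using uJ by (simp_all add: beta_same power2_norm_eq_inner)
    show *: "\<beta> (J Z u) u = U *\<^sub>R Z"
      by (rule beta_eqI) (simp add: inner_J_J_left U_def inner_commute)
    show "\<beta> u (J Z u) = - (U *\<^sub>R Z)"
      using arg_cong[OF *, of cnj] by (simp add: cnj_beta cnj_C_im[OF Z])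
  qed
  have eta: "fst (\<gamma>' l) - (1/2) *\<^sub>R \<beta> (snd (\<gamma>' l)) (snd (\<gamma> l)) = (2/X\<^sup>2) *\<^sub>R (A *\<^sub>R e + B *\<^sub>R Z)"
  proof -
    define P Q where "P = 2*c1 l / X\<^sup>2" and "Q = 2*c2 l / X\<^sup>2"
    have "P*p + n*Q*q = 4*l*(c1 l*m + c2 l*l*n)/X^3"
      using X0 by (simp add: P_def Q_def p_def q_def field_simps power2_eq_square power3_eq_cube)
    also have "c1 l*m + c2 l*l*n = m * X" by (simp add: c X) algebra
    finally have 1: "P*p + n*Q*q = 4*l*m/X\<^sup>2" using X0 by (simp add: power2_eq_square power3_eq_cube)
    have "Q*p - P*q = 4*l*(c2 l*m - c1 l*l)/X^3"
      using X0 by (simp add: P_def Q_def p_def q_def field_simps power2_eq_square power3_eq_cube)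
    also have "c2 l*m - c1 l*l = l * X" by (simp add: c X) algebra
    finally have 2: "Q*p - P*q = 4*l\<^sup>2/X\<^sup>2" using X0 by (simp add: power2_eq_square power3_eq_cube)
    have s: "snd (\<gamma>' l) = P *\<^sub>R u + Q *\<^sub>R J Z u" "snd (\<gamma> l) = p *\<^sub>R u + q *\<^sub>R J Z u"
      by (simp_all add: \<gamma>'_def gl P_def Q_def X_def)
    have "\<beta> (snd (\<gamma>' l)) (snd (\<gamma> l)) = ((P*p + n*Q*q)*U) *\<^sub>R e + ((Q*p - P*q)*U) *\<^sub>R Z"
      by (simp add: s beta_simps bt algebra_simps)
    then have bb: "\<beta> (snd (\<gamma>' l)) (snd (\<gamma> l)) = (4*l*m/X\<^sup>2*U) *\<^sub>R e + (4*l\<^sup>2/X\<^sup>2*U) *\<^sub>R Z"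
      unfolding 1 2 .
    have f: "fst (\<gamma>' l) = (2*(s*c1 l - n*c2 l)/X\<^sup>2) *\<^sub>R e + (2*(s*c2 l + c1 l)/X\<^sup>2) *\<^sub>R Z"
      by (simp add: \<gamma>'_def X_def)
    have 3: "2*(s*c1 l - n*c2 l)/X\<^sup>2 - (1/2)*(4*l*m/X\<^sup>2*U) = 2/X\<^sup>2*A"
      "2*(s*c2 l + c1 l)/X\<^sup>2 - (1/2)*(4*l\<^sup>2/X\<^sup>2*U) = 2/X\<^sup>2*B"
      using X0 by (simp_all add: A_def B_def field_simps)
    have "(x *\<^sub>R e + y *\<^sub>R Z) - (1/2) *\<^sub>R (x' *\<^sub>R e + y' *\<^sub>R Z) = (x - (1/2)*x') *\<^sub>R e + (y - (1/2)*y') *\<^sub>R Z" for x x' y y'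
      by (simp add: algebra_simps)
    then show ?thesis unfolding bb f 3 by (simp only: 3 scaleR_add_right scaleR_scaleR)
  qed
  have n1: "(norm (fst (\<gamma>' l) - (1/2) *\<^sub>R \<beta> (snd (\<gamma>' l)) (snd (\<gamma> l))))\<^sup>2 = 4/X^4 * (A\<^sup>2 + n*B\<^sup>2)"
    unfolding eta
    by (simp add: power2_norm_eq_inner inner_add Ze ZZ power_mult_distrib power_divide)
       (simp add: power2_eq_square power4_eq_xxxx algebra_simps)
  have AB: "A\<^sup>2 + n*B\<^sup>2 = X * (s\<^sup>2 + n - 2*l*r\<^sup>2 * s + l\<^sup>2*(r\<^sup>2)\<^sup>2)"
    unfolding A_def B_def c X rr m_def by algebra
  have n2: "(norm (snd (\<gamma>' l)))\<^sup>2 = 4/X\<^sup>2 * U"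
  proof -
    have "(norm (snd (\<gamma>' l)))\<^sup>2 = 4/X^4 * ((c1 l)\<^sup>2 + n*(c2 l)\<^sup>2)*U"
      by (simp add: \<gamma>'_def power2_norm_eq_inner inner_add uJ X_def[symmetric])
         (simp add: power2_eq_square power4_eq_xxxx algebra_simps add_divide_distrib)
    also have "(c1 l)\<^sup>2 + n*(c2 l)\<^sup>2 = X\<^sup>2" unfolding c X by algebra
    finally show ?thesis using X0 by (simp add: power2_eq_square power4_eq_xxxx)
  qed
  define w where "w = 1 - l\<^sup>2*r\<^sup>2"
  have w: "w > 0" using lr by (simp add: w_def)
  have "Qmet (\<gamma> l) (\<gamma>' l) = 4 / (X * w\<^sup>2) * ((s\<^sup>2 + n - 2*l*r\<^sup>2 * s + l\<^sup>2*(r\<^sup>2)\<^sup>2) + U * w)"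
    unfolding Qmet_def n1 n2 H AB w_def[symmetric] using X0 w
    by (simp add: field_simps power2_eq_square power4_eq_xxxx)
  also have "(s\<^sup>2 + n - 2*l*r\<^sup>2 * s + l\<^sup>2*(r\<^sup>2)\<^sup>2) + U * w = r\<^sup>2 * X"
    unfolding w_def rr X m_def by algebra
  finally show "Qmet (\<gamma> l) (\<gamma>' l) = (2 * r / (1 - l\<^sup>2 * r\<^sup>2))\<^sup>2"
    using X0 w by (simp add: power_divide power_mult_distrib flip: w_def)
qed

text \<open>
  The parameters come from inverting the Cayley transform: \<open>s + Z\<close> is \<open>(\<zeta> - 1) / (\<zeta> + 1)\<close>,
  \<open>u\<close> is \<open>(\<zeta> + 1)\<^sup>-\<^sup>1 v\<close>, and \<open>\<Delta> = |\<zeta> + 1|\<^sup>2\<close>.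
\<close>
lemma exists_geodesic_from_base:
  assumes q: "q \<in> D"
  shows "\<exists>\<gamma> \<gamma>' r. 0 \<le> r \<and> r < 1 \<and> \<gamma> 0 = base \<and> \<gamma> 1 = q \<and> Phi q base = 1 / (1 - r\<^sup>2) \<and>
    (\<forall>l\<in>{0..1}. \<gamma> l \<in> D \<and> (\<gamma> has_vector_derivative \<gamma>' l) (at l) \<and>
      Qmet (\<gamma> l) (\<gamma>' l) = (2 * r / (1 - l\<^sup>2 * r\<^sup>2))\<^sup>2)"
proof -
  obtain \<zeta> v where q_eq: "q = (\<zeta>, v)" by (cases q)
  define a where "a = e \<bullet> \<zeta>"
  define h where "h = a - (norm v)\<^sup>2 / 4"
  have h: "h > 0" using q by (simp add: q_eq mem_D hgt_eq h_def a_def)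
  then have a: "a > 0" using zero_le_power2[of "norm v"] unfolding h_def by linarith
  define \<Delta> where "\<Delta> = (norm (\<zeta> + e))\<^sup>2"
  have \<Delta>: "\<Delta> = (norm \<zeta>)\<^sup>2 + 2*a + 1"
    by (simp add: \<Delta>_def a_def power2_norm_eq_inner inner_add inner_commute)
  have \<Delta>0: "\<Delta> > 0" using a by (simp add: \<Delta> add_nonneg_pos)
  define s where "s = ((norm \<zeta>)\<^sup>2 - 1) / \<Delta>"
  have "(norm \<zeta>)\<^sup>2 - 1 = \<Delta> - (2*a + 2)" by (simp add: \<Delta>)
  then have s1: "s = 1 - (2*a + 2)/\<Delta>" unfolding s_def using \<Delta>0 by (simp only: diff_divide_distrib) simp
  define Z where "Z = (2 / \<Delta>) *\<^sub>R im_part e \<zeta>"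
  define u where "u = (1/\<Delta>) *\<^sub>R J (cnj (\<zeta> + e)) v"
  define r where "r = sqrt (1 - 4*h/\<Delta>)"
  have Z: "Z \<in> C_im e" by (simp add: Z_def C_im_def im_part_eq inner_diff)
  have nZ: "(norm Z)\<^sup>2 = 4 * ((norm \<zeta>)\<^sup>2 - a\<^sup>2) / \<Delta>\<^sup>2"
    unfolding power2_norm_eq_inner
    by (simp add: Z_def im_part_eq inner_diff inner_commute a_def) (simp add: power2_eq_square)
  have nu: "(norm u)\<^sup>2 = (norm v)\<^sup>2 / \<Delta>"
    using \<Delta>0 by (simp add: u_def norm_J power_divide power_mult_distrib del: cnj_simps(4))
       (simp add: power2_eq_square flip: \<Delta>_def[unfolded power2_eq_square])
  have 1: "s\<^sup>2 + (norm Z)\<^sup>2 = 1 - 4*a/\<Delta>"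
  proof -
    have "s\<^sup>2 + (norm Z)\<^sup>2 = (((norm \<zeta>)\<^sup>2 - 1)\<^sup>2 + 4 * ((norm \<zeta>)\<^sup>2 - a\<^sup>2)) / \<Delta>\<^sup>2"
      by (simp add: s_def nZ power_divide add_divide_distrib)
    also have "((norm \<zeta>)\<^sup>2 - 1)\<^sup>2 + 4 * ((norm \<zeta>)\<^sup>2 - a\<^sup>2) = (\<Delta> - 4*a) * \<Delta>"
      unfolding \<Delta> by algebra
    also have "(\<Delta> - 4*a) * \<Delta> / \<Delta>\<^sup>2 = 1 - 4*a/\<Delta>"
      using \<Delta>0 by (simp add: field_simps power2_eq_square)
    finally show ?thesis .
  qed
  then have 2: "s\<^sup>2 + (norm Z)\<^sup>2 + (norm u)\<^sup>2 = 1 - 4*h/\<Delta>"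
    by (simp add: nu h_def diff_divide_distrib)
  then have "1 - 4*h/\<Delta> \<ge> 0" by (metis add_nonneg_nonneg zero_le_power2)
  then have r: "r \<ge> 0" "r\<^sup>2 = 1 - 4*h/\<Delta>" by (auto simp: r_def)
  have r1: "r\<^sup>2 < 1" using h \<Delta>0 by (simp add: r)
  have "r < 1" using r1 r(1) by (simp add: abs_square_less_1)
  have Phi: "Phi q base = 1 / (1 - r\<^sup>2)"
    using \<Delta>0 h by (simp add: r Phi_def pht_def q_eq hgt_eq h_def a_def \<Delta>_def)
  have \<kappa>1: "(1 - s)\<^sup>2 + (norm Z)\<^sup>2 = 4/\<Delta>"
  proof -
    have "(1 - s)\<^sup>2 + (norm Z)\<^sup>2 = 1 - 2 * s + (1 - 4*a/\<Delta>)"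
      using 1 by (simp add: power2_eq_square algebra_simps)
    then show ?thesis unfolding s1 by (simp add: add_divide_distrib)
  qed
  have g1: "J ((1 - s) *\<^sub>R e + Z) u = (2/\<Delta>) *\<^sub>R v"
  proof -
    have os: "(1 - s) = (2 + 2*a)/\<Delta>" by (simp add: s1)
    have "(1 - s) *\<^sub>R e + Z = (2/\<Delta>) *\<^sub>R (\<zeta> + e)"
      unfolding os by (simp add: Z_def im_part_eq algebra_simps add_divide_distrib flip: a_def)
    then have "J ((1 - s) *\<^sub>R e + Z) u = ((2/\<Delta>) * (1/\<Delta>)) *\<^sub>R J (\<zeta> + e) (J (cnj (\<zeta> + e)) v)"
      by (simp add: J_linear_simps(5,6) u_def del: cnj_simps(4))
    also have "\<dots> = (2/\<Delta>) *\<^sub>R v"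
      unfolding J_J_cnj \<Delta>_def[symmetric] using \<Delta>0 by simp
    finally show ?thesis .
  qed
  let ?\<kappa> = "\<lambda>l. (1 - l * s)\<^sup>2 + l\<^sup>2*(norm Z)\<^sup>2"
  let ?\<gamma> = "\<lambda>l. (((1 - l\<^sup>2*(s\<^sup>2 + (norm Z)\<^sup>2)) / ?\<kappa> l) *\<^sub>R e + (2*l / ?\<kappa> l) *\<^sub>R Z,
                  (2*l*(1 - l * s) / ?\<kappa> l) *\<^sub>R u + (2*l\<^sup>2 / ?\<kappa> l) *\<^sub>R J Z u)"
  have "?\<gamma> 1 = q"
  proof -
    have "fst (?\<gamma> 1) = ((1 - (s\<^sup>2 + (norm Z)\<^sup>2)) / ((1 - s)\<^sup>2 + (norm Z)\<^sup>2)) *\<^sub>R e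
        + (2 / ((1 - s)\<^sup>2 + (norm Z)\<^sup>2)) *\<^sub>R Z"
      by simp
    also have "\<dots> = a *\<^sub>R e + im_part e \<zeta>"
      unfolding \<kappa>1 1 using \<Delta>0 by (simp add: Z_def)
    finally have "fst (?\<gamma> 1) = \<zeta>"
      by (simp add: im_part_eq a_def)
    moreover have "snd (?\<gamma> 1) = (\<Delta>/2) *\<^sub>R J ((1 - s) *\<^sub>R e + Z) u"
      unfolding snd_conv by (simp add: \<kappa>1 J_linear_simps scaleR_add_right)
    ultimately show ?thesis using \<Delta>0 by (simp add: g1 q_eq prod_eq_iff)
  qed
  moreover have "?\<gamma> 0 = base" by simp
  ultimately show ?thesis
    using geodesic_from_base[OF Z 2[folded r(2)] r1] Phi r(1) \<open>r < 1\<close>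
    by (intro exI[of _ ?\<gamma>] exI[of _ r] exI conjI ballI) auto
qed

section \<open>Isometries preserve the point pair invariant\<close>

lemma base_in_D: "base \<in> D"
  by (simp add: mem_D hgt_eq)

lemma open_D: "open D"
proof -
  have "D = {z. 0 < e \<bullet> fst z - (norm (snd z))\<^sup>2 / 4}" using mem_D by (auto simp: hgt_eq)
  then show ?thesis by (simp add: open_Collect_less continuous_intros)
qed

lemma N_A_transitive:
  assumes "p \<in> D"
  shows "act_N J e (im_part e (fst p)) (snd p) (act_A (hgt p) base) = p"
  by (simp add: prod_eq_iff im_part_eq hgt_eq algebra_simps)

text \<open>
  The curve from \<open>p\<close> to \<open>q\<close> (a geodesic from \<open>base\<close>, moved by the affine map \<open>L\<close>, which preserves metric and
  invariant) has length \<open>d(p,q)\<close>. Its image under \<open>g\<close> has the same length and joins \<open>g p\<close> to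
  \<open>g q\<close>, so the comparison principle bounds \<open>Phi (g q) (g p)\<close>.
\<close>
lemma Phi_nonexpansive:
  assumes gD: "\<And>z. z \<in> D \<Longrightarrow> g z \<in> D"
    and gd: "\<And>z. z \<in> D \<Longrightarrow> (g has_derivative g' z) (at z)"
    and gQ: "\<And>z a. z \<in> D \<Longrightarrow> Qmet (g z) (g' z a) = Qmet z a"
    and p: "p \<in> D" and q: "q \<in> D"
  shows "Phi (g q) (g p) \<le> Phi q p"
proof -
  define t X Z where "t = hgt p" and "X = snd p" and "Z = im_part e (fst p)"
  have t: "t > 0" using p by (simp add: t_def mem_D)
  have Z: "Z \<in> C_im e" by (simp add: Z_def)
  define L where "L z = act_N J e Z X (act_A t z)" for z
  define L' where "L' a = (t *\<^sub>R fst a + (1/2) *\<^sub>R \<beta> (sqrt t *\<^sub>R snd a) X, sqrt t *\<^sub>R snd a)" for a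
  have Lb: "L base = p" unfolding L_def t_def X_def Z_def by (rule N_A_transitive[OF p])
  have hL: "hgt (L z) = t * hgt z" for z using Z t by (simp add: L_def hgt_act_N hgt_act_A)
  have LD: "L z \<in> D" if "z \<in> D" for z using that t by (simp add: mem_D hL)
  have LPhi: "Phi (L z) (L w) = Phi z w" for z w
    using Z t by (simp add: L_def Phi_act_N Phi_act_A)
  have Ld: "(L has_derivative L') (at z)" for z
  proof -
    note [derivative_intros] = bounded_linear.has_derivative[OF beta.bounded_linear_left]
    have *: "L = (\<lambda>z. ((1/4 * (norm X)\<^sup>2) *\<^sub>R e + Z + t *\<^sub>R fst z + (1/2) *\<^sub>R \<beta> (sqrt t *\<^sub>R snd z) X, X + sqrt t *\<^sub>R snd z))"
      by (simp add: fun_eq_iff prod_eq_iff L_def)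
    show ?thesis unfolding * L'_def[abs_def]
      by (auto intro!: derivative_eq_intros)
  qed
  have LQ: "Qmet (L z) (L' a) = Qmet z a" for z a
  proof -
    have "fst (L' a) - (1/2) *\<^sub>R \<beta> (snd (L' a)) (snd (L z)) = t *\<^sub>R (fst a - (1/2) *\<^sub>R \<beta> (snd a) (snd z))"
      using t by (simp add: L'_def L_def beta_simps algebra_simps)
    then show ?thesis using t
      unfolding Qmet_def hL
      by (simp add: power_mult_distrib L'_def)
  qed
  define q0 where "q0 = act_A (1/t) (act_N J e (- Z) (- X) q)"
  have q0: "L q0 = q" using t Z by (simp add: L_def q0_def act_A_inverse act_N_inverse)
  have "q0 \<in> D" using q t hL[of q0] by (simp add: q0 mem_D zero_less_mult_iff)
  from exists_geodesic_from_base[OF this]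
  obtain \<gamma> \<gamma>' r where r: "0 \<le> r" "r < 1" and \<gamma>01: "\<gamma> 0 = base" "\<gamma> 1 = q0"
    and Pr: "Phi q0 base = 1 / (1 - r\<^sup>2)"
    and \<gamma>_all: "\<forall>l\<in>{0..1}. \<gamma> l \<in> D \<and> (\<gamma> has_vector_derivative \<gamma>' l) (at l) \<and>
      Qmet (\<gamma> l) (\<gamma>' l) = (2 * r / (1 - l\<^sup>2 * r\<^sup>2))\<^sup>2"
    by (elim exE conjE)
  have \<gamma>: "\<And>l. 0 \<le> l \<Longrightarrow> l \<le> 1 \<Longrightarrow> \<gamma> l \<in> D"
      "\<And>l. 0 \<le> l \<Longrightarrow> l \<le> 1 \<Longrightarrow> (\<gamma> has_vector_derivative \<gamma>' l) (at l)"
      "\<And>l. 0 \<le> l \<Longrightarrow> l \<le> 1 \<Longrightarrow> Qmet (\<gamma> l) (\<gamma>' l) = (2 * r / (1 - l\<^sup>2 * r\<^sup>2))\<^sup>2"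
    using \<gamma>_all by simp_all
  define u where "u l = Phi (g (L (\<gamma> l))) (g p)" for l
  define u' where "u' l = dPhi (g p) (g (L (\<gamma> l))) (g' (L (\<gamma> l)) (L' (\<gamma>' l)))" for l
  have "u 1 \<le> 1 / (1 - r\<^sup>2)"
  proof (rule cosh_square_comparison[OF r, of u u'])
    fix l :: real assume l: "0 \<le> l" "l \<le> 1"
    have in_D: "L (\<gamma> l) \<in> D" "g (L (\<gamma> l)) \<in> D" "g p \<in> D" using \<gamma>(1)[OF l] LD gD p by auto
    have "(\<gamma> has_derivative (\<lambda>h. h *\<^sub>R \<gamma>' l)) (at l)"
      using \<gamma>(2)[OF l] by (simp add: has_vector_derivative_def)
    from has_derivative_compose[OF this Ld] have "((\<lambda>l. L (\<gamma> l)) has_derivative (\<lambda>h. L' (h *\<^sub>R \<gamma>' l))) (at l)" .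
    from has_derivative_compose[OF this gd[OF in_D(1)]]
    have "((\<lambda>l. g (L (\<gamma> l))) has_derivative (\<lambda>h. g' (L (\<gamma> l)) (L' (h *\<^sub>R \<gamma>' l)))) (at l)" .
    from has_derivative_compose[OF this has_derivative_Phi[OF in_D(2,3)]]
    have "(u has_derivative (\<lambda>h. dPhi (g p) (g (L (\<gamma> l))) (g' (L (\<gamma> l)) (L' (h *\<^sub>R \<gamma>' l))))) (at l)"
      unfolding u_def[abs_def] .
    from has_real_derivative_of_has_derivative[OF this]
    show "(u has_real_derivative u' l) (at l)" by (simp add: u'_def)
    show "1 \<le> u l" unfolding u_def using in_D by (intro Phi_ge_1)
    have "(u' l)\<^sup>2 \<le> Qmet (g (L (\<gamma> l))) (g' (L (\<gamma> l)) (L' (\<gamma>' l))) * (u l * (u l - 1))"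
      unfolding u'_def u_def using in_D by (intro dPhi_bound)
    then show "(u' l)\<^sup>2 \<le> (2 * r / (1 - l\<^sup>2 * r\<^sup>2))\<^sup>2 * (u l * (u l - 1))"
      by (simp only: gQ[OF in_D(1)] LQ \<gamma>(3)[OF l])
  next
    show "u 0 = 1" using gD p by (simp add: u_def \<gamma>01 Lb Phi_same)
  qed
  then have "Phi (g q) (g p) \<le> Phi q0 base" by (simp add: u_def \<gamma>01 q0 Pr)
  also have "\<dots> = Phi q p" using LPhi[of q0 base] by (simp add: q0 Lb)
  finally show ?thesis .
qed

lemma smooth_has_derivative:
  assumes "smooth_map_on D f" "z \<in> D"
  shows "(f has_derivative frechet_derivative f (at z)) (at z)"
proof -
  from assms(1) obtain F where F: "\<forall>x\<in>D. F [] x = f x"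
     "\<forall>hs. \<forall>x\<in>D. (F hs has_derivative (\<lambda>h. F (h # hs) x)) (at x)"
    unfolding smooth_map_on_def by (elim exE conjE)
  have "(f has_derivative (\<lambda>h. F [h] z)) (at z)"
    by (rule has_derivative_transform_within_open[OF F(2)[rule_format, OF assms(2)] open_D assms(2)])
       (simp add: F(1))
  then show ?thesis using frechet_derivative_at by fastforce
qed

lemma smooth_map_on_cong:
  assumes fg: "\<And>z. z \<in> D \<Longrightarrow> f z = g z" and f: "smooth_map_on D f"
  shows "smooth_map_on D g"
proof -
  from f obtain F where F: "\<forall>x\<in>D. F [] x = f x"
     "\<forall>hs. \<forall>x\<in>D. (F hs has_derivative (\<lambda>h. F (h # hs) x)) (at x)"
    unfolding smooth_map_on_def by (elim exE conjE)
  have "\<forall>x\<in>D. F [] x = g x" using F(1) fg by simp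
  then show ?thesis
    unfolding smooth_map_on_def by (intro exI[of _ F] conjI F(2))
qed

lemma riemannian_isometry_inverse:
  assumes f: "riemannian_isometry J e f" and gf: "\<And>z. z \<in> D \<Longrightarrow> g z = inv_into D f z"
  shows "riemannian_isometry J e g"
proof -
  have bij: "bij_betw f D D" and sf: "smooth_map_on D f" and si: "smooth_map_on D (inv_into D f)"
    and met: "\<And>p a b. p \<in> D \<Longrightarrow> D_metric J e (f p) (frechet_derivative f (at p) a) (frechet_derivative f (at p) b)
          = D_metric J e p a b"
    using f by (auto simp: riemannian_isometry_def)
  have sg: "smooth_map_on D g" by (rule smooth_map_on_cong[OF _ si]) (simp add: gf)
  have bg: "bij_betw g D D" using bij_betw_inv_into[OF bij] gf by (metis bij_betw_cong)
  have fg: "f (g z) = z" "g z \<in> D" if "z \<in> D" for z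
    using that bij bij_betw_inv_into_right[OF bij that] bij_betwE[OF bg] by (auto simp: gf)
  have gf': "g (f z) = z" if "z \<in> D" for z
    using bij_betw_inv_into_left[OF bij that] bij_betwE[OF bij] that by (auto simp: gf)
  have "inv_into D g z = f z" if "z \<in> D" for z
    using that bij_betw_inv_into_left[OF bg, of "f z"] bij_betwE[OF bij] by (simp add: gf')
  then have sig: "smooth_map_on D (inv_into D g)"
    by (intro smooth_map_on_cong[OF _ sf]) auto
  have "D_metric J e (g p) (frechet_derivative g (at p) a) (frechet_derivative g (at p) b) = D_metric J e p a b"
    if p: "p \<in> D" for p a b
  proof -
    have "((\<lambda>z. f (g z)) has_derivative (\<lambda>h. frechet_derivative f (at (g p)) (frechet_derivative g (at p) h))) (at p)"
      by (rule has_derivative_compose[OF smooth_has_derivative[OF sg p] smooth_has_derivative[OF sf fg(2)[OF p]]])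
    then have "((\<lambda>z. z) has_derivative (\<lambda>h. frechet_derivative f (at (g p)) (frechet_derivative g (at p) h))) (at p)"
      by (rule has_derivative_transform_within_open[OF _ open_D p]) (simp add: fg)
    then have "(\<lambda>h. frechet_derivative f (at (g p)) (frechet_derivative g (at p) h)) = (\<lambda>h. h)"
      using has_derivative_unique has_derivative_ident by blast
    then have "frechet_derivative f (at (g p)) (frechet_derivative g (at p) h) = h" for h by meson
    then show ?thesis
      using met[OF fg(2)[OF p], of "frechet_derivative g (at p) a" "frechet_derivative g (at p) b"]
      by (simp add: fg p)
  qed
  then show ?thesis using bg sg sig by (simp add: riemannian_isometry_def)
qed

lemma Phi_isometry:
  assumes f: "riemannian_isometry J e f" and pq: "p \<in> D" "q \<in> D"
  shows "Phi (f p) (f q) = Phi p q"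
proof -
  have le: "Phi (g q) (g p) \<le> Phi q p" if g: "riemannian_isometry J e g" and "p \<in> D" "q \<in> D" for g p q
  proof (rule Phi_nonexpansive[where g' = "\<lambda>z. frechet_derivative g (at z)"])
    have bij: "bij_betw g D D" using g by (simp add: riemannian_isometry_def)
    show gD: "g z \<in> D" if "z \<in> D" for z using bij_betwE[OF bij] that by blast
    show "(g has_derivative frechet_derivative g (at z)) (at z)" if "z \<in> D" for z
      using g that by (auto simp: riemannian_isometry_def intro: smooth_has_derivative)
    show "Qmet (g z) (frechet_derivative g (at z) a) = Qmet z a" if "z \<in> D" for z a
    proof -
      have "D_metric J e (g z) (frechet_derivative g (at z) a) (frechet_derivative g (at z) a) = D_metric J e z a a"
        using g that unfolding riemannian_isometry_def by blast
      then show ?thesis using that gD by (simp add: D_metric_eq_Qmet)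
    qed
  qed fact+
  have bij: "bij_betw f D D" using f by (simp add: riemannian_isometry_def)
  have fD: "f p \<in> D" "f q \<in> D" using bij_betwE[OF bij] pq by auto
  have "Phi (inv_into D f (f p)) (inv_into D f (f q)) \<le> Phi (f p) (f q)"
    by (rule le[OF riemannian_isometry_inverse[OF f]]) (use fD in auto)
  then show ?thesis
    using le[OF f pq(2,1)] by (simp add: bij_betw_inv_into_left[OF bij] pq)
qed

lemma compact_cball_space: "compact (cball (0 :: 'c \<times> 'v) R)"
proof -
  obtain B :: "'v set" where "finite B" "span B = UNIV"
    using J2C by (auto simp: J2C_module_def)
  then have "compact (cball (0::'v) R)" by (rule compact_cball_finite_span)
  then have "compact (cball (0::'c) R \<times> cball (0::'v) R)" by (intro compact_Times) auto
  moreover have "cball (0 :: 'c \<times> 'v) R \<subseteq> cball (0::'c) R \<times> cball (0::'v) R"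
    by (auto intro: order_trans[OF norm_fst_le] order_trans[OF norm_snd_le])
  then have "(cball (0::'c) R \<times> cball (0::'v) R) \<inter> cball 0 R = cball 0 R" by (rule inf.absorb2)
  ultimately show ?thesis
    using compact_Int_closed[of "cball (0::'c) R \<times> cball (0::'v) R", OF _ closed_cball[of 0 R]] by simp
qed

section \<open>Maps preserving the invariant and the height\<close>

lemma D_coords: "S_to_D e (hgt z, im_part e (fst z), snd z) = z"
  by (cases z) (simp add: im_part_eq hgt_eq)

lemma hgt_S_to_D: "Z \<in> C_im e \<Longrightarrow> hgt (S_to_D e (h, Z, X)) = h"
  by (simp add: hgt_eq inner_add inner_e_C_im)

lemma norm_re_im: "(norm \<zeta>)\<^sup>2 = (e \<bullet> \<zeta>)\<^sup>2 + (norm (im_part e \<zeta>))\<^sup>2"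
  unfolding power2_norm_eq_inner
  by (simp add: im_part_eq inner_diff inner_commute) (simp add: power2_eq_square)

lemma norm_re_plus_im: "I \<in> C_im e \<Longrightarrow> (norm (a *\<^sub>R e + I))\<^sup>2 = a\<^sup>2 + (norm I)\<^sup>2"
  unfolding power2_norm_eq_inner by (simp add: inner_add inner_e_C_im power2_eq_square)

lemma im_part_C_im_eq: "Z \<in> C_im e \<Longrightarrow> im_part e Z = Z"
  by (simp add: im_part_eq inner_e_C_im)

lemma im_part_add: "im_part e (x + y) = im_part e x + im_part e y"
  and im_part_diff: "im_part e (x - y) = im_part e x - im_part e y"
  and im_part_e [simp]: "im_part e e = 0"
  and im_part_0 [simp]: "im_part e 0 = 0"
  by (simp_all add: im_part_eq inner_diff inner_add scaleR_add_left scaleR_diff_left)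

lemma norm_pht_coords:
  assumes "Z \<in> C_im e" "W \<in> C_im e"
  shows "(norm (pht (S_to_D e (h, Z, X)) (S_to_D e (k, W, Y))))\<^sup>2
    = (h + k + (norm (X - Y))\<^sup>2 / 4)\<^sup>2 + (norm (Z - W - (1/2) *\<^sub>R im_part e (\<beta> X Y)))\<^sup>2"
proof -
  let ?p = "pht (S_to_D e (h, Z, X)) (S_to_D e (k, W, Y))"
  have "e \<bullet> ?p = h + k + (norm (X - Y))\<^sup>2 / 4"
    using assms by (simp add: inner_e_pht hgt_S_to_D del: S_to_D.simps) simp
  moreover have "im_part e ?p = Z - W - (1/2) *\<^sub>R im_part e (\<beta> X Y)"
    using assms
    by (simp add: pht_def im_part_add im_part_diff im_part_scaleR im_part_C_im_eq cnj_C_im)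
  ultimately show ?thesis using norm_re_im[of ?p] by (simp only:)
qed

text \<open>
  Points of \<open>D\<close> are written in horospherical coordinates as \<open>(h, Z, X)\<close>. Height and \<open>Phi\<close> determine \<open>|pht|\<close>, and
  comparing \<open>|pht|\<close> at several heights separates \<open>|X - Y|\<close> from \<open>|Z - W - Im (\<beta> X Y) / 2|\<close>. Thus
  \<open>F\<close> acts in the \<open>X\<close>-coordinate by a linear isometry \<open>ps\<close>, in the \<open>Z\<close>-coordinate by a linear
  isometry \<open>ph\<close>, and intertwines \<open>\<beta>\<close>; this is the defining property of \<open>M\<close>.
\<close>
lemma height_preserving_fixing_base:
  assumes FD: "\<And>z. z \<in> D \<Longrightarrow> F z \<in> D" and surj: "\<And>z. z \<in> D \<Longrightarrow> \<exists>w\<in>D. F w = z"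
    and FPhi: "\<And>z w. z \<in> D \<Longrightarrow> w \<in> D \<Longrightarrow> Phi (F z) (F w) = Phi z w"
    and Fh: "\<And>z. z \<in> D \<Longrightarrow> hgt (F z) = hgt z"
    and Fb: "F base = base"
  shows "\<exists>m\<in>M_maps J e. \<forall>z\<in>D. F z = m z"
proof -
  let ?mk = "\<lambda>h Z X. S_to_D e (h, Z, X)"
  define f where "f Z X = im_part e (fst (F (?mk 1 Z X)))" for Z X
  define \<psi> where "\<psi> Z X = snd (F (?mk 1 Z X))" for Z X
  have mkD: "?mk h Z X \<in> D" if "h > 0" "Z \<in> C_im e" for h Z X
    using that by (simp add: mem_D hgt_S_to_D del: S_to_D.simps)
  have fim [simp]: "f Z X \<in> C_im e" for Z X by (simp add: f_def)
  have F1: "F (?mk 1 Z X) = ?mk 1 (f Z X) (\<psi> Z X)" if "Z \<in> C_im e" for Z X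
    using D_coords[of "F (?mk 1 Z X)"] Fh[OF mkD[of 1 Z X]] that
    by (simp add: f_def \<psi>_def hgt_S_to_D del: S_to_D.simps)
  have Fp: "(norm (pht (F z) (F w)))\<^sup>2 = (norm (pht z w))\<^sup>2" if "z \<in> D" "w \<in> D" for z w
    using FPhi[OF that] Fh that by (simp add: Phi_def mem_D)
  \<comment> \<open>For points at heights \<open>h\<close> and \<open>1\<close> the norm of \<open>pht\<close> is at least \<open>h + 1\<close>, with equality only for
    equal \<open>(Z, X)\<close>.\<close>
  have Fmk: "F (?mk h Z X) = ?mk h (f Z X) (\<psi> Z X)" if h: "h > 0" and Z: "Z \<in> C_im e" for h Z X
  proof -
    define I v where "I = im_part e (fst (F (?mk h Z X)))" and "v = snd (F (?mk h Z X))"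
    have I: "I \<in> C_im e" by (simp add: I_def)
    have eq: "F (?mk h Z X) = ?mk h I v"
      using D_coords[of "F (?mk h Z X)"] Fh[OF mkD[OF that]] Z
      by (simp add: I_def v_def hgt_S_to_D del: S_to_D.simps)
    have "(h + 1 + (norm (v - \<psi> Z X))\<^sup>2 / 4)\<^sup>2
        + (norm (I - f Z X - (1/2) *\<^sub>R im_part e (\<beta> v (\<psi> Z X))))\<^sup>2
      = (h + 1 + (norm (X - X))\<^sup>2 / 4)\<^sup>2 + (norm (Z - Z - (1/2) *\<^sub>R im_part e (\<beta> X X)))\<^sup>2"
      using Fp[OF mkD[OF that, of X] mkD[OF zero_less_one Z, of X]]
      unfolding eq F1[OF Z] norm_pht_coords[OF I fim] norm_pht_coords[OF Z Z] .
    also have "\<dots> = (h + 1)\<^sup>2" by (simp add: beta_same im_part_eq)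
    finally have *: "(h + 1 + (norm (v - \<psi> Z X))\<^sup>2 / 4)\<^sup>2
        + (norm (I - f Z X - (1/2) *\<^sub>R im_part e (\<beta> v (\<psi> Z X))))\<^sup>2 = (h + 1)\<^sup>2" .
    then have "(h + 1 + (norm (v - \<psi> Z X))\<^sup>2 / 4)\<^sup>2 \<le> (h + 1)\<^sup>2"
      by (metis le_add_same_cancel1 zero_le_power2)
    then have "h + 1 + (norm (v - \<psi> Z X))\<^sup>2 / 4 \<le> h + 1"
      using h by (simp add: power2_le_iff_abs_le)
    then have v: "v = \<psi> Z X" by simp
    with * have "I = f Z X" by (simp add: beta_same im_part_eq)
    with v eq show ?thesis by simp
  qed
  have key: "norm (\<psi> Z X - \<psi> W Y) = norm (X - Y)"
    "norm (f Z X - f W Y - (1/2) *\<^sub>R im_part e (\<beta> (\<psi> Z X) (\<psi> W Y)))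
      = norm (Z - W - (1/2) *\<^sub>R im_part e (\<beta> X Y))"
    if Z: "Z \<in> C_im e" "W \<in> C_im e" for Z W X Y
  proof -
    define a b where "a = (norm (\<psi> Z X - \<psi> W Y))\<^sup>2 / 4" and "b = (norm (X - Y))\<^sup>2 / 4"
    define A B where "A = (norm (f Z X - f W Y - (1/2) *\<^sub>R im_part e (\<beta> (\<psi> Z X) (\<psi> W Y))))\<^sup>2"
      and "B = (norm (Z - W - (1/2) *\<^sub>R im_part e (\<beta> X Y)))\<^sup>2"
    have *: "(h + h + a)\<^sup>2 + A = (h + h + b)\<^sup>2 + B" if "h > 0" for h
      using Fp[OF mkD[OF that Z(1), of X] mkD[OF that Z(2), of Y]]
      unfolding Fmk[OF that Z(1)] Fmk[OF that Z(2)] norm_pht_coords[OF fim fim] norm_pht_coords[OF Z]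
        a_def b_def A_def B_def .
    have "(2 + a)\<^sup>2 + A = (2 + b)\<^sup>2 + B" "(4 + a)\<^sup>2 + A = (4 + b)\<^sup>2 + B"
      using *[of 1] *[of 2] by simp_all
    then have ab: "a = b" by (simp add: power2_eq_square algebra_simps)
    then have AB: "A = B" using \<open>(2 + a)\<^sup>2 + A = (2 + b)\<^sup>2 + B\<close> by simp
    show "norm (\<psi> Z X - \<psi> W Y) = norm (X - Y)"
      using ab by (simp add: a_def b_def)
    show "norm (f Z X - f W Y - (1/2) *\<^sub>R im_part e (\<beta> (\<psi> Z X) (\<psi> W Y)))
      = norm (Z - W - (1/2) *\<^sub>R im_part e (\<beta> X Y))"
      using AB by (simp add: A_def B_def)
  qed
  have z0 [simp]: "0 \<in> C_im e" by (simp add: C_im_def)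
  have f00: "f 0 0 = 0" and p00: "\<psi> 0 0 = 0"
    using Fb by (simp_all add: f_def \<psi>_def im_part_eq)
  define ps where "ps = \<psi> 0"
  define ph where "ph Z = f Z 0" for Z
  have ps: "\<psi> Z X = ps X" if "Z \<in> C_im e" for Z X
    using key(1)[of Z 0 X X] that by (simp add: ps_def)
  have ps_orth: "orthogonal_transformation ps"
    unfolding orthogonal_transformation_isometry
    using key(1)[of 0 0] p00 by (simp add: ps_def dist_norm)
  have ps0: "ps 0 = 0" using p00 by (simp add: ps_def)
  have ph: "f Z X = ph Z" if "Z \<in> C_im e" for Z X
    using key(2)[of Z Z X 0] that by (simp add: ps ps0 ph_def im_part_eq)
  have ph_im: "ph Z \<in> C_im e" for Z by (simp add: ph_def)
  have ph_dist: "norm (ph Z - ph W) = norm (Z - W)" if "Z \<in> C_im e" "W \<in> C_im e" for Z W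
    using key(2)[of Z W 0 0] that by (simp add: ph ps ps0 im_part_eq)
  have ph0: "ph 0 = 0" by (simp add: ph_def f00)
  have im_half: "(1/2) *\<^sub>R im_part e c \<in> C_im e" for c by (simp add: C_im_def im_part_eq inner_diff)
  \<comment> \<open>Take points for which the right-hand side of \<open>key(2)\<close> vanishes.\<close>
  have ph_beta: "ph ((1/2) *\<^sub>R im_part e (\<beta> X Y)) = (1/2) *\<^sub>R im_part e (\<beta> (ps X) (ps Y))" for X Y
    using key(2)[OF im_half[of "\<beta> X Y"] z0, of X Y] im_half[of "\<beta> X Y"] by (simp add: ph ps ph0)
  define \<phi> where "\<phi> \<zeta> = (e \<bullet> \<zeta>) *\<^sub>R e + ph (im_part e \<zeta>)" for \<zeta>
  have \<phi>0: "\<phi> 0 = 0" "\<phi> e = e" by (simp_all add: \<phi>_def ph0)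
  have "norm (\<phi> x - \<phi> y) = norm (x - y)" for x y
  proof -
    have dd: "\<phi> x - \<phi> y = (e \<bullet> (x - y)) *\<^sub>R e + (ph (im_part e x) - ph (im_part e y))"
      by (simp add: \<phi>_def inner_diff algebra_simps)
    have im: "ph (im_part e x) - ph (im_part e y) \<in> C_im e"
      using ph_im by (simp add: C_im_def inner_diff)
    have "(norm (\<phi> x - \<phi> y))\<^sup>2 = (e \<bullet> (x - y))\<^sup>2 + (norm (ph (im_part e x) - ph (im_part e y)))\<^sup>2"
      unfolding dd by (rule norm_re_plus_im[OF im])
    also have "\<dots> = (norm (x - y))\<^sup>2"
      by (simp add: ph_dist norm_re_im[of "x - y"] im_part_diff del: S_to_D.simps)
    finally show ?thesis by (simp add: power2_eq_iff_nonneg)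
  qed
  then have \<phi>_orth: "orthogonal_transformation \<phi>"
    unfolding orthogonal_transformation_isometry using \<phi>0 by (simp add: dist_norm)
  have \<phi>_lin: "linear \<phi>" and \<phi>_inner: "\<phi> x \<bullet> \<phi> y = x \<bullet> y" for x y
    using \<phi>_orth by (simp_all add: orthogonal_transformation_def)
  have ps_inner: "ps x \<bullet> ps y = x \<bullet> y" for x y
    using ps_orth by (simp add: orthogonal_transformation_def)
  have \<phi>_beta: "\<phi> (\<beta> X Y) = \<beta> (ps X) (ps Y)" for X Y
  proof -
    have re_im: "c = (e \<bullet> c) *\<^sub>R e + 2 *\<^sub>R ((1/2) *\<^sub>R im_part e c)" for c
      by (simp add: im_part_eq)
    have \<phi>im: "\<phi> ((1/2) *\<^sub>R im_part e c) = ph ((1/2) *\<^sub>R im_part e c)" for c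
      using im_half[of c] by (simp add: \<phi>_def inner_e_C_im im_part_C_im_eq del: inner_scaleR_right)
    have "\<phi> (\<beta> X Y) = (e \<bullet> \<beta> X Y) *\<^sub>R \<phi> e + 2 *\<^sub>R \<phi> ((1/2) *\<^sub>R im_part e (\<beta> X Y))"
      by (subst re_im) (simp only: linear_add[OF \<phi>_lin] linear_cmul[OF \<phi>_lin])
    also have "\<dots> = (e \<bullet> \<beta> (ps X) (ps Y)) *\<^sub>R e + 2 *\<^sub>R ((1/2) *\<^sub>R im_part e (\<beta> (ps X) (ps Y)))"
      by (simp only: \<phi>im ph_beta \<phi>0 inner_e_beta ps_inner)
    also have "\<dots> = \<beta> (ps X) (ps Y)" by (rule re_im[symmetric])
    finally show ?thesis .
  qed
  have Fz: "F z = map_prod \<phi> ps z" if z: "z \<in> D" for z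
  proof -
    define h Z X where "h = hgt z" and "Z = im_part e (fst z)" and "X = snd z"
    have h: "h > 0" and Z: "Z \<in> C_im e" using z by (auto simp: h_def Z_def mem_D)
    have zeq: "z = ?mk h Z X" using D_coords[of z] by (simp add: h_def Z_def X_def)
    have "F z = ?mk h (ph Z) (ps X)"
      using Fmk[OF h Z, of X] Z zeq by (simp add: ph ps del: S_to_D.simps)
    moreover have "norm (ps X) = norm X" using ps_inner by (simp add: norm_eq_sqrt_inner)
    ultimately show ?thesis
      using Z by (simp add: zeq \<phi>_def inner_add inner_e_C_im im_part_eq)
  qed
  have "ps (J \<zeta> v) = J (\<phi> \<zeta>) (ps v)" for \<zeta> v
  proof -
    have "ps (J \<zeta> v) \<bullet> y = J (\<phi> \<zeta>) (ps v) \<bullet> y" for y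
    proof -
      obtain z where z: "z \<in> D" "F z = ?mk 1 0 y" using surj[OF mkD[OF zero_less_one z0, of y]] by blast
      define w where "w = snd z"
      have y: "y = ps w" using Fz[OF z(1)] z(2) by (cases z) (simp add: w_def)
      have "ps (J \<zeta> v) \<bullet> ps w = \<beta> w v \<bullet> \<zeta>" by (simp add: ps_inner beta_inner)
      also have "\<dots> = \<beta> (ps w) (ps v) \<bullet> \<phi> \<zeta>" by (simp only: \<phi>_inner flip: \<phi>_beta)
      also have "\<dots> = J (\<phi> \<zeta>) (ps v) \<bullet> ps w" by (simp add: beta_inner)
      finally show ?thesis by (simp add: y)
    qed
    then show ?thesis using vector_eq_rdot by blast
  qed
  then have "map_prod \<phi> ps \<in> M_maps J e"
    unfolding M_maps_def using \<phi>_orth ps_orth \<phi>0 by blast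
  then show ?thesis using Fz by blast
qed

section \<open>Maps that rescale the height\<close>

abbreviation "\<sigma> \<equiv> geod_inversion J e"

lemma act_A_D: "0 < t \<Longrightarrow> z \<in> D \<Longrightarrow> act_A t z \<in> D"
  by (simp add: mem_D hgt_act_A)

lemma act_N_D: "Z \<in> C_im e \<Longrightarrow> z \<in> D \<Longrightarrow> act_N J e Z X z \<in> D"
  by (simp add: mem_D hgt_act_N)

lemma inversion_D: "z \<in> D \<Longrightarrow> \<sigma> z \<in> D"
  using fst_nonzero[of z] by (simp add: mem_D hgt_inversion)

text \<open>
  The isometries of the metric space \<open>(D, d)\<close>.
\<close>
definition preserves_Phi :: "('c \<times> 'v \<Rightarrow> 'c \<times> 'v) \<Rightarrow> bool" where
  "preserves_Phi f \<longleftrightarrow> bij_betw f D D \<and> (\<forall>z\<in>D. \<forall>w\<in>D. Phi (f z) (f w) = Phi z w)"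

lemma preserves_PhiD:
  assumes "preserves_Phi f"
  shows "z \<in> D \<Longrightarrow> f z \<in> D" "z \<in> D \<Longrightarrow> \<exists>w\<in>D. f w = z"
    "z \<in> D \<Longrightarrow> w \<in> D \<Longrightarrow> Phi (f z) (f w) = Phi z w"
proof -
  have "f ` D \<subseteq> D" "D \<subseteq> f ` D" and Phi: "\<forall>z\<in>D. \<forall>w\<in>D. Phi (f z) (f w) = Phi z w"
    using assms by (auto simp only: preserves_Phi_def bij_betw_def)
  then show "z \<in> D \<Longrightarrow> f z \<in> D" "z \<in> D \<Longrightarrow> \<exists>w\<in>D. f w = z" by blast+
  show "z \<in> D \<Longrightarrow> w \<in> D \<Longrightarrow> Phi (f z) (f w) = Phi z w" using Phi by blast
qed

lemma preserves_Phi_comp: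
  assumes "preserves_Phi f" "preserves_Phi g" shows "preserves_Phi (\<lambda>z. f (g z))"
  using assms preserves_PhiD[OF assms(2)] bij_betw_trans[of g D D f D]
  by (auto simp: preserves_Phi_def o_def)

lemma preserves_Phi_act_A:
  assumes t: "0 < t" shows "preserves_Phi (act_A t)"
proof -
  have "bij_betw (act_A t) D D"
    by (rule bij_betw_byWitness[where f' = "act_A (1/t)"])
       (use t act_A_D[of t] act_A_D[of "1/t"] in \<open>auto simp: act_A_inverse simp del: act_A.simps\<close>)
  then show ?thesis using t by (simp add: preserves_Phi_def Phi_act_A)
qed

lemma preserves_Phi_act_N:
  assumes Z: "Z \<in> C_im e" shows "preserves_Phi (act_N J e Z X)"
proof -
  have "bij_betw (act_N J e Z X) D D"
    by (rule bij_betw_byWitness[where f' = "act_N J e (- Z) (- X)"])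
       (use Z act_N_D[of Z _ X] act_N_D[of "- Z" _ "- X"] in \<open>auto simp: act_N_inverse simp del: act_N.simps\<close>)
  then show ?thesis using Z by (simp add: preserves_Phi_def Phi_act_N)
qed

lemma preserves_Phi_inversion: "preserves_Phi \<sigma>"
proof -
  have "bij_betw \<sigma> D D"
    by (rule bij_betw_byWitness[where f' = \<sigma>])
       (use inversion_D fst_nonzero in \<open>auto simp: inversion_involution simp del: geod_inversion.simps\<close>)
  then show ?thesis by (simp add: preserves_Phi_def Phi_inversion)
qed

lemma preserves_Phi_isometry: "riemannian_isometry J e f \<Longrightarrow> preserves_Phi f"
  using Phi_isometry[of f] by (simp add: preserves_Phi_def riemannian_isometry_def)

text \<open>
  Composing with an element of \<open>A N\<close> that sends \<open>base\<close> to the preimage of \<open>base\<close> gives a map which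
  fixes \<open>base\<close> and preserves heights, hence lies in \<open>M\<close>.
\<close>
lemma MAN_form:
  assumes f: "preserves_Phi f" and k: "0 < k" and fh: "\<And>z. z \<in> D \<Longrightarrow> hgt (f z) = k * hgt z"
  shows "\<exists>m\<in>M_maps J e. \<exists>n\<in>N_maps J e. \<forall>z\<in>D. f z = m (act_A k (n z))"
proof -
  obtain p where p: "p \<in> D" "f p = base" using preserves_PhiD(2)[OF f base_in_D] by blast
  have hp: "hgt p = 1 / k"
    using fh[OF p(1)] k by (simp add: p(2) hgt_eq[of base] field_simps)
  define W Y where "W = im_part e (fst p)" and "Y = snd p"
  have W: "W \<in> C_im e" by (simp add: W_def)
  define L where "L z = act_N J e W Y (act_A (1/k) z)" for z
  have L: "preserves_Phi L"
    unfolding L_def[abs_def] using W k by (intro preserves_Phi_comp[OF preserves_Phi_act_N preserves_Phi_act_A]) auto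
  have fL: "preserves_Phi (\<lambda>z. f (L z))" by (rule preserves_Phi_comp[OF f L])
  have Lb: "L base = p" using N_A_transitive[OF p(1)] by (simp add: L_def W_def Y_def hp)
  have "\<exists>m\<in>M_maps J e. \<forall>z\<in>D. f (L z) = m z"
  proof (rule height_preserving_fixing_base)
    show "hgt (f (L z)) = hgt z" if "z \<in> D" for z
      using fh[OF preserves_PhiD(1)[OF L that]] k W by (simp add: L_def hgt_act_N hgt_act_A)
    show "f (L base) = base" by (simp add: Lb p)
  qed (use preserves_PhiD[OF fL] in auto)
  then obtain m where m: "m \<in> M_maps J e" "\<forall>z\<in>D. f (L z) = m z" by blast
  have "f z = m (act_A k (act_N J e (- W) (- Y) z))" if z: "z \<in> D" for z
  proof -
    have D': "act_A k (act_N J e (- W) (- Y) z) \<in> D" using z W k by (simp add: act_A_D act_N_D)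
    have "L (act_A k (act_N J e (- W) (- Y) z)) = z"
      using W unfolding L_def act_A_inverse(1)[OF k] by (simp only: act_N_inverse)
    then show ?thesis using m(2) D' by metis
  qed
  moreover have "act_N J e (- W) (- Y) \<in> N_maps J e" using W by (auto simp: N_maps_def)
  ultimately show ?thesis using m(1) by blast
qed

section \<open>The decomposition of isometries\<close>

definition ray :: "nat \<Rightarrow> 'c \<times> 'v" where "ray n = (real (Suc n) *\<^sub>R e, 0)"

lemma ray_D: "ray n \<in> D" and hgt_ray: "hgt (ray n) = real (Suc n)"
  by (simp_all add: ray_def mem_D hgt_eq)

text \<open>
  Up to normalisation the height is \<open>exp (-b)\<close> for the Busemann function \<open>b\<close> of the vertical ray.
\<close>
lemma Phi_ray_ratio:
  assumes w: "w \<in> D"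
  shows "(\<lambda>n. Phi (ray n) w / Phi (ray n) base) \<longlonglongrightarrow> 1 / hgt w"
proof -
  have lim: "(\<lambda>n. norm (pht (ray n) u) / real (Suc n)) \<longlonglongrightarrow> 1" for u
  proof -
    have "(\<lambda>n. norm (e + inverse (real (Suc n)) *\<^sub>R cnj (fst u))) \<longlonglongrightarrow> norm (e + 0 *\<^sub>R cnj (fst u))"
      by (intro tendsto_intros LIMSEQ_inverse_real_of_nat)
    moreover have "norm (e + inverse (real (Suc n)) *\<^sub>R cnj (fst u)) = norm (pht (ray n) u) / real (Suc n)" for n
    proof -
      have "pht (ray n) u = real (Suc n) *\<^sub>R (e + inverse (real (Suc n)) *\<^sub>R cnj (fst u))"
        by (simp add: ray_def pht_def scaleR_add_right)
      then show ?thesis by simp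
    qed
    ultimately show ?thesis by simp
  qed
  have "(\<lambda>n. (norm (pht (ray n) w) / real (Suc n))\<^sup>2 / (norm (pht (ray n) base) / real (Suc n))\<^sup>2 / hgt w)
      \<longlonglongrightarrow> 1\<^sup>2 / 1\<^sup>2 / hgt w"
    using w by (intro tendsto_intros lim) (auto simp: mem_D)
  moreover have "(norm (pht (ray n) w) / real (Suc n))\<^sup>2 / (norm (pht (ray n) base) / real (Suc n))\<^sup>2 / hgt w
     = Phi (ray n) w / Phi (ray n) base" for n
    using w by (simp add: Phi_def mem_D hgt_ray power_divide hgt_eq[of base] del: of_nat_Suc)
  ultimately show ?thesis by simp
qed

lemma norm_snd_le_sqrt:
  assumes "0 \<le> hgt x" shows "norm (snd x) \<le> 2 * sqrt (norm (fst x))"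
proof -
  have "(norm (snd x))\<^sup>2 \<le> 4 * (e \<bullet> fst x)" using assms by (simp add: hgt_eq)
  also have "\<dots> \<le> 4 * norm (fst x)" using norm_cauchy_schwarz[of e "fst x"] by simp
  also have "\<dots> = (2 * sqrt (norm (fst x)))\<^sup>2" by (simp add: power_mult_distrib)
  finally show ?thesis by (rule power2_le_imp_le) simp
qed

text \<open>
  On the closure of \<open>D\<close>, \<open>|v|\<^sup>2\<close> is at most \<open>4 |\<zeta>|\<close>, so a point \<open>(\<zeta>, v)\<close> is far away only if \<open>\<zeta>\<close> is.
\<close>
lemma norm_le_fst: "norm x \<le> 1 + 5 * norm (fst x)" if "0 \<le> hgt x"
proof -
  have "sqrt (norm (fst x)) * 2 \<le> 1 + norm (fst x)"
    using zero_le_power2[of "1 - sqrt (norm (fst x))"] by (simp add: power2_diff)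
  moreover have "norm x \<le> norm (fst x) + norm (snd x)"
    by (metis norm_Pair_le prod.collapse)
  ultimately show ?thesis using norm_snd_le_sqrt[OF that] norm_ge_zero[of "fst x"] by linarith
qed

lemma fst_to_infinity:
  assumes x: "\<And>n. 0 \<le> hgt (x n)" and inf: "filterlim (\<lambda>n. norm (x n)) at_top F"
  shows "filterlim (\<lambda>n. norm (fst (x n))) at_top F"
proof -
  have "filterlim (\<lambda>n. (norm (x n) - 1) / 5) at_top F"
    using inf unfolding filterlim_at_top
  proof safe
    fix Z :: real
    assume "\<forall>Z. \<forall>\<^sub>F n in F. Z \<le> norm (x n)"
    then have "\<forall>\<^sub>F n in F. 5 * Z + 1 \<le> norm (x n)" by blast
    then show "\<forall>\<^sub>F n in F. Z \<le> (norm (x n) - 1) / 5" by eventually_elim simp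
  qed
  then show ?thesis
    by (rule filterlim_at_top_mono) (use norm_le_fst[OF x] in \<open>auto simp: field_simps intro!: always_eventually\<close>)
qed

text \<open>
  The difference between \<open>pht x u\<close> and \<open>fst x\<close> is of the order of \<open>|snd x|\<close>, hence of the order of
  \<open>sqrt |fst x|\<close>.
\<close>
lemma pht_ratio_at_infinity:
  fixes x :: "nat \<Rightarrow> 'c \<times> 'v"
  assumes x: "\<And>n. 0 \<le> hgt (x n)" and inf: "filterlim (\<lambda>n. norm (x n)) at_top sequentially"
  shows "(\<lambda>n. norm (pht (x n) u) / norm (fst (x n))) \<longlonglongrightarrow> 1"
proof -
  have F: "filterlim (\<lambda>n. norm (fst (x n))) at_top sequentially" by (rule fst_to_infinity[OF x inf])
  obtain K where K: "\<And>a b. norm (\<beta> a b) \<le> norm a * norm b * K" "K \<ge> 0"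
    using beta.nonneg_bounded by blast
  have 1: "(\<lambda>n. norm (fst u) / norm (fst (x n)) + norm (snd u) * K / sqrt (norm (fst (x n)))) \<longlonglongrightarrow> 0 + 0"
    by (intro tendsto_add tendsto_divide_0[OF tendsto_const] filterlim_at_top_imp_at_infinity F
        filterlim_compose[OF sqrt_at_top F])
  have ev: "\<forall>\<^sub>F n in sequentially. norm (norm (pht (x n) u) / norm (fst (x n)) - 1)
     \<le> (norm (fst u) / norm (fst (x n)) + norm (snd u) * K / sqrt (norm (fst (x n)))) * 1"
    using filterlim_at_top_dense[THEN iffD1, OF F, rule_format, of 0]
  proof eventually_elim
    case (elim n)
    let ?m = "norm (fst (x n))"
    have "\<bar>norm (pht (x n) u) - ?m\<bar> \<le> norm (pht (x n) u - fst (x n))" by (rule norm_triangle_ineq3)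
    also have "\<dots> \<le> norm (cnj (fst u)) + norm ((1/2) *\<^sub>R \<beta> (snd (x n)) (snd u))"
      unfolding pht_def by (metis (no_types, lifting) add_diff_cancel_left' add_diff_eq norm_triangle_ineq4)
    also have "\<dots> \<le> norm (fst u) + (1/2) * (2 * sqrt ?m * norm (snd u) * K)"
    proof -
      have "norm (\<beta> (snd (x n)) (snd u)) \<le> norm (snd (x n)) * norm (snd u) * K" by (rule K)
      also have "\<dots> \<le> 2 * sqrt ?m * norm (snd u) * K"
        using norm_snd_le_sqrt[OF x[of n]] K(2) by (intro mult_right_mono) auto
      finally show ?thesis by simp
    qed
    finally have *: "\<bar>norm (pht (x n) u) - ?m\<bar> \<le> norm (fst u) + sqrt ?m * norm (snd u) * K" by simp
    have "norm (norm (pht (x n) u) / ?m - 1) = \<bar>norm (pht (x n) u) - ?m\<bar> / ?m"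
    proof -
      have "norm (pht (x n) u) / ?m - 1 = (norm (pht (x n) u) - ?m) / ?m"
        using elim by (simp add: diff_divide_distrib)
      then show ?thesis by simp
    qed
    also have "\<dots> \<le> (norm (fst u) + sqrt ?m * norm (snd u) * K) / ?m"
      using * elim by (intro divide_right_mono) auto
    also have "\<dots> = norm (fst u) / ?m + norm (snd u) * K / sqrt ?m"
    proof -
      have "sqrt ?m / ?m = 1 / sqrt ?m" by (simp add: sqrt_divide_self_eq inverse_eq_divide)
      then have "sqrt ?m * norm (snd u) * K / ?m = 1 / sqrt ?m * (norm (snd u) * K)"
        by (metis mult.assoc times_divide_eq_left)
      then show ?thesis by (simp add: add_divide_distrib)
    qed
    finally show ?case by simp
  qed
  have "(\<lambda>n. norm (pht (x n) u) / norm (fst (x n)) - 1) \<longlonglongrightarrow> 0"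
  proof (rule Lim_null_comparison)
    show "\<forall>\<^sub>F n in sequentially. norm (norm (pht (x n) u) / norm (fst (x n)) - 1)
      \<le> norm (fst u) / norm (fst (x n)) + norm (snd u) * K / sqrt (norm (fst (x n)))"
      using ev by simp
  qed (use 1 in simp)
  then show ?thesis by (simp add: LIM_zero_iff)
qed

text \<open>
  The ratio \<open>Phi (ray n) w / Phi (ray n) base\<close> is unchanged when \<open>g\<close> is applied to all points. Its limit is
  \<open>1 / ht w\<close>; computed along the image \<open>x n = g (ray n)\<close> it is a height ratio if \<open>x n\<close> is unbounded, and it involves
  \<open>|pht b (g w)|\<^sup>2 / ht (g w)\<close> if a subsequence converges to \<open>b\<close>. In the second case \<open>b\<close> is on
  the boundary, since \<open>Phi\<close> tends to infinity along the ray, and moving \<open>b\<close> to \<open>0\<close> by \<open>N\<close>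
  turns \<open>|pht b \<cdot>|\<^sup>2\<close> into the factor by which \<open>\<sigma>\<close> changes the height.
\<close>
lemma Phi_preserving_dichotomy:
  assumes g: "preserves_Phi g"
  shows "(\<exists>k>0. \<forall>z\<in>D. hgt (g z) = k * hgt z) \<or>
    (\<exists>Z\<in>C_im e. \<exists>X. \<exists>k>0. \<forall>z\<in>D. hgt (\<sigma> (act_N J e Z X (g z))) = k * hgt z)"
proof -
  define x where "x n = g (ray n)" for n
  note gD = preserves_PhiD(1)[OF g]
  have xD: "x n \<in> D" for n by (simp add: x_def gD ray_D)
  have x0: "0 < hgt (x n)" for n using xD[of n] by (simp add: mem_D)
  let ?b = "g base"
  have bD: "?b \<in> D" by (rule gD[OF base_in_D])
  let ?R = "\<lambda>w n. (norm (pht (x n) (g w)))\<^sup>2 / (norm (pht (x n) ?b))\<^sup>2"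
  have R: "?R w \<longlonglongrightarrow> hgt (g w) / (hgt w * hgt ?b)" if w: "w \<in> D" for w
  proof -
    have pos: "0 < hgt (g w)" "0 < hgt ?b" "0 < hgt w" using w gD bD by (auto simp: mem_D)
    have "Phi (ray n) w / Phi (ray n) base = ?R w n * (hgt ?b / hgt (g w))" for n
    proof -
      have "Phi (ray n) w / Phi (ray n) base = Phi (x n) (g w) / Phi (x n) ?b"
        using preserves_PhiD(3)[OF g] w ray_D base_in_D by (simp add: x_def)
      then show ?thesis using pos x0[of n] by (simp add: Phi_def)
    qed
    then have "(\<lambda>n. ?R w n * (hgt ?b / hgt (g w))) \<longlonglongrightarrow> 1 / hgt w"
      using Phi_ray_ratio[OF w] by simp
    from tendsto_mult[OF this tendsto_const[of "hgt (g w) / hgt ?b"]]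
    show ?thesis using pos by (simp add: mult.commute)
  qed
  show ?thesis
  proof (cases "\<exists>K. \<forall>n. norm (x n) \<le> K")
    case True
    then obtain K where "\<And>n. x n \<in> cball 0 K" by auto
    then obtain b r where r: "strict_mono r" "(x \<circ> r) \<longlonglongrightarrow> b"
      using compact_cball_space[of K] unfolding compact_eq_seq_compact_metric seq_compact_def by metis
    have xb: "(\<lambda>n. x (r n)) \<longlonglongrightarrow> b" using r(2) by (simp add: o_def)
    have pl: "(\<lambda>n. norm (pht (x (r n)) u)) \<longlonglongrightarrow> norm (pht b u)" for u
      unfolding pht_def by (intro tendsto_intros xb beta.tendsto)
    have hl: "(\<lambda>n. hgt (x (r n))) \<longlonglongrightarrow> hgt b"
      unfolding hgt_eq by (intro tendsto_intros xb) auto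
    have hb: "hgt b \<ge> 0" using hl x0 by (intro LIMSEQ_le_const[OF hl]) (auto intro: less_imp_le)
    have hb0: "hgt b = 0"
    proof (rule ccontr)
      assume "hgt b \<noteq> 0"
      then have "(\<lambda>n. Phi (x (r n)) ?b) \<longlonglongrightarrow> Phi b ?b"
        unfolding Phi_def using bD by (intro tendsto_intros hl pl) (auto simp: mem_D)
      then have "Bseq (\<lambda>n. Phi (x (r n)) ?b)" by (rule convergent_imp_Bseq[OF convergentI])
      then obtain B where B: "B > 0" "\<And>n. norm (Phi (x (r n)) ?b) \<le> B" by (auto simp: Bseq_def)
      have "real n / 4 \<le> B" for n
      proof -
        have "real n \<le> real (r n)" using seq_suble[OF r(1)] by simp
        also have "\<dots> / 4 \<le> (real (r n) + 2)\<^sup>2 / (4 * (real (r n) + 1))"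
          by (simp add: field_simps power2_eq_square)
        also have "\<dots> = Phi (ray (r n)) base"
        proof -
          have "pht (ray (r n)) base = (real (r n) + 2) *\<^sub>R e"
            by (simp add: pht_def ray_def scaleR_add_left scaleR_2 add_ac)
          then show ?thesis by (simp add: Phi_def hgt_ray hgt_eq[of base] add.commute)
        qed
        also have "\<dots> = Phi (x (r n)) ?b"
          using preserves_PhiD(3)[OF g ray_D base_in_D] by (simp add: x_def)
        also have "\<dots> \<le> B" using B(2)[of n] by simp
        finally show ?thesis by simp
      qed
      then show False using reals_Archimedean2[of "4 * B"] by (metis mult.commute not_less pos_divide_le_eq zero_less_numeral)
    qed
    have pb: "pht b u \<noteq> 0" if "u \<in> D" for u
      using pht_nonzero[of u b] that hb norm_pht_commute[of b u] by (auto simp: mem_D)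
    have eq: "(norm (pht b (g w)))\<^sup>2 / (norm (pht b ?b))\<^sup>2 = hgt (g w) / (hgt w * hgt ?b)"
      if w: "w \<in> D" for w
    proof (rule LIMSEQ_unique)
      show "(\<lambda>n. ?R w (r n)) \<longlonglongrightarrow> (norm (pht b (g w)))\<^sup>2 / (norm (pht b ?b))\<^sup>2"
        using pb[OF bD] by (intro tendsto_intros pl) auto
      show "(\<lambda>n. ?R w (r n)) \<longlonglongrightarrow> hgt (g w) / (hgt w * hgt ?b)"
        using LIMSEQ_subseq_LIMSEQ[OF R[OF w] r(1)] by (simp add: o_def)
    qed
    define Z X where "Z = - im_part e (fst b)" and "X = - snd b"
    have Z: "Z \<in> C_im e" by (simp add: Z_def)
    have nb: "act_N J e Z X b = (0, 0)"
      using hb0 by (simp add: prod_eq_iff Z_def X_def im_part_eq hgt_eq beta_simps beta_same algebra_simps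
          flip: scaleR_add_left)
    define k where "k = hgt ?b / (norm (pht b ?b))\<^sup>2"
    have k: "k > 0" using bD pb[OF bD] by (simp add: k_def mem_D)
    have "hgt (\<sigma> (act_N J e Z X (g w))) = k * hgt w" if w: "w \<in> D" for w
    proof -
      let ?u = "act_N J e Z X (g w)"
      have uD: "?u \<in> D" using gD[OF w] Z by (rule act_N_D[rotated])
      have "norm (pht b (g w)) = norm (pht (0,0) ?u)"
        using pht_act_N[OF Z, of X b "g w"] by (simp only: nb)
      then have n: "norm (pht b (g w)) = norm (fst ?u)" by (simp add: pht_def del: fst_act_N)
      have "hgt (\<sigma> ?u) = hgt (g w) / (norm (pht b (g w)))\<^sup>2"
        using hgt_inversion[OF fst_nonzero[OF uD]] by (simp only: n hgt_act_N[OF Z])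
      also have "\<dots> = k * hgt w"
        using eq[OF w] w gD[OF w] bD pb[OF gD[OF w]] pb[OF bD]
        by (simp add: k_def mem_D field_simps)
      finally show ?thesis .
    qed
    then show ?thesis using Z k by blast
  next
    case False
    \<comment> \<open>The indices must tend to infinity as well, so that the limit \<open>R\<close> can be used along them.\<close>
    have "\<exists>n\<ge>N. real N \<le> norm (x n)" for N
    proof -
      let ?M = "Max ((\<lambda>n. norm (x n)) ` {..N}) + real N"
      obtain n where n: "norm (x n) > ?M" using False by (metis not_le)
      have "\<not> n \<le> N"
      proof
        assume "n \<le> N"
        then have "norm (x n) \<le> Max ((\<lambda>n. norm (x n)) ` {..N})" by (intro Max_ge) auto
        then show False using n by simp
      qed
      moreover have "0 \<le> Max ((\<lambda>n. norm (x n)) ` {..N})"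
        by (rule order_trans[OF norm_ge_zero[of "x 0"]]) (auto intro: Max_ge)
      ultimately show ?thesis using n by (intro exI[of _ n]) auto
    qed
    then obtain s where s: "\<And>N. s N \<ge> N" "\<And>N. real N \<le> norm (x (s N))" by metis
    have sl: "filterlim s sequentially sequentially"
      by (rule filterlim_at_top_mono[OF filterlim_ident]) (use s in auto)
    have inf: "filterlim (\<lambda>n. norm (x (s n))) at_top sequentially"
      by (rule filterlim_at_top_mono[OF filterlim_real_sequentially]) (use s in auto)
    have lim: "(\<lambda>n. norm (pht (x (s n)) u) / norm (fst (x (s n)))) \<longlonglongrightarrow> 1" for u
      by (rule pht_ratio_at_infinity[OF _ inf]) (use x0 in \<open>auto intro: less_imp_le\<close>)
    have "hgt (g w) = hgt ?b * hgt w" if w: "w \<in> D" for w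
    proof -
      have "(\<lambda>n. (norm (pht (x (s n)) (g w)) / norm (fst (x (s n))))\<^sup>2 / (norm (pht (x (s n)) ?b) / norm (fst (x (s n))))\<^sup>2)
        \<longlonglongrightarrow> 1\<^sup>2 / 1\<^sup>2"
        by (intro tendsto_intros lim) auto
      moreover have "(norm (pht (x (s n)) (g w)) / norm (fst (x (s n))))\<^sup>2 / (norm (pht (x (s n)) ?b) / norm (fst (x (s n))))\<^sup>2 = ?R w (s n)" for n
        using fst_nonzero[OF xD] by (simp add: power_divide)
      ultimately have "(\<lambda>n. ?R w (s n)) \<longlonglongrightarrow> 1" by simp
      moreover have "(\<lambda>n. ?R w (s n)) \<longlonglongrightarrow> hgt (g w) / (hgt w * hgt ?b)"
        by (rule filterlim_compose[OF R[OF w] sl])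
      ultimately have "hgt (g w) / (hgt w * hgt ?b) = 1" by (rule LIMSEQ_unique[symmetric])
      then show ?thesis using w bD by (simp add: mem_D field_simps)
    qed
    then show ?thesis using bD by (auto simp: mem_D)
  qed
qed

lemma isometry_decomposition:
  assumes g: "preserves_Phi g"
  shows "(\<exists>k>0. \<exists>m\<in>M_maps J e. \<exists>n\<in>N_maps J e. \<forall>z\<in>D. g z = m (act_A k (n z))) \<or>
    (\<exists>k>0. \<exists>n1\<in>N_maps J e. \<exists>m\<in>M_maps J e. \<exists>n2\<in>N_maps J e.
        \<forall>z\<in>D. g z = n1 (\<sigma> (m (act_A k (n2 z)))))"
proof (cases "\<exists>k>0. \<forall>z\<in>D. hgt (g z) = k * hgt z")
  case True
  then obtain k where k: "k > 0" and h: "\<forall>z\<in>D. hgt (g z) = k * hgt z" by (elim exE conjE)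
  have "\<exists>m\<in>M_maps J e. \<exists>n\<in>N_maps J e. \<forall>z\<in>D. g z = m (act_A k (n z))"
    by (rule MAN_form[OF g k h[rule_format]])
  with k show ?thesis by (intro disjI1 exI[of _ k] conjI)
next
  case False
  then have "\<exists>Z\<in>C_im e. \<exists>X. \<exists>k>0. \<forall>z\<in>D. hgt (\<sigma> (act_N J e Z X (g z))) = k * hgt z"
    using Phi_preserving_dichotomy[OF g] by (simp only: simp_thms)
  then obtain Z X k where Z: "Z \<in> C_im e" and k: "k > 0"
    and h: "\<forall>z\<in>D. hgt (\<sigma> (act_N J e Z X (g z))) = k * hgt z" by (elim exE bexE conjE)
  have P: "preserves_Phi (\<lambda>z. \<sigma> (act_N J e Z X (g z)))"
    by (rule preserves_Phi_comp[OF preserves_Phi_inversion preserves_Phi_comp[OF preserves_Phi_act_N[OF Z] g]])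
  have "\<exists>m\<in>M_maps J e. \<exists>n\<in>N_maps J e. \<forall>z\<in>D. \<sigma> (act_N J e Z X (g z)) = m (act_A k (n z))"
    by (rule MAN_form[OF P k h[rule_format]])
  then obtain m n where mn: "m \<in> M_maps J e" "n \<in> N_maps J e"
    "\<forall>z\<in>D. \<sigma> (act_N J e Z X (g z)) = m (act_A k (n z))" by (elim bexE)
  have "g z = act_N J e (- Z) (- X) (\<sigma> (m (act_A k (n z))))" if z: "z \<in> D" for z
  proof -
    have "act_N J e Z X (g z) \<in> D" using preserves_PhiD(1)[OF g z] Z by (simp add: act_N_D)
    then have "\<sigma> (\<sigma> (act_N J e Z X (g z))) = act_N J e Z X (g z)"
      by (intro inversion_involution fst_nonzero)
    then show ?thesis using mn(3)[rule_format, OF z] act_N_inverse(1)[OF Z, of X "g z"] by (simp only:)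
  qed
  then have "\<forall>z\<in>D. g z = act_N J e (- Z) (- X) (\<sigma> (m (act_A k (n z))))" by (rule ballI)
  moreover have "act_N J e (- Z) (- X) \<in> N_maps J e" using Z by (auto simp: N_maps_def)
  ultimately have "\<exists>n1\<in>N_maps J e. \<exists>m\<in>M_maps J e. \<exists>n2\<in>N_maps J e.
        \<forall>z\<in>D. g z = n1 (\<sigma> (m (act_A k (n2 z))))"
    using mn(1,2) by (intro bexI[of _ "act_N J e (- Z) (- X)"] bexI[of _ m] bexI[of _ n])
  with k show ?thesis by (intro disjI2 exI[of _ k] conjI)
qed

section \<open>Continuous extension to the boundary\<close>

text \<open>
  The finite part of the closure of \<open>D\<close>; \<open>Dbar\<close> adds the point at infinity.
\<close>
definition Dcl :: "('c \<times> 'v) set" where "Dcl = {z. 0 \<le> hgt z}"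

abbreviation "Dbar \<equiv> (D_bar e :: ('c \<times> 'v) option set)"
abbreviation "Dbar_top \<equiv> (D_bar_top e :: ('c \<times> 'v) option topology)"

lemma D_bar_eq: "Dbar = insert None (Some ` Dcl)"
proof -
  have "{(\<zeta>, v). re_part e \<zeta> \<ge> 1/4 * (norm v)\<^sup>2} = Dcl"
    by (auto simp: Dcl_def hgt_eq re_part_def)
  then show ?thesis by (simp add: D_bar_def)
qed

lemma mem_D_bar [simp]: "None \<in> Dbar" "Some z \<in> Dbar \<longleftrightarrow> z \<in> Dcl"
  by (auto simp: D_bar_eq)

lemma D_subset_Dcl: "D \<subseteq> Dcl"
  by (auto simp: Dcl_def mem_D simp del: ht.simps)

lemma continuous_hgt: "continuous_on A hgt"
proof -
  have "hgt = (\<lambda>z. e \<bullet> fst z - (norm (snd z))\<^sup>2 / 4)" by (simp add: fun_eq_iff hgt_eq)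
  then show ?thesis by (simp add: continuous_intros)
qed

lemma closed_Dcl: "closed Dcl"
  unfolding Dcl_def by (intro closed_Collect_le continuous_hgt continuous_intros)

lemma topspace_D_bar [simp]: "topspace Dbar_top = Dbar"
  by (auto simp: D_bar_top_def)

text \<open>
  A neighbourhood of \<open>\<infinity>\<close> in the closure is the complement of a compact set, and in \<open>Dcl\<close>, which is closed in a
  space with the Heine-Borel property, it suffices to exclude a bounded set.
\<close>
lemma openin_D_bar:
  "openin Dbar_top U \<longleftrightarrow> U \<subseteq> Dbar \<and>
     (\<forall>z. Some z \<in> U \<longrightarrow> (\<exists>d>0. \<forall>w\<in>Dcl. dist w z < d \<longrightarrow> Some w \<in> U)) \<and>
     (None \<in> U \<longrightarrow> (\<exists>R. \<forall>w\<in>Dcl. R < norm w \<longrightarrow> Some w \<in> U))" (is "_ \<longleftrightarrow> ?rhs")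
proof
  assume "openin Dbar_top U"
  then obtain V where V: "openin (Alexandroff_compactification euclidean) V" "U = V \<inter> Dbar"
    by (auto simp: D_bar_top_def openin_subtopology)
  from V(1) consider T where "open T" "V = Some ` T" | C where "compact C" "V = insert None (Some ` (- C))"
    by (auto simp: openin_Alexandroff_compactification Compl_eq_Diff_UNIV)
  then show ?rhs
  proof cases
    case 1
    have "\<exists>d>0. \<forall>w\<in>Dcl. dist w z < d \<longrightarrow> Some w \<in> U" if "Some z \<in> U" for z
    proof -
      have "z \<in> T" using that 1 V by auto
      then obtain d where "d > 0" "\<forall>w. dist w z < d \<longrightarrow> w \<in> T" using \<open>open T\<close> by (auto simp: open_dist)
      then show ?thesis using 1 V by auto
    qed
    moreover have "None \<notin> U" using 1 V by auto
    ultimately show ?thesis using V by blast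
  next
    case 2
    then have "open (- C)" by (simp add: compact_imp_closed open_Compl)
    have "\<exists>d>0. \<forall>w\<in>Dcl. dist w z < d \<longrightarrow> Some w \<in> U" if "Some z \<in> U" for z
    proof -
      have "z \<in> - C" using that 2 V by auto
      then obtain d where "d > 0" "\<forall>w. dist w z < d \<longrightarrow> w \<in> - C"
        using \<open>open (- C)\<close> unfolding open_dist by blast
      then show ?thesis using 2 V by auto
    qed
    moreover obtain R where "\<forall>w\<in>C. norm w \<le> R" using compact_imp_bounded[OF 2(1)] by (auto simp: bounded_iff)
    then have "\<forall>w\<in>Dcl. R < norm w \<longrightarrow> Some w \<in> U" using 2 V by fastforce
    ultimately show ?thesis using V by blast
  qed
next
  assume rhs: ?rhs
  let ?U = "{z. Some z \<in> U}"
  have UD: "?U \<subseteq> Dcl" using rhs by auto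
  have "openin (top_of_set Dcl) ?U"
    unfolding openin_euclidean_subtopology_iff using rhs UD by auto
  then obtain T where T: "open T" "?U = Dcl \<inter> T" by (auto simp: openin_open)
  show "openin Dbar_top U"
  proof (cases "None \<in> U")
    case False
    have "U = Some ` T \<inter> Dbar"
    proof (intro Set.set_eqI)
      fix x show "x \<in> U \<longleftrightarrow> x \<in> Some ` T \<inter> Dbar"
        using False T(2) by (cases x) auto
    qed
    then show ?thesis
      unfolding D_bar_top_def openin_subtopology using T(1)
      by (intro exI[of _ "Some ` T"]) simp
  next
    case True
    then obtain R where R: "\<forall>w\<in>Dcl. R < norm w \<longrightarrow> Some w \<in> U" using rhs by blast
    define C where "C = Dcl \<inter> - T"
    have "closed C" unfolding C_def using T(1) closed_Dcl by (intro closed_Int) (auto simp: closed_def)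
    moreover have "C \<subseteq> cball 0 R"
    proof
      fix w assume w: "w \<in> C"
      then have "Some w \<notin> U" using T(2) by (auto simp: C_def)
      then show "w \<in> cball 0 R" using R w by (auto simp: C_def not_less[symmetric])
    qed
    ultimately have "compact C"
      using compact_Int_closed[OF compact_cball_space[of R]] by (metis inf.absorb2)
    have "U = insert None (Some ` (- C)) \<inter> Dbar"
    proof (intro Set.set_eqI)
      fix x show "x \<in> U \<longleftrightarrow> x \<in> insert None (Some ` (- C)) \<inter> Dbar"
        using True T(2) by (cases x) (auto simp: C_def)
    qed
    moreover have "openin (Alexandroff_compactification euclidean) (insert None (Some ` (- C)))"
      using \<open>compact C\<close> \<open>closed C\<close> by (auto simp: openin_Alexandroff_compactification Compl_eq_Diff_UNIV)
    ultimately show ?thesis unfolding D_bar_top_def openin_subtopology by blast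
  qed
qed

lemma continuous_map_D_barI:
  assumes maps: "\<And>x. x \<in> Dbar \<Longrightarrow> h x \<in> Dbar"
    and fin_fin: "\<And>z y d. z \<in> Dcl \<Longrightarrow> h (Some z) = Some y \<Longrightarrow> d > 0 \<Longrightarrow>
      \<exists>c>0. \<forall>w\<in>Dcl. dist w z < c \<longrightarrow> (\<exists>y'. h (Some w) = Some y' \<and> dist y' y < d)"
    and fin_inf: "\<And>z R. z \<in> Dcl \<Longrightarrow> h (Some z) = None \<Longrightarrow>
      \<exists>c>0. \<forall>w\<in>Dcl. dist w z < c \<longrightarrow> h (Some w) = None \<or> (\<exists>y'. h (Some w) = Some y' \<and> R < norm y')"
    and inf_fin: "\<And>y d. h None = Some y \<Longrightarrow> d > 0 \<Longrightarrow>
      \<exists>R. \<forall>w\<in>Dcl. R < norm w \<longrightarrow> (\<exists>y'. h (Some w) = Some y' \<and> dist y' y < d)"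
    and inf_inf: "\<And>R. h None = None \<Longrightarrow>
      \<exists>R'. \<forall>w\<in>Dcl. R' < norm w \<longrightarrow> (\<exists>y'. h (Some w) = Some y' \<and> R < norm y')"
  shows "continuous_map Dbar_top Dbar_top h"
  unfolding continuous_map_def topspace_D_bar
proof (intro conjI allI impI)
  show "h \<in> Dbar \<rightarrow> Dbar" using maps by blast
  fix U assume U: "openin Dbar_top U"
  have Dh: "y \<in> Dcl" if "w \<in> Dcl" "h (Some w) = Some y" for w y
    using maps[of "Some w"] that by simp
  have U1: "\<exists>d>0. \<forall>w\<in>Dcl. dist w z < d \<longrightarrow> Some w \<in> U" if "Some z \<in> U" for z
    using U that unfolding openin_D_bar by blast
  have U2: "\<exists>R. \<forall>w\<in>Dcl. R < norm w \<longrightarrow> Some w \<in> U" if "None \<in> U"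
    using U that unfolding openin_D_bar by blast
  show "openin Dbar_top {x \<in> Dbar. h x \<in> U}"
    unfolding openin_D_bar
  proof (intro conjI allI impI)
    fix z assume "Some z \<in> {x \<in> Dbar. h x \<in> U}"
    then have z: "z \<in> Dcl" "h (Some z) \<in> U" by auto
    show "\<exists>d>0. \<forall>w\<in>Dcl. dist w z < d \<longrightarrow> Some w \<in> {x \<in> Dbar. h x \<in> U}"
    proof (cases "h (Some z)")
      case None
      with z U2 obtain R where R: "\<forall>w\<in>Dcl. R < norm w \<longrightarrow> Some w \<in> U" by auto
      obtain c where "c > 0" "\<forall>w\<in>Dcl. dist w z < c \<longrightarrow> h (Some w) = None \<or> (\<exists>y'. h (Some w) = Some y' \<and> R < norm y')"
        using fin_inf[OF z(1) None, of R] by blast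
      then show ?thesis using R Dh z(2) None by (intro exI[of _ c]) force
    next
      case (Some y)
      with z U1 obtain d where d: "d > 0" "\<forall>w\<in>Dcl. dist w y < d \<longrightarrow> Some w \<in> U" by metis
      obtain c where "c > 0" "\<forall>w\<in>Dcl. dist w z < c \<longrightarrow> (\<exists>y'. h (Some w) = Some y' \<and> dist y' y < d)"
        using fin_fin[OF z(1) Some d(1)] by blast
      then show ?thesis using d(2) Dh by (intro exI[of _ c]) force
    qed
  next
    assume "None \<in> {x \<in> Dbar. h x \<in> U}"
    then have n: "h None \<in> U" by simp
    show "\<exists>R. \<forall>w\<in>Dcl. R < norm w \<longrightarrow> Some w \<in> {x \<in> Dbar. h x \<in> U}"
    proof (cases "h None")
      case None
      with n U2 obtain R where R: "\<forall>w\<in>Dcl. R < norm w \<longrightarrow> Some w \<in> U" by auto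
      obtain R' where "\<forall>w\<in>Dcl. R' < norm w \<longrightarrow> (\<exists>y'. h (Some w) = Some y' \<and> R < norm y')"
        using inf_inf[OF None, of R] by blast
      then show ?thesis using R Dh by (intro exI[of _ R']) force
    next
      case (Some y)
      with n U1 obtain d where d: "d > 0" "\<forall>w\<in>Dcl. dist w y < d \<longrightarrow> Some w \<in> U" by metis
      obtain R where "\<forall>w\<in>Dcl. R < norm w \<longrightarrow> (\<exists>y'. h (Some w) = Some y' \<and> dist y' y < d)"
        using inf_fin[OF Some d(1)] by blast
      then show ?thesis using d(2) Dh by (intro exI[of _ R]) force
    qed
  qed auto
qed

lemma Hausdorff_D_bar: "Hausdorff_space Dbar_top"
proof -
  have "locally_compact_space (euclidean :: ('c \<times> 'v) topology)"
    unfolding locally_compact_space_def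
  proof
    fix x :: "'c \<times> 'v"
    show "\<exists>U K. openin euclidean U \<and> compactin euclidean K \<and> x \<in> U \<and> U \<subseteq> K"
      using compact_cball_space[of "norm x + 1"]
      by (intro exI[of _ "ball 0 (norm x + 1)"] exI[of _ "cball 0 (norm x + 1)"]) auto
  qed
  then show ?thesis
    unfolding D_bar_top_def
    by (intro Hausdorff_space_subtopology) (simp add: Hausdorff_space_Alexandroff_compactification)
qed

lemma hgt_add_e: "hgt (fst z + d *\<^sub>R e, snd z) = hgt z + d"
  by (simp add: hgt_eq inner_add)

lemma D_dense_in_D_bar: "x \<in> Dbar \<Longrightarrow> x \<in> Dbar_top closure_of (Some ` D)"
  unfolding in_closure_of topspace_D_bar
proof (intro conjI allI impI)
  fix U assume x: "x \<in> Dbar" and U: "x \<in> U \<and> openin Dbar_top U"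
  show "\<exists>y. y \<in> Some ` D \<and> y \<in> U"
  proof (cases x)
    case None
    then obtain R where R: "\<forall>w\<in>Dcl. R < norm w \<longrightarrow> Some w \<in> U"
      using U unfolding openin_D_bar by blast
    obtain n where "real n > R" using reals_Archimedean2 by blast
    then have "R < norm (ray n)" by (simp add: ray_def norm_Pair)
    then show ?thesis using R ray_D D_subset_Dcl by blast
  next
    case (Some z)
    then obtain d where d: "d > 0" "\<forall>w\<in>Dcl. dist w z < d \<longrightarrow> Some w \<in> U"
      using U unfolding openin_D_bar by blast
    define w where "w = (fst z + (d/2) *\<^sub>R e, snd z)"
    have "dist w z < d" using d(1) by (simp add: w_def dist_prod_def dist_norm)
    moreover have "w \<in> D" using x d(1) Some unfolding w_def mem_D hgt_add_e by (simp add: Dcl_def)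
    ultimately show ?thesis using d(2) D_subset_Dcl by blast
  qed
qed auto

text \<open>
  The description defining \<open>bar_ext\<close> has at most one solution, because \<open>D\<close> is dense in its closure, which is Hausdorff.
\<close>
lemma bar_ext_eqI:
  assumes h: "continuous_map Dbar_top Dbar_top h" and hg: "\<And>z. z \<in> D \<Longrightarrow> h (Some z) = Some (g z)"
    and x: "x \<in> Dbar"
  shows "bar_ext e g x = h x"
proof -
  let ?P = "\<lambda>h. h \<in> extensional Dbar \<and> continuous_map Dbar_top Dbar_top h \<and> (\<forall>z\<in>D. h (Some z) = Some (g z))"
  have uniq: "h1 y = h2 y" if "continuous_map Dbar_top Dbar_top h1" "continuous_map Dbar_top Dbar_top h2"
    "\<forall>z\<in>D. h1 (Some z) = Some (g z)" "\<forall>z\<in>D. h2 (Some z) = Some (g z)" "y \<in> Dbar" for h1 h2 y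
    by (rule forall_in_closure_of_eq[OF D_dense_in_D_bar[OF that(5)] Hausdorff_D_bar that(1,2)])
       (use that(3,4) in auto)
  have "continuous_map Dbar_top Dbar_top (restrict h Dbar)"
    by (rule continuous_map_eq[OF h]) auto
  then have P: "?P (restrict h Dbar)"
    using hg D_subset_Dcl by auto
  have "bar_ext e g = restrict h Dbar"
    unfolding bar_ext_def
  proof (rule the_equality[where P = ?P, OF P])
    fix h' assume h': "?P h'"
    show "h' = restrict h Dbar"
    proof (rule extensionalityI[of _ Dbar])
      show "h' y = restrict h Dbar y" if "y \<in> Dbar" for y
        using uniq[of h' "restrict h Dbar" y] h' P that by blast
    qed (use h' P in auto)
  qed
  then show ?thesis using x by simp
qed

lemma continuous_map_proper:
  assumes cont: "\<And>z. isCont f z" and maps: "\<And>z. z \<in> Dcl \<Longrightarrow> f z \<in> Dcl"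
    and proper: "\<And>z. norm z \<le> a + b * norm (f z)" and b: "0 \<le> b"
  shows "continuous_map Dbar_top Dbar_top (map_option f)"
proof (rule continuous_map_D_barI)
  show "map_option f x \<in> Dbar" if "x \<in> Dbar" for x using that maps by (cases x) auto
next
  fix z y and d :: real assume y: "map_option f (Some z) = Some y" and d: "d > 0"
  obtain c where "c > 0" "\<forall>w. dist w z < c \<longrightarrow> dist (f w) (f z) < d"
    using cont[of z] d unfolding continuous_at_eps_delta by blast
  then show "\<exists>c>0. \<forall>w\<in>Dcl. dist w z < c \<longrightarrow> (\<exists>y'. map_option f (Some w) = Some y' \<and> dist y' y < d)"
    using y by (intro exI[of _ c]) auto
next
  fix R
  have "R < norm (f w)" if "a + b * R < norm w" for w
  proof (rule ccontr)
    assume "\<not> R < norm (f w)"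
    then have "b * norm (f w) \<le> b * R" using b by (intro mult_left_mono) auto
    then show False using proper[of w] that by simp
  qed
  then show "\<exists>R'. \<forall>w\<in>Dcl. R' < norm w \<longrightarrow> (\<exists>y'. map_option f (Some w) = Some y' \<and> R < norm y')"
    by (intro exI[of _ "a + b * R"]) simp
qed auto

lemma hgt_M: "m \<in> M_maps J e \<Longrightarrow> hgt (m z) = hgt z"
  and norm_M: "m \<in> M_maps J e \<Longrightarrow> norm (m z) = norm z"
  and norm_fst_M: "m \<in> M_maps J e \<Longrightarrow> norm (fst (m z)) = norm (fst z)"
  and isCont_M: "m \<in> M_maps J e \<Longrightarrow> isCont m z"
proof -
  assume "m \<in> M_maps J e"
  then obtain \<phi> \<psi> where m: "m = map_prod \<phi> \<psi>" "orthogonal_transformation \<phi>" "orthogonal_transformation \<psi>" "\<phi> e = e"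
    by (auto simp: M_maps_def)
  have n: "norm (\<phi> x) = norm x" "norm (\<psi> y) = norm y" for x y
    using m orthogonal_transformation_norm by blast+
  have "e \<bullet> \<phi> x = e \<bullet> x" for x using m by (metis orthogonal_transformation_def)
  then show "hgt (m z) = hgt z" by (cases z) (simp add: m hgt_eq n)
  show "norm (m z) = norm z" "norm (fst (m z)) = norm (fst z)" by (cases z; simp add: m norm_Pair n)+
  have "linear \<phi>" "linear \<psi>" using m by (auto simp: orthogonal_transformation_def)
  then have "bounded_linear \<phi>" "bounded_linear \<psi>"
    by (auto intro!: bounded_linear_intro[where K = 1] simp: linear_add linear_cmul n)
  moreover have "m = (\<lambda>z. (\<phi> (fst z), \<psi> (snd z)))" by (simp add: m fun_eq_iff)
  ultimately show "isCont m z"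
    by (simp add: bounded_linear.isCont continuous_intros linear_continuous_at isCont_Pair bounded_linear.continuous)
qed

lemma continuous_map_M: "m \<in> M_maps J e \<Longrightarrow> continuous_map Dbar_top Dbar_top (map_option m)"
  by (rule continuous_map_proper[where a = 0 and b = 1]) (auto simp: isCont_M Dcl_def hgt_M norm_M)

lemma continuous_map_A:
  assumes t: "0 < t" shows "continuous_map Dbar_top Dbar_top (map_option (act_A t))"
proof (rule continuous_map_proper[where a = 0 and b = "1/t + 1/sqrt t"])
  have *: "act_A t = (\<lambda>z. (t *\<^sub>R fst z, sqrt t *\<^sub>R snd z))" by (simp add: fun_eq_iff)
  show "isCont (act_A t) z" for z :: "'c \<times> 'v" unfolding * by (intro continuous_intros)
  fix z :: "'c \<times> 'v"
  show "act_A t z \<in> Dcl" if "z \<in> Dcl" using that t by (simp add: Dcl_def hgt_act_A)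
  have "norm z = norm (act_A (1/t) (act_A t z))" using t by (simp only: act_A_inverse)
  also have "\<dots> \<le> (1/t) * norm (fst (act_A t z)) + (1/sqrt t) * norm (snd (act_A t z))"
    using t norm_Pair_le[of "(1/t) *\<^sub>R fst (act_A t z)" "sqrt (1/t) *\<^sub>R snd (act_A t z)"]
    by (cases "act_A t z") (simp add: real_sqrt_divide)
  also have "\<dots> \<le> (1/t) * norm (act_A t z) + (1/sqrt t) * norm (act_A t z)"
    using t by (intro add_mono mult_left_mono norm_fst_proj norm_snd_proj) auto
  finally show "norm z \<le> 0 + (1/t + 1/sqrt t) * norm (act_A t z)" by (simp add: distrib_right)
qed (use t in simp)

lemma continuous_map_N:
  assumes n: "n \<in> N_maps J e" shows "continuous_map Dbar_top Dbar_top (map_option n)"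
proof -
  obtain Z X where Z: "Z \<in> C_im e" and n: "n = act_N J e Z X" using n by (auto simp: N_maps_def)
  obtain K where K: "\<And>a b. norm (\<beta> a b) \<le> norm a * norm b * K" "K \<ge> 0"
    using beta.nonneg_bounded by blast
  let ?a = "norm ((1/4 * (norm X)\<^sup>2) *\<^sub>R e - Z) + norm X" and ?b = "1 + norm X * K + 1"
  show ?thesis
  proof (rule continuous_map_proper[where a = ?a and b = ?b])
    have *: "n = (\<lambda>z. ((1/4 * (norm X)\<^sup>2) *\<^sub>R e + Z + fst z + (1/2) *\<^sub>R \<beta> (snd z) X, X + snd z))"
      by (simp add: fun_eq_iff n)
    show "isCont n z" for z unfolding * by (intro continuous_intros beta.isCont)
    fix z
    show "n z \<in> Dcl" if "z \<in> Dcl" using that Z by (simp add: Dcl_def hgt_act_N n)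
    define w where "w = n z"
    have zw: "z = act_N J e (- Z) (- X) w" using Z by (simp only: w_def n act_N_inverse)
    have f: "fst z = (1/4 * (norm X)\<^sup>2) *\<^sub>R e - Z + fst w - (1/2) *\<^sub>R \<beta> (snd w) X"
      and s: "snd z = snd w - X"
      by (simp_all add: zw beta.minus_right)
    have "norm z \<le> norm (fst z) + norm (snd z)" by (metis norm_Pair_le prod.collapse)
    also have "norm (snd z) \<le> norm w + norm X"
      unfolding s using norm_triangle_ineq4[of "snd w" X] norm_snd_proj[of w] by linarith
    also have "norm (fst z) \<le> norm ((1/4 * (norm X)\<^sup>2) *\<^sub>R e - Z) + norm w + norm w * norm X * K"
    proof -
      have "norm (fst z) \<le> norm ((1/4 * (norm X)\<^sup>2) *\<^sub>R e - Z) + norm (fst w) + norm ((1/2) *\<^sub>R \<beta> (snd w) X)"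
        unfolding f
        by (rule order_trans[OF norm_triangle_ineq4 add_right_mono[OF norm_triangle_ineq]])
      moreover have "norm ((1/2) *\<^sub>R \<beta> (snd w) X) \<le> norm w * norm X * K"
      proof -
        have "norm ((1/2) *\<^sub>R \<beta> (snd w) X) \<le> norm (\<beta> (snd w) X)" by simp
        also have "\<dots> \<le> norm (snd w) * norm X * K" by (rule K)
        also have "\<dots> \<le> norm w * norm X * K" using K(2) by (intro mult_right_mono norm_snd_proj) auto
        finally show ?thesis .
      qed
      ultimately show ?thesis using norm_fst_proj[of w] by linarith
    qed
    finally show "norm z \<le> ?a + ?b * norm (n z)" by (simp add: algebra_simps flip: w_def)
  qed (use K(2) in simp)
qed

text \<open>
  In \<open>Dcl\<close> the only point with vanishing first coordinate is \<open>0\<close> (\<open>Dcl_fst_zero\<close>), so \<open>0\<close> and \<open>\<infinity>\<close> are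
  exchanged.
\<close>
definition bar_inversion :: "('c \<times> 'v) option \<Rightarrow> ('c \<times> 'v) option" where
  "bar_inversion x = (case x of None \<Rightarrow> Some (0, 0) | Some z \<Rightarrow> if fst z = 0 then None else Some (\<sigma> z))"

lemma Dcl_fst_zero: "z \<in> Dcl \<Longrightarrow> fst z = 0 \<Longrightarrow> z = (0, 0)"
  using norm_snd_le_sqrt[of z] by (simp add: Dcl_def prod_eq_iff)

lemma isCont_inversion: "fst z \<noteq> 0 \<Longrightarrow> isCont \<sigma> z"
proof -
  assume z: "fst z \<noteq> 0"
  note [continuous_intros] = bounded_linear.isCont[OF bounded_linear_cnj] bounded_bilinear.isCont[OF bounded_bilinear_J]
  have *: "\<sigma> = (\<lambda>z. ((1 / (norm (fst z))\<^sup>2) *\<^sub>R cnj (fst z), - J ((1 / (norm (fst z))\<^sup>2) *\<^sub>R cnj (fst z)) (snd z)))"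
    by (simp add: fun_eq_iff inv_C_eq)
  show ?thesis unfolding * using z by (intro continuous_intros) auto
qed

lemma continuous_map_inversion: "continuous_map Dbar_top Dbar_top bar_inversion"
proof (rule continuous_map_D_barI)
  show "bar_inversion x \<in> Dbar" if "x \<in> Dbar" for x
  proof (cases x)
    case None
    then show ?thesis by (simp add: bar_inversion_def Dcl_def hgt_eq)
  next
    case (Some z)
    then show ?thesis using that by (simp add: bar_inversion_def Dcl_def hgt_inversion)
  qed
next
  fix z y and d :: real
  assume zy: "bar_inversion (Some z) = Some y" and d: "d > 0"
  then have z: "fst z \<noteq> 0" "y = \<sigma> z" by (auto simp: bar_inversion_def split: if_splits)
  obtain c where c: "c > 0" "\<And>w. dist w z < c \<Longrightarrow> dist (\<sigma> w) y < d"
    using isCont_inversion[OF z(1)] d unfolding continuous_at_eps_delta z(2) by metis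
  have "fst w \<noteq> 0" if "dist w z < norm (fst z)" for w
  proof
    assume "fst w = 0"
    then have "norm (fst z) \<le> dist w z" using dist_fst_le[of w z] by simp
    then show False using that by simp
  qed
  then show "\<exists>c>0. \<forall>w\<in>Dcl. dist w z < c \<longrightarrow> (\<exists>y'. bar_inversion (Some w) = Some y' \<and> dist y' y < d)"
    using c z(1) by (intro exI[of _ "min c (norm (fst z))"]) (auto simp: bar_inversion_def)
next
  fix z and R :: real
  assume "z \<in> Dcl" "bar_inversion (Some z) = None"
  then have z: "z = (0, 0)" using Dcl_fst_zero[of z] by (auto simp: bar_inversion_def split: if_splits)
  have "R < norm (\<sigma> w)" if w: "fst w \<noteq> 0" "dist w z < 1 / (\<bar>R\<bar> + 1)" for w
  proof -
    have "norm (fst w) \<le> dist w z" using dist_fst_le[of w z] by (simp add: z)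
    then have "norm (fst w) < 1 / (\<bar>R\<bar> + 1)" using w by simp
    then have "\<bar>R\<bar> + 1 < 1 / norm (fst w)" using w(1)
      by (metis abs_add_one_gt_zero inverse_eq_divide inverse_inverse_eq inverse_less_iff_less inverse_positive_iff_positive zero_less_norm_iff add.commute)
    also have "\<dots> = norm (fst (\<sigma> w))" by (simp add: norm_inv_C)
    also have "\<dots> \<le> norm (\<sigma> w)" by (rule norm_fst_proj)
    finally show ?thesis by linarith
  qed
  then show "\<exists>c>0. \<forall>w\<in>Dcl. dist w z < c \<longrightarrow> bar_inversion (Some w) = None \<or> (\<exists>y'. bar_inversion (Some w) = Some y' \<and> R < norm y')"
    by (intro exI[of _ "1 / (\<bar>R\<bar> + 1)"]) (auto simp: bar_inversion_def)
next
  fix y and d :: real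
  assume "bar_inversion None = Some y" and d: "d > 0"
  then have y: "y = (0, 0)" by (simp add: bar_inversion_def)
  have "fst w \<noteq> 0 \<and> dist (\<sigma> w) y < d" if w: "w \<in> Dcl" "1 + 5 * (1 + 9 / d\<^sup>2) < norm w" for w
  proof
    let ?m = "norm (fst w)"
    define q where "q = 9 / d\<^sup>2"
    have "1 + 5 * (1 + q) < 1 + 5 * ?m"
      by (rule less_le_trans[OF w(2)[folded q_def] norm_le_fst[OF w(1)[unfolded Dcl_def mem_Collect_eq]]])
    then have "1 + q < ?m" by simp
    then have m: "1 + 9 / d\<^sup>2 < ?m" by (simp add: q_def)
    have d2: "0 < 9 / d\<^sup>2" using d by simp
    have m1: "1 < ?m" and m2: "9 / d\<^sup>2 < ?m"
      using \<open>1 + q < ?m\<close> d2 unfolding q_def[symmetric] by linarith+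
    show "fst w \<noteq> 0" using m1 by auto
    have "3 / d = sqrt (9 / d\<^sup>2)" using d by (simp add: real_sqrt_divide)
    also have "\<dots> < sqrt ?m" using m2 by simp
    finally have s: "3 / d < sqrt ?m" .
    have ss: "sqrt ?m * sqrt ?m = ?m" by simp
    have s1: "1 \<le> sqrt ?m" using m1 by simp
    have "norm (\<sigma> w) \<le> norm (fst (\<sigma> w)) + norm (snd (\<sigma> w))" by (metis norm_Pair_le prod.collapse)
    also have "\<dots> = 1 / ?m + norm (snd w) / ?m" by (simp add: norm_inv_C norm_J)
    also have "\<dots> \<le> sqrt ?m / ?m + 2 * sqrt ?m / ?m"
      using norm_snd_le_sqrt[of w] w(1) s1 by (intro add_mono divide_right_mono) (auto simp: Dcl_def)
    also have "\<dots> = 3 * (sqrt ?m / ?m)" by simp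
    also have "\<dots> = 3 / sqrt ?m" by (simp add: sqrt_divide_self_eq inverse_eq_divide)
    also have "\<dots> < d"
    proof -
      have "3 < sqrt ?m * d" using s by (simp only: pos_divide_less_eq[OF d])
      moreover have "0 < sqrt ?m" using m1 by auto
      ultimately show ?thesis by (simp only: pos_divide_less_eq mult.commute)
    qed
    finally show "dist (\<sigma> w) y < d" by (simp add: y flip: zero_prod_def)
  qed
  then show "\<exists>R. \<forall>w\<in>Dcl. R < norm w \<longrightarrow> (\<exists>y'. bar_inversion (Some w) = Some y' \<and> dist y' y < d)"
    by (intro exI[of _ "1 + 5 * (1 + 9 / d\<^sup>2)"]) (auto simp: bar_inversion_def)
qed (simp add: bar_inversion_def)

lemma bar_ext_MAN:
  assumes "0 < t" "m \<in> M_maps J e" "n \<in> N_maps J e" and g: "\<And>z. z \<in> D \<Longrightarrow> g z = m (act_A t (n z))"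
  shows "bar_ext e g None = None"
proof -
  have "continuous_map Dbar_top Dbar_top (map_option m \<circ> (map_option (act_A t) \<circ> map_option n))"
    by (rule continuous_map_compose[OF continuous_map_compose[OF continuous_map_N[OF assms(3)]
          continuous_map_A[OF assms(1)]] continuous_map_M[OF assms(2)]])
  then have "bar_ext e g None = (map_option m \<circ> (map_option (act_A t) \<circ> map_option n)) None"
    by (rule bar_ext_eqI) (simp_all add: g)
  then show ?thesis by simp
qed

lemma bar_ext_NsMAN:
  assumes "0 < t" "n1 \<in> N_maps J e" "m \<in> M_maps J e" "n2 \<in> N_maps J e"
    and g: "\<And>z. z \<in> D \<Longrightarrow> g z = n1 (\<sigma> (m (act_A t (n2 z))))"
  shows "bar_ext e g None = Some (n1 (0, 0))"
proof -
  let ?h = "map_option n1 \<circ> (bar_inversion \<circ> (map_option m \<circ> (map_option (act_A t) \<circ> map_option n2)))"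
  have "continuous_map Dbar_top Dbar_top ?h"
    by (rule continuous_map_compose[OF continuous_map_compose[OF continuous_map_compose[OF
          continuous_map_compose[OF continuous_map_N[OF assms(4)] continuous_map_A[OF assms(1)]]
          continuous_map_M[OF assms(3)]] continuous_map_inversion] continuous_map_N[OF assms(2)]])
  then have "bar_ext e g None = ?h None"
  proof (rule bar_ext_eqI)
    fix z assume z: "z \<in> D"
    have "act_A t (n2 z) \<in> D" using assms z by (auto simp: N_maps_def intro: act_A_D act_N_D)
    then have "fst (m (act_A t (n2 z))) \<noteq> 0"
      using fst_nonzero[of "act_A t (n2 z)"] norm_fst_M[OF assms(3)] by (metis norm_eq_zero)
    then show "?h (Some z) = Some (g z)" by (simp add: bar_inversion_def g[OF z] del: act_A.simps geod_inversion.simps)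
  qed simp
  then show ?thesis by (simp add: bar_inversion_def)
qed

section \<open>The isometry group\<close>

abbreviation "G \<equiv> isom_group J e"
abbreviation "Ginf \<equiv> G_infty J e"

lemma carrier_G: "g \<in> carrier G \<longleftrightarrow> g \<in> extensional D \<and> bij_betw g D D \<and> riemannian_isometry J e g"
  by (auto simp: isom_group_def Bij_def)

lemma carrier_preserves_Phi: "g \<in> carrier G \<Longrightarrow> preserves_Phi g"
  by (simp add: carrier_G preserves_Phi_isometry)

lemma carrier_D: "g \<in> carrier G \<Longrightarrow> z \<in> D \<Longrightarrow> g z \<in> D"
  using preserves_PhiD(1)[OF carrier_preserves_Phi] .

lemma mult_G: "f \<in> carrier G \<Longrightarrow> g \<in> carrier G \<Longrightarrow> f \<otimes>\<^bsub>G\<^esub> g = compose D f g"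
  by (simp add: isom_group_def BijGroup_def)

lemma one_G: "\<one>\<^bsub>G\<^esub> = (\<lambda>z\<in>D. z)"
  by (simp add: isom_group_def BijGroup_def)

text \<open>
  The description defining \<open>m_inv\<close> is solved directly: \<open>G\<close> is closed under inverses by
  \<open>riemannian_isometry_inverse\<close>, and any inverse in \<open>G\<close> agrees with the inverse function on \<open>D\<close>.
\<close>
lemma inv_G:
  assumes g: "g \<in> carrier G"
  shows "m_inv G g = (\<lambda>z\<in>D. inv_into D g z)" "m_inv G g \<in> carrier G"
proof -
  let ?h = "\<lambda>z\<in>D. inv_into D g z"
  have bij: "bij_betw g D D" using g by (simp add: carrier_G)
  have iso: "riemannian_isometry J e ?h"
    by (rule riemannian_isometry_inverse[of g]) (use g in \<open>simp_all add: carrier_G\<close>)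
  then have h: "?h \<in> carrier G"
    by (simp add: carrier_G riemannian_isometry_def)
  have inv: "g (inv_into D g z) = z" "inv_into D g (g z) = z" "inv_into D g z \<in> D" if "z \<in> D" for z
    using that bij bij_betw_inv_into_right[OF bij that] bij_betw_inv_into_left[OF bij that]
      bij_betwE[OF bij_betw_inv_into[OF bij]] by auto
  have "m_inv G g = ?h"
    unfolding m_inv_def
  proof (rule the_equality)
    show "?h \<in> carrier G \<and> g \<otimes>\<^bsub>G\<^esub> ?h = \<one>\<^bsub>G\<^esub> \<and> ?h \<otimes>\<^bsub>G\<^esub> g = \<one>\<^bsub>G\<^esub>"
      using h g carrier_D[OF g] inv by (auto simp: mult_G one_G compose_def fun_eq_iff)
  next
    fix y assume y: "y \<in> carrier G \<and> g \<otimes>\<^bsub>G\<^esub> y = \<one>\<^bsub>G\<^esub> \<and> y \<otimes>\<^bsub>G\<^esub> g = \<one>\<^bsub>G\<^esub>"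
    show "y = ?h"
    proof (rule extensionalityI[of _ D])
      fix z assume z: "z \<in> D"
      have y1: "y \<in> carrier G" "g \<otimes>\<^bsub>G\<^esub> y = \<one>\<^bsub>G\<^esub>" using y by blast+
      have "compose D g y = (\<lambda>z\<in>D. z)" using y1(2) unfolding mult_G[OF g y1(1)] one_G .
      then have "compose D g y z = z" using z by simp
      then have "g (y z) = z" using z by (simp add: compose_def)
      moreover have "y z \<in> D" using y z carrier_D by blast
      ultimately show "y z = ?h z" using z inv(2)[of "y z"] by simp
    qed (use y in \<open>auto simp: carrier_G\<close>)
  qed
  then show "m_inv G g = ?h" "m_inv G g \<in> carrier G" using h by auto
qed

lemma inv_G_apply:
  assumes g: "g \<in> carrier G" and z: "z \<in> D"
  shows "m_inv G g (g z) = z" "g (m_inv G g z) = z"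
proof -
  have bij: "bij_betw g D D" using g by (simp add: carrier_G)
  show "m_inv G g (g z) = z" "g (m_inv G g z) = z"
    using carrier_D[OF g z] z bij_betw_inv_into_right[OF bij z] bij_betw_inv_into_left[OF bij z]
    by (simp_all add: inv_G(1)[OF g])
qed

lemma act_N_fst_axis:
  assumes "Z \<in> C_im e"
  shows "(norm (fst (act_N J e Z X (s *\<^sub>R e, 0))))\<^sup>2 = (s + (norm X)\<^sup>2 / 4)\<^sup>2 + (norm Z)\<^sup>2"
proof -
  have "fst (act_N J e Z X (s *\<^sub>R e, 0)) = (s + (norm X)\<^sup>2 / 4) *\<^sub>R e + Z"
    by (simp add: algebra_simps)
  then show ?thesis using norm_re_plus_im[OF assms] by (simp only:)
qed

lemma axis_D: "0 < s \<Longrightarrow> (s *\<^sub>R e, 0) \<in> D"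
  by (simp add: mem_D hgt_eq)

text \<open>
  On the axis, \<open>|fst (n (s, 0))|\<^sup>2\<close> is a monic quadratic polynomial in \<open>s\<close>, so the factor can be read off
  from its values at three points. This makes \<open>isom_radius\<close> well defined.
\<close>
lemma N_fst_unique:
  assumes n: "n \<in> N_maps J e" "n' \<in> N_maps J e"
    and eq: "\<And>z. z \<in> D \<Longrightarrow> t * (norm (fst (n z)))\<^sup>2 = t' * (norm (fst (n' z)))\<^sup>2"
  shows "t = t'"
proof -
  obtain Z X Z' X' where Z: "Z \<in> C_im e" "Z' \<in> C_im e" and n: "n = act_N J e Z X" "n' = act_N J e Z' X'"
    using n by (auto simp: N_maps_def)
  define x x' y y' where "x = (norm X)\<^sup>2 / 4" "x' = (norm X')\<^sup>2 / 4" "y = (norm Z)\<^sup>2" "y' = (norm Z')\<^sup>2"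
  have *: "t * ((s + x)\<^sup>2 + y) = t' * ((s + x')\<^sup>2 + y')" if "s > 0" for s
    using eq[OF axis_D[OF that]] Z by (simp only: n act_N_fst_axis x_x'_y_y'_def)
  show ?thesis
    using *[of 1] *[of 2] *[of 3] by (simp add: power2_eq_square algebra_simps)
qed

lemma N_fst_not_constant:
  assumes n: "n \<in> N_maps J e"
  shows "\<not> (\<forall>z\<in>D. (norm (fst (n z)))\<^sup>2 = k)"
proof
  assume k: "\<forall>z\<in>D. (norm (fst (n z)))\<^sup>2 = k"
  obtain Z X where Z: "Z \<in> C_im e" and n: "n = act_N J e Z X" using n by (auto simp: N_maps_def)
  define x where "x = (norm X)\<^sup>2 / 4"
  have x: "x \<ge> 0" by (simp add: x_def)
  have *: "(s + x)\<^sup>2 + (norm Z)\<^sup>2 = k" if "s > 0" for s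
    using k[rule_format, OF axis_D[OF that]] Z by (simp only: n act_N_fst_axis x_def)
  have "(1 + x)\<^sup>2 = (2 + x)\<^sup>2" using *[of 1] *[of 2] by simp
  then show False using x by (simp add: power2_eq_square algebra_simps)
qed

lemma hgt_N: "n \<in> N_maps J e \<Longrightarrow> hgt (n z) = hgt z"
  by (auto simp: N_maps_def hgt_act_N)

lemma hgt_NsMAN:
  assumes "0 < t" "n1 \<in> N_maps J e" "m \<in> M_maps J e" "n2 \<in> N_maps J e" "z \<in> D"
  shows "hgt (n1 (\<sigma> (m (act_A t (n2 z))))) = hgt z / (t * (norm (fst (n2 z)))\<^sup>2)"
proof -
  let ?y = "m (act_A t (n2 z))"
  have h: "hgt ?y = t * hgt z" using assms by (simp add: hgt_M hgt_act_A hgt_N)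
  then have "?y \<in> D" using assms by (simp add: mem_D)
  then have "hgt (\<sigma> ?y) = t * hgt z / (norm (fst ?y))\<^sup>2"
    using hgt_inversion[OF fst_nonzero] h by simp
  also have "norm (fst ?y) = t * norm (fst (n2 z))" using assms by (simp add: norm_fst_M)
  finally show ?thesis using assms by (simp add: hgt_N power_mult_distrib power2_eq_square)
qed

text \<open>
  The two cases of \<open>isometry_decomposition\<close> are distinguished by the image of \<open>\<infinity>\<close>.
\<close>
lemma isometry_cases:
  assumes g: "g \<in> carrier G"
  obtains (scaling) t where "0 < t" "g \<in> Ginf" "\<And>z. z \<in> D \<Longrightarrow> hgt (g z) = t * hgt z"
  | (moving) t n1 m n2 where "0 < t" "n1 \<in> N_maps J e" "m \<in> M_maps J e" "n2 \<in> N_maps J e" "g \<notin> Ginf"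
    "\<And>z. z \<in> D \<Longrightarrow> g z = n1 (\<sigma> (m (act_A t (n2 z))))"
    "bar_ext e g None = Some (n1 (0, 0))"
  using isometry_decomposition[OF carrier_preserves_Phi[OF g]]
proof (elim disjE exE bexE conjE)
  fix t m n assume *: "0 < t" "m \<in> M_maps J e" "n \<in> N_maps J e" "\<forall>z\<in>D. g z = m (act_A t (n z))"
  have "bar_ext e g None = None" by (rule bar_ext_MAN[OF *(1,2,3)]) (use *(4) in blast)
  then have "g \<in> Ginf" using g by (simp add: G_infty_def)
  moreover have "hgt (g z) = t * hgt z" if "z \<in> D" for z
    using that * by (simp add: hgt_M hgt_act_A hgt_N)
  ultimately show thesis using scaling[of t] *(1) by blast
next
  fix t n1 m n2 assume *: "0 < t" "n1 \<in> N_maps J e" "m \<in> M_maps J e" "n2 \<in> N_maps J e"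
    "\<forall>z\<in>D. g z = n1 (\<sigma> (m (act_A t (n2 z))))"
  have b: "bar_ext e g None = Some (n1 (0, 0))" by (rule bar_ext_NsMAN[OF *(1-4)]) (use *(5) in blast)
  then have "g \<notin> Ginf" by (simp add: G_infty_def)
  then show thesis using moving[OF *(1-4) _ _ b] *(5) by blast
qed

text \<open>
  If \<open>g\<close> moves \<open>\<infinity>\<close>, the factor \<open>1 / (t |fst (n2 z)|\<^sup>2)\<close> by which it changes heights is not constant. With this
  criterion, products and inverses of elements of the stabilizer are treated by multiplying and inverting
  factors.
\<close>
lemma G_infty_iff_scales_height:
  assumes g: "g \<in> carrier G"
  shows "g \<in> Ginf \<longleftrightarrow> (\<exists>k>0. \<forall>z\<in>D. hgt (g z) = k * hgt z)"
  using g
proof (cases rule: isometry_cases)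
  case (scaling t)
  then show ?thesis by blast
next
  case (moving t n1 m n2)
  have False if k: "k > 0" "\<forall>z\<in>D. hgt (g z) = k * hgt z" for k
  proof -
    have "(norm (fst (n2 z)))\<^sup>2 = 1 / (t * k)" if z: "z \<in> D" for z
    proof -
      have "hgt z / (t * (norm (fst (n2 z)))\<^sup>2) = k * hgt z"
        using k(2)[rule_format, OF z] hgt_NsMAN[OF moving(1-4) z] unfolding moving(6)[OF z] by (rule trans[OF sym, rotated])
      moreover have "n2 z \<in> D" using z moving(4) by (simp add: mem_D hgt_N)
      ultimately show ?thesis
        using z moving(1) k(1) fst_nonzero[of "n2 z"] by (simp add: mem_D field_simps)
    qed
    then show False using N_fst_not_constant[OF moving(4)] by blast
  qed
  then show ?thesis using moving(5) by blast
qed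

lemma inv_not_G_infty:
  assumes g: "g \<in> carrier G" "g \<notin> Ginf" shows "m_inv G g \<notin> Ginf"
proof
  assume "m_inv G g \<in> Ginf"
  then obtain k where k: "k > 0" "\<forall>z\<in>D. hgt (m_inv G g z) = k * hgt z"
    using G_infty_iff_scales_height[OF inv_G(2)[OF g(1)]] by blast
  have "hgt (g z) = (1/k) * hgt z" if z: "z \<in> D" for z
    using k(2)[rule_format, OF carrier_D[OF g(1) z]] inv_G_apply(1)[OF g(1) z] k(1) by simp
  then show False using g G_infty_iff_scales_height[OF g(1)] k(1) by (metis zero_less_divide_1_iff)
qed

section \<open>Isometric spheres\<close>

lemma cygan_boundary:
  assumes z: "z \<in> D" and c: "hgt c = 0"
  shows "cygan J e z c = sqrt (norm (pht z c))"
proof -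
  obtain \<zeta> v \<eta> u where [simp]: "z = (\<zeta>, v)" "c = (\<eta>, u)" by (cases z, cases c)
  have h: "hgt z = e \<bullet> \<zeta> - (norm v)\<^sup>2 / 4" "hgt c = e \<bullet> \<eta> - (norm u)\<^sup>2 / 4" by (simp_all add: hgt_eq)
  have "1/4 * (norm v)\<^sup>2 + 1/4 * (norm u)\<^sup>2 + \<bar>hgt z - hgt c\<bar> = e \<bullet> \<zeta> + e \<bullet> \<eta>"
    using z c h by (simp add: mem_D)
  then have "cygan J e z c = sqrt (norm ((e \<bullet> \<zeta> + e \<bullet> \<eta>) *\<^sub>R e + im_part e \<zeta> - im_part e \<eta> - (1/2) *\<^sub>R \<beta> v u))"
    by simp
  also have "(e \<bullet> \<zeta> + e \<bullet> \<eta>) *\<^sub>R e + im_part e \<zeta> - im_part e \<eta> = \<zeta> + cnj \<eta>"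
    by (simp add: im_part_eq cnj_eq algebra_simps scaleR_2 flip: scaleR_add_left)
  finally show ?thesis by (simp add: pht_def)
qed

text \<open>
  The height formula, with \<open>\<rho>(z, g\<^sup>-\<^sup>1 \<infinity>)\<^sup>2 = |fst (n z)|\<close>. The map \<open>n\<close> that moves the centre \<open>g\<^sup>-\<^sup>1 \<infinity>\<close> to \<open>0\<close>
  is taken from the decomposition of \<open>g\<^sup>-\<^sup>1\<close>, where the centre is visible, while \<open>isom_radius\<close>
  is defined by the decomposition of \<open>g\<close>; the two parameters \<open>t\<close> agree by \<open>N_fst_unique\<close>.
\<close>
lemma isometric_sphere_form:
  assumes g: "g \<in> carrier G" "g \<notin> Ginf"
  obtains t n where "0 < t" "n \<in> N_maps J e" "isom_radius J e g = t powr (- 1/4)"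
    "\<And>z. z \<in> D \<Longrightarrow> cygan J e z (isom_center J e g) = sqrt (norm (fst (n z)))"
    "\<And>z. z \<in> D \<Longrightarrow> hgt (g z) = hgt z / (t * (norm (fst (n z)))\<^sup>2)"
proof -
  let ?gi = "m_inv G g"
  from inv_G(2)[OF g(1)] show thesis
  proof (cases rule: isometry_cases)
    case (scaling t)
    then show thesis using inv_not_G_infty[OF g] by blast
  next
    case (moving t n1 m n2)
    obtain Z X where Z: "Z \<in> C_im e" and n1: "n1 = act_N J e Z X" using moving(2) by (auto simp: N_maps_def)
    define n where "n = act_N J e (- Z) (- X)"
    have n: "n \<in> N_maps J e" using Z by (auto simp: N_maps_def n_def)
    define c where "c = n1 (0, 0)"
    have cen: "isom_center J e g = c" by (simp add: isom_center_def moving(7) c_def)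
    have nc: "n c = (0, 0)" using Z by (simp only: n_def c_def n1 act_N_inverse)
    have hc: "hgt c = 0" unfolding c_def hgt_N[OF moving(2)] by (simp add: hgt_eq)
    have cyg: "cygan J e z (isom_center J e g) = sqrt (norm (fst (n z)))" if z: "z \<in> D" for z
    proof -
      have "pht z c = pht (n z) (n c)" using Z by (simp only: n_def pht_act_N neg_C_im)
      then have "pht z c = fst (n z)" by (simp add: nc pht_def)
      then show ?thesis by (simp add: cen cygan_boundary[OF z hc])
    qed
    have ht: "hgt (g z) = hgt z / (t * (norm (fst (n z)))\<^sup>2)" if z: "z \<in> D" for z
    proof -
      let ?w = "g z"
      have w: "?w \<in> D" by (rule carrier_D[OF g(1) z])
      define y where "y = m (act_A t (n2 ?w))"
      have hy: "hgt y = t * hgt ?w" using moving(1-4) by (simp add: y_def hgt_M hgt_act_A hgt_N)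
      then have y: "y \<in> D" using w moving(1) by (simp add: mem_D)
      have "z = n1 (\<sigma> y)" using moving(6)[OF w] inv_G_apply(1)[OF g(1) z] by (simp add: y_def)
      then have nz: "n z = \<sigma> y" using Z by (simp only: n_def n1 act_N_inverse)
      have "hgt z = hgt (n z)" using hgt_N[OF n] by simp
      also have "\<dots> = t * hgt ?w / (norm (fst y))\<^sup>2" using hgt_inversion[OF fst_nonzero[OF y]] by (simp only: nz hy)
      also have "\<dots> = t * hgt ?w * (norm (fst (n z)))\<^sup>2"
        by (simp add: nz norm_inv_C power_divide)
      finally have "hgt z = t * hgt ?w * (norm (fst (n z)))\<^sup>2" .
      moreover have "fst (n z) \<noteq> 0" using fst_nonzero[OF inversion_D[OF y]] unfolding nz .
      ultimately show ?thesis using moving(1) by (simp add: field_simps)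
    qed
    have same: "t' = t" if "0 < t'" "n1' \<in> N_maps J e" "m' \<in> M_maps J e" "n2' \<in> N_maps J e"
      "\<forall>z\<in>D. g z = n1' (\<sigma> (m' (act_A t' (n2' z))))" for t' n1' m' n2'
    proof (rule N_fst_unique[OF that(4) n])
      fix z assume z: "z \<in> D"
      have "hgt z / (t' * (norm (fst (n2' z)))\<^sup>2) = hgt z / (t * (norm (fst (n z)))\<^sup>2)"
        using hgt_NsMAN[OF that(1-4) z] that(5) z ht[OF z] by simp
      then show "t' * (norm (fst (n2' z)))\<^sup>2 = t * (norm (fst (n z)))\<^sup>2"
        using z by (simp add: mem_D)
    qed
    have "isom_radius J e g = t powr (- 1/4)"
      unfolding isom_radius_def
    proof (rule the_equality)
      show "\<exists>t'>0. t powr (- 1/4) = t' powr (- 1/4) \<and>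
        (\<exists>n1\<in>N_maps J e. \<exists>m\<in>M_maps J e. \<exists>n2\<in>N_maps J e. \<forall>z\<in>D. g z = n1 (\<sigma> (m (act_A t' (n2 z)))))"
        using g(1)
      proof (cases rule: isometry_cases)
        case (scaling k)
        then show ?thesis using g(2) by blast
      next
        case (moving t' n1' m' n2')
        have "t' = t" by (rule same[OF moving(1-4)]) (use moving(6) in blast)
        then show ?thesis using moving(1-4,6) by blast
      qed
    next
      fix r assume "\<exists>t'>0. r = t' powr (- 1/4) \<and>
        (\<exists>n1\<in>N_maps J e. \<exists>m\<in>M_maps J e. \<exists>n2\<in>N_maps J e. \<forall>z\<in>D. g z = n1 (\<sigma> (m (act_A t' (n2 z)))))"
      then show "r = t powr (- 1/4)" using same by blast
    qed
    then show thesis using that[OF moving(1) n _ cyg ht] by blast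
  qed
qed

lemma radius_less_iff:
  assumes "0 < t" "0 \<le> x"
  shows "t powr (- 1/4) < sqrt x \<longleftrightarrow> 1 < t * x\<^sup>2"
proof -
  have "(t powr (- 1/4)) ^ 4 = t powr (- 1)"
    using assms(1) by (simp add: power4_eq_xxxx flip: powr_add)
  then have p: "(t powr (- 1/4)) ^ 4 = 1 / t"
    using assms(1) by (simp add: powr_minus_divide)
  have q: "(sqrt x) ^ 4 = x\<^sup>2"
    using assms(2) by (simp add: power4_eq_xxxx power2_eq_square flip: mult.assoc)
  have "t powr (- 1/4) < sqrt x \<longleftrightarrow> (t powr (- 1/4)) ^ 4 < (sqrt x) ^ 4"
    using assms by (simp add: power_mono_iff flip: not_le)
  also have "\<dots> \<longleftrightarrow> 1 / t < x\<^sup>2" by (simp only: p q)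
  also have "\<dots> \<longleftrightarrow> 1 < t * x\<^sup>2" using assms(1) by (simp add: pos_divide_less_eq mult.commute)
  finally show ?thesis .
qed

lemma isom_ext_iff:
  assumes g: "g \<in> carrier G" "g \<notin> Ginf"
  shows "z \<in> isom_ext J e g \<longleftrightarrow> z \<in> D \<and> hgt (g z) < hgt z"
proof (cases "z \<in> D")
  case True
  obtain t n where tn: "0 < t" "n \<in> N_maps J e" "isom_radius J e g = t powr (- 1/4)"
    "\<And>z. z \<in> D \<Longrightarrow> cygan J e z (isom_center J e g) = sqrt (norm (fst (n z)))"
    "\<And>z. z \<in> D \<Longrightarrow> hgt (g z) = hgt z / (t * (norm (fst (n z)))\<^sup>2)"
    using isometric_sphere_form[OF g] by metis
  have "n z \<in> D" using True tn(2) by (simp add: mem_D hgt_N)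
  then have "0 < t * (norm (fst (n z)))\<^sup>2" using fst_nonzero[of "n z"] tn(1) by simp
  then have "hgt (g z) < hgt z \<longleftrightarrow> 1 < t * (norm (fst (n z)))\<^sup>2"
    using True by (simp add: tn(5)[OF True] mem_D pos_divide_less_eq)
  then show ?thesis
    using True radius_less_iff[OF tn(1) norm_ge_zero, of "fst (n z)"]
    by (simp add: isom_ext_def tn(3) tn(4)[OF True])
qed (simp add: isom_ext_def)

text \<open>
  Moving \<open>z\<close> vertically upwards leaves the isometric sphere strictly, since this increases the real part of
  \<open>fst (n z)\<close>, which is positive.
\<close>
lemma closure_isom_ext:
  assumes g: "g \<in> carrier G" "g \<notin> Ginf" and z: "z \<in> D" and le: "hgt (g z) \<le> hgt z"
  shows "z \<in> D_closure e (isom_ext J e g)"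
proof -
  obtain t n where tn: "0 < t" "n \<in> N_maps J e" "isom_radius J e g = t powr (- 1/4)"
    "\<And>z. z \<in> D \<Longrightarrow> cygan J e z (isom_center J e g) = sqrt (norm (fst (n z)))"
    "\<And>z. z \<in> D \<Longrightarrow> hgt (g z) = hgt z / (t * (norm (fst (n z)))\<^sup>2)"
    using isometric_sphere_form[OF g] by metis
  have nz: "n z \<in> D" using z tn(2) by (simp add: mem_D hgt_N)
  then have "0 < t * (norm (fst (n z)))\<^sup>2" using fst_nonzero[of "n z"] tn(1) by simp
  then have ge: "1 \<le> t * (norm (fst (n z)))\<^sup>2"
    using z le by (simp add: tn(5)[OF z] mem_D pos_divide_le_eq)
  have "\<exists>w\<in>isom_ext J e g. dist w z < d" if d: "d > 0" for d
  proof -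
    define w where "w = (fst z + (d/2) *\<^sub>R e, snd z)"
    have dist: "dist w z < d" using d(1) by (simp add: w_def dist_prod_def dist_norm)
    have w: "w \<in> D" using z d unfolding w_def mem_D hgt_add_e by simp
    have "fst (n w) = fst (n z) + (d/2) *\<^sub>R e"
      using tn(2) by (auto simp: N_maps_def w_def)
    then have "(norm (fst (n w)))\<^sup>2 = (norm (fst (n z)))\<^sup>2 + d * (e \<bullet> fst (n z)) + (d/2)\<^sup>2"
      by (simp add: power2_norm_eq_inner inner_add inner_commute power2_eq_square[of "d/2"])
    moreover have "0 < e \<bullet> fst (n z)"
    proof -
      have "0 < hgt (n z)" using nz by (simp add: mem_D)
      then show ?thesis using zero_le_power2[of "norm (snd (n z))"] unfolding hgt_eq by linarith
    qed
    then have "0 < d * (e \<bullet> fst (n z))" using d by simp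
    moreover have "0 \<le> (d/2)\<^sup>2" by simp
    ultimately have "(norm (fst (n z)))\<^sup>2 < (norm (fst (n w)))\<^sup>2" by linarith
    then have "t * (norm (fst (n z)))\<^sup>2 < t * (norm (fst (n w)))\<^sup>2" using tn(1) by simp
    then have "1 < t * (norm (fst (n w)))\<^sup>2" using ge by linarith
    then have "w \<in> isom_ext J e g"
      using w radius_less_iff[OF tn(1) norm_ge_zero, of "fst (n w)"]
      by (simp add: isom_ext_def tn(3) tn(4)[OF w])
    then show ?thesis using dist by blast
  qed
  then show ?thesis using z by (auto simp: D_closure_def closure_approachable)
qed

section \<open>The fundamental region\<close>

text \<open>
  If \<open>f\<close> fixes \<open>\<infinity>\<close> and \<open>g\<close> moves it, then \<open>f g\<close> moves it and \<open>f = (f g) g\<^sup>-\<^sup>1\<close>.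
\<close>
lemma generate_moving_elements:
  assumes \<Gamma>: "subgroup \<Gamma> G" and ne: "\<Gamma> - Ginf \<noteq> {}"
  shows "generate G (\<Gamma> - Ginf) = \<Gamma>"
proof
  show "generate G (\<Gamma> - Ginf) \<subseteq> \<Gamma>"
  proof
    fix x assume "x \<in> generate G (\<Gamma> - Ginf)"
    then show "x \<in> \<Gamma>"
      by induction (use \<Gamma> in \<open>auto intro: subgroup.one_closed subgroup.m_closed subgroup.m_inv_closed\<close>)
  qed
  have car: "g \<in> carrier G" if "g \<in> \<Gamma>" for g using subgroup.subset[OF \<Gamma>] that by blast
  obtain g where g: "g \<in> \<Gamma>" "g \<notin> Ginf" using ne by blast
  show "\<Gamma> \<subseteq> generate G (\<Gamma> - Ginf)"
  proof
    fix f assume f: "f \<in> \<Gamma>"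
    show "f \<in> generate G (\<Gamma> - Ginf)"
    proof (cases "f \<in> Ginf")
      case False
      then show ?thesis using f by (intro generate.incl) simp
    next
      case True
      let ?fg = "f \<otimes>\<^bsub>G\<^esub> g"
      have fg: "?fg \<in> \<Gamma>" using f g \<Gamma> by (intro subgroup.m_closed)
      have app: "?fg z = f (g z)" if "z \<in> D" for z
        using that car[OF f] car[OF g(1)] by (simp add: mult_G compose_def)
      obtain k where k: "k > 0" "\<forall>z\<in>D. hgt (f z) = k * hgt z"
        using True G_infty_iff_scales_height[OF car[OF f]] by blast
      have "?fg \<notin> Ginf"
      proof
        assume "?fg \<in> Ginf"
        then obtain l where l: "l > 0" "\<forall>z\<in>D. hgt (?fg z) = l * hgt z"
          using G_infty_iff_scales_height[OF car[OF fg]] by blast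
        have "hgt (g z) = (l / k) * hgt z" if z: "z \<in> D" for z
        proof -
          have "k * hgt (g z) = l * hgt z"
            using k(2)[rule_format, OF carrier_D[OF car[OF g(1)] z]] l(2)[rule_format, OF z] by (simp add: app z)
          then show ?thesis using k(1) by (simp add: field_simps)
        qed
        moreover have "l / k > 0" using k l by simp
        ultimately show False using g(2) G_infty_iff_scales_height[OF car[OF g(1)]] by blast
      qed
      then have 1: "?fg \<in> generate G (\<Gamma> - Ginf)" using fg by (intro generate.incl) simp
      have 2: "m_inv G g \<in> generate G (\<Gamma> - Ginf)" using g by (intro generate.inv) simp
      have "f = ?fg \<otimes>\<^bsub>G\<^esub> m_inv G g"
      proof (rule extensionalityI[of _ D])
        have m: "?fg \<otimes>\<^bsub>G\<^esub> m_inv G g = compose D ?fg (m_inv G g)"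
          by (rule mult_G[OF car[OF fg] inv_G(2)[OF car[OF g(1)]]])
        then show "?fg \<otimes>\<^bsub>G\<^esub> m_inv G g \<in> extensional D" by simp
        show "f \<in> extensional D" using car[OF f] by (simp add: carrier_G)
        fix z assume z: "z \<in> D"
        show "f z = (?fg \<otimes>\<^bsub>G\<^esub> m_inv G g) z"
          using z carrier_D[OF inv_G(2)[OF car[OF g(1)]] z] inv_G_apply(2)[OF car[OF g(1)] z]
          by (simp add: m compose_def app)
      qed
      then show ?thesis using generate.eng[OF 1 2] by simp
    qed
  qed
qed

lemma fundamental_region_of_exteriors:
  assumes \<Gamma>: "subgroup \<Gamma> G" and O: "type_O J e \<Gamma>" and F: "type_F J e (\<Gamma> - Ginf)"
    and fund: "fundamental_region e (\<Gamma> \<inter> Ginf) F_inf"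
    and clos: "D_closure e F_inf \<inter> (\<Inter>g\<in>\<Gamma> - Ginf. D_closure e (isom_ext J e g))
           = D_closure e (F_inf \<inter> (\<Inter>g\<in>\<Gamma> - Ginf. isom_ext J e g))"
  shows "fundamental_region e \<Gamma> (F_inf \<inter> (\<Inter>g\<in>\<Gamma> - Ginf. isom_ext J e g))"
proof -
  let ?F = "F_inf \<inter> (\<Inter>g\<in>\<Gamma> - Ginf. isom_ext J e g)"
  have car: "g \<in> carrier G" if "g \<in> \<Gamma>" for g using subgroup.subset[OF \<Gamma>] that by blast
  have mult: "g \<otimes>\<^bsub>G\<^esub> h \<in> \<Gamma>" if "g \<in> \<Gamma>" "h \<in> \<Gamma>" for g h using subgroup.m_closed[OF \<Gamma>] that .
  have inv: "m_inv G g \<in> \<Gamma>" if "g \<in> \<Gamma>" for g using subgroup.m_inv_closed[OF \<Gamma>] that .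
  have app: "(g \<otimes>\<^bsub>G\<^esub> h) z = g (h z)" if "g \<in> \<Gamma>" "h \<in> \<Gamma>" "z \<in> D" for g h z
    using that car by (simp add: mult_G compose_def)
  note region = fund[unfolded fundamental_region_def]
  have op: "open F_inf" by (rule region[THEN conjunct1])
  have sub: "F_inf \<subseteq> D" by (rule region[THEN conjunct2, THEN conjunct1])
  have disj: "\<forall>g\<in>\<Gamma> \<inter> Ginf. \<forall>h\<in>\<Gamma> \<inter> Ginf. g \<noteq> h \<longrightarrow> g ` F_inf \<inter> h ` F_inf = {}"
    by (rule region[THEN conjunct2, THEN conjunct2, THEN conjunct1])
  have cov: "D = (\<Union>g\<in>\<Gamma> \<inter> Ginf. g ` D_closure e F_inf)"
    by (rule region[THEN conjunct2, THEN conjunct2, THEN conjunct2])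
  show ?thesis
  proof (cases "\<Gamma> - Ginf = {}")
    case True
    then have "\<Gamma> \<inter> Ginf = \<Gamma>" by blast
    then have "fundamental_region e \<Gamma> F_inf" using fund by (simp only:)
    then show ?thesis unfolding True by simp
  next
    case False
    have gen: "generate G (\<Gamma> - Ginf) = \<Gamma>" by (rule generate_moving_elements[OF \<Gamma> False])
    have max: "\<exists>g\<in>\<Gamma>. \<forall>h\<in>\<Gamma>. hgt (h z) \<le> hgt (g z)" if "z \<in> D" for z
      using F that unfolding type_F_def gen by blast
    \<comment> \<open>\<open>k\<close> multiplies heights by a constant \<open>c\<close>; applied to a highest point of an orbit, \<open>k\<close> gives
      \<open>c \<le> 1\<close> and its inverse gives \<open>c \<ge> 1\<close>.\<close>
    have height: "hgt (k z) = hgt z" if k: "k \<in> \<Gamma> \<inter> Ginf" and z: "z \<in> D" for k z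
    proof -
      obtain c where c: "c > 0" "\<forall>z\<in>D. hgt (k z) = c * hgt z"
        using k G_infty_iff_scales_height[OF car] by blast
      obtain g where g: "g \<in> \<Gamma>" "\<forall>h\<in>\<Gamma>. hgt (h z) \<le> hgt (g z)" using max[OF z] by blast
      let ?w = "g z"
      have w: "?w \<in> D" by (rule carrier_D[OF car[OF g(1)] z])
      then have w0: "0 < hgt ?w" by (simp add: mem_D)
      have k': "k \<in> \<Gamma>" using k by blast
      have "c * hgt ?w = hgt ((k \<otimes>\<^bsub>G\<^esub> g) z)" using c(2) w app[OF k' g(1) z] by simp
      also have "\<dots> \<le> hgt ?w" using g(2) mult[OF k' g(1)] by blast
      finally have c1: "c \<le> 1" using w0 by simp
      let ?u = "m_inv G k ?w"
      have u: "?u \<in> D" by (rule carrier_D[OF inv_G(2)[OF car[OF k']] w])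
      have "hgt ?u = hgt ((m_inv G k \<otimes>\<^bsub>G\<^esub> g) z)" using app[OF inv[OF k'] g(1) z] by simp
      also have "\<dots> \<le> hgt ?w" using g(2) mult[OF inv[OF k'] g(1)] by blast
      also have "hgt ?w = c * hgt ?u"
        using c(2) u inv_G_apply(2)[OF car[OF k'] w] by metis
      finally have "1 \<le> c" using u by (simp add: mem_D)
      with c1 c(2) z show ?thesis by simp
    qed
    show ?thesis
      unfolding fundamental_region_def
    proof (intro conjI ballI impI)
      have "?F = F_inf \<inter> (D \<inter> (\<Inter>g\<in>\<Gamma> - Ginf. isom_ext J e g))" using sub by blast
      also have "\<dots> = F_inf \<inter> (D - (D \<inter> closure (\<Union>g\<in>\<Gamma> - Ginf. isom_int J e g)))"
        using O by (simp only: type_O_def D_closure_def)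
      also have "\<dots> = F_inf - closure (\<Union>g\<in>\<Gamma> - Ginf. isom_int J e g)"
        using sub by blast
      finally show "open ?F" using op by (simp add: open_Diff)
      show "?F \<subseteq> D" using sub by blast
    next
      fix g h assume gh: "g \<in> \<Gamma>" "h \<in> \<Gamma>" "g \<noteq> h"
      show "g ` ?F \<inter> h ` ?F = {}"
      proof (rule ccontr)
        assume "g ` ?F \<inter> h ` ?F \<noteq> {}"
        then obtain x y where xy: "x \<in> ?F" "y \<in> ?F" "g x = h y" by blast
        have D': "x \<in> D" "y \<in> D" using xy sub by auto
        let ?k = "m_inv G h \<otimes>\<^bsub>G\<^esub> g"
        have k: "?k \<in> \<Gamma>" using gh inv mult by blast
        have kx: "?k x = y"
          using app[OF inv[OF gh(2)] gh(1) D'(1)] xy(3) inv_G_apply(1)[OF car[OF gh(2)] D'(2)] by simp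
        show False
        proof (cases "?k \<in> Ginf")
          case True
          have one: "\<one>\<^bsub>G\<^esub> \<in> \<Gamma>" by (rule subgroup.one_closed[OF \<Gamma>])
          have "\<exists>c>0. \<forall>z\<in>D. hgt (\<one>\<^bsub>G\<^esub> z) = c * hgt z"
            by (rule exI[of _ 1]) (simp add: one_G)
          then have one': "\<one>\<^bsub>G\<^esub> \<in> Ginf" using G_infty_iff_scales_height[OF car[OF one]] by blast
          have "?k \<noteq> \<one>\<^bsub>G\<^esub>"
          proof
            assume e: "?k = \<one>\<^bsub>G\<^esub>"
            have "g = h"
            proof (rule extensionalityI[of _ D])
              fix z assume z: "z \<in> D"
              have "m_inv G h (g z) = z" using app[OF inv[OF gh(2)] gh(1) z] e z by (simp add: one_G)
              then show "g z = h z"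
                using inv_G_apply(2)[OF car[OF gh(2)] carrier_D[OF car[OF gh(1)] z]] by simp
            qed (use car gh in \<open>auto simp: carrier_G\<close>)
            then show False using gh(3) by blast
          qed
          then have "?k ` F_inf \<inter> \<one>\<^bsub>G\<^esub> ` F_inf = {}"
            using k True one one' by (intro disj[rule_format]) simp_all
          moreover have "y \<in> ?k ` F_inf" using kx xy(1) by blast
          moreover have "y \<in> \<one>\<^bsub>G\<^esub> ` F_inf" using xy(2) D'(2) by (auto simp: one_G image_iff)
          ultimately show False by blast
        next
          case False
          have "hgt y < hgt x"
            using xy(1) k False isom_ext_iff[OF car[OF k] False, of x] kx by blast
          moreover have ki: "m_inv G ?k \<in> \<Gamma> - Ginf"
            using inv[OF k] inv_not_G_infty[OF car[OF k] False] by blast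
          then have "hgt (m_inv G ?k y) < hgt y"
            using xy(2) isom_ext_iff[of "m_inv G ?k" y] car by blast
          then have "hgt x < hgt y"
            using inv_G_apply(1)[OF car[OF k] D'(1)] kx by simp
          ultimately show False by simp
        qed
      qed
    next
      show "D = (\<Union>g\<in>\<Gamma>. g ` D_closure e ?F)"
      proof
        show "(\<Union>g\<in>\<Gamma>. g ` D_closure e ?F) \<subseteq> D"
          using carrier_D car by (auto simp: D_closure_def)
        show "D \<subseteq> (\<Union>g\<in>\<Gamma>. g ` D_closure e ?F)"
        proof
          fix z assume z: "z \<in> D"
          obtain g where g: "g \<in> \<Gamma>" "\<forall>h\<in>\<Gamma>. hgt (h z) \<le> hgt (g z)" using max[OF z] by blast
          have "g z \<in> D" by (rule carrier_D[OF car[OF g(1)] z])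
          then obtain k x where k: "k \<in> \<Gamma> \<inter> Ginf" and x: "x \<in> D_closure e F_inf" "g z = k x"
            using cov by blast
          have xD: "x \<in> D" using x by (simp add: D_closure_def)
          have k': "k \<in> \<Gamma>" using k by blast
          let ?f = "m_inv G k \<otimes>\<^bsub>G\<^esub> g"
          have f: "?f \<in> \<Gamma>" using k' g inv mult by blast
          have fz: "?f z = x"
            using app[OF inv[OF k'] g(1) z] x(2) inv_G_apply(1)[OF car[OF k'] xD] by simp
          have "x \<in> D_closure e (isom_ext J e h)" if h: "h \<in> \<Gamma> - Ginf" for h
          proof (rule closure_isom_ext)
            have h': "h \<in> \<Gamma>" using h by blast
            have "hgt (h x) = hgt ((h \<otimes>\<^bsub>G\<^esub> ?f) z)" using app[OF h' f z] fz by simp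
            also have "\<dots> \<le> hgt (g z)" using g(2) mult[OF h' f] by blast
            also have "\<dots> = hgt x" using height[OF k xD] x(2) by simp
            finally show "hgt (h x) \<le> hgt x" .
          qed (use h car xD in auto)
          then have "x \<in> D_closure e ?F" using x(1) clos by blast
          moreover have "m_inv G ?f x = z" using inv_G_apply(1)[OF car[OF f] z] fz by simp
          ultimately show "z \<in> (\<Union>g\<in>\<Gamma>. g ` D_closure e ?F)" using inv[OF f] by blast
        qed
      qed
    qed
  qed
qed

end

theorem theorem3p18:
  fixes J :: "'c::euclidean_space \<Rightarrow> 'v::real_inner \<Rightarrow> 'v"
    and e :: 'c
    and \<Gamma> :: "('c \<times> 'v \<Rightarrow> 'c \<times> 'v) set"
    and F_inf :: "('c \<times> 'v) set"
  assumes "J2C_module J e"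
    and "\<not> ((UNIV :: 'c set) = span {e} \<and> (UNIV :: 'v set) = {0})"
    and "subgroup \<Gamma> (isom_group J e)"
    and "type_O J e \<Gamma>"
    and "type_F J e (\<Gamma> - G_infty J e)"
    and "fundamental_region e (\<Gamma> \<inter> G_infty J e) F_inf"
    and "D_closure e F_inf \<inter> (\<Inter>g\<in>\<Gamma> - G_infty J e. D_closure e (isom_ext J e g))
           = D_closure e (F_inf \<inter> (\<Inter>g\<in>\<Gamma> - G_infty J e. isom_ext J e g))"
  shows "fundamental_region e \<Gamma> (F_inf \<inter> (\<Inter>g\<in>\<Gamma> - G_infty J e. isom_ext J e g))"
  using assms(3-7)
  by (rule J2C_structure.fundamental_region_of_exteriors[OF J2C_structure.intro[OF assms(1)]])

end
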